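(* Let $D\subseteq\mathbb{C}$ be a domain, let $\mu:D\to\mathbb{C}$ be a measurable function with $|\mu(z)|<1$ a.e., and let $f$ be a homeomorphic $W^{1,1}_{\rm loc}$ solution of the Beltrami equation $f_{\bar z}=\mu(z) f_z$ in $D$. Then $$M(f\Sigma_{\varepsilon})\ \geqslant\ \inf_{\varrho\in{\rm ext\,adm}\,\Sigma_{\varepsilon}}\ \int_{D}\frac{\varrho^2(z)}{K^T_{\mu}(z,z_0)}\,dm(z)$$ for all $z_0\in\overline{D}$, $\varepsilon\in(0,\varepsilon_0)$ and $\varepsilon_0\in(0,d_0)$, where $d_0=\sup_{z\in D}|z-z_0|$ and $\Sigma_{\varepsilon}$ denotes the family of dashed lines consisting of all intersections of the circles $S(z_0,r)=\{z\in\mathbb{C}:|z-z_0|=r\}$, $r\in(\varepsilon,\varepsilon_0)$, with $D$.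
   Context: A domain is a connected open subset of $\mathbb{C}$. A homeomorphic $W^{1,1}_{\rm loc}$ solution $f$ of $f_{\bar z}=\mu f_z$ in $D$ is a homeomorphism of $D$ onto its image in $\mathbb{C}$ belonging to the Sobolev class $W^{1,1}_{\rm loc}(D)$ and satisfying the equation a.e. in $D$, where $f_{\bar z}=(f_x+if_y)/2$, $f_z=(f_x-if_y)/2$. The tangent dilatation with respect to $z_0\in\mathbb{C}$ is $$K^T_{\mu}(z,z_0)=\frac{\left|1-\frac{\overline{z-z_0}}{z-z_0}\,\mu(z)\right|^2}{1-|\mu(z)|^2}.$$ $dm$ is Lebesgue measure in $\mathbb{C}$. A dashed line in a domain is a continuous mapping $\gamma$ of an open subset of the real axis or of a circle into the domain (such an open set is a countable union of disjoint intervals or arcs, and the integral $\int_\gamma\varrho\,ds$ with respect to arc length is the sum of the integrals over the corresponding pieces). For a family $\Gamma$ of dashed lines, a Borel function $\varrho:\mathbb{C}\to[0,\infty]$ is admissible, $\varrho\in{\rm adm}\,\Gamma$, if $\int_\gamma\varrho\,ds\geqslant1$ for all $\gamma\in\Gamma$; the modulus is $M(\Gamma)=\inf_{\varrho\in{\rm adm}\,\Gamma}\int_{\mathbb{C}}\varrho^2\,dm$. A property holds for a.e. $\gamma\in\Gamma$ if the subfamily of all $\gamma\in\Gamma$ for which it fails has modulus zero. A Lebesgue measurable function $\varrho:\mathbb{C}\to[0,\infty]$ is extensively admissible, $\varrho\in{\rm ext\,adm}\,\Gamma$, if $\int_\gamma\varrho\,ds\geqslant1$ for a.e. $\gamma\in\Gamma$.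 $f\Sigma_\varepsilon=\{f\circ\gamma:\gamma\in\Sigma_\varepsilon\}$ is the image family. *)

theory Defs
  imports "HOL-Analysis.Analysis"
begin

section \<open>The Sobolev class $W^{1,1}_{loc}$ and the Beltrami equation\<close>

primrec C_k :: "nat \<Rightarrow> (complex \<Rightarrow> real) \<Rightarrow> bool" where
  "C_k 0 \<phi> \<longleftrightarrow> continuous_on UNIV \<phi>"
| "C_k (Suc k) \<phi> \<longleftrightarrow> \<phi> differentiable_on UNIV \<and>
     C_k k (\<lambda>z. frechet_derivative \<phi> (at z) 1) \<and> C_k k (\<lambda>z. frechet_derivative \<phi> (at z) \<i>)"

definition test_function :: "complex set \<Rightarrow> (complex \<Rightarrow> real) \<Rightarrow> bool" where
  "test_function D \<phi> \<longleftrightarrow> (\<forall>k. C_k k \<phi>) \<and>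
     compact (closure {z. \<phi> z \<noteq> 0}) \<and> closure {z. \<phi> z \<noteq> 0} \<subseteq> D"

definition L1_loc :: "complex set \<Rightarrow> (complex \<Rightarrow> complex) \<Rightarrow> bool" where
  "L1_loc D g \<longleftrightarrow> (\<forall>K. compact K \<and> K \<subseteq> D \<longrightarrow> g absolutely_integrable_on K)"

text \<open>\<open>g\<close> is the distributional derivative of \<open>f\<close> in \<open>D\<close> in the direction \<open>v\<close>
  (\<open>v = 1\<close> for the variable \<open>x\<close>, \<open>v = \<i>\<close> for the variable \<open>y\<close>).\<close>

definition weak_derivative ::
    "complex set \<Rightarrow> complex \<Rightarrow> (complex \<Rightarrow> complex) \<Rightarrow> (complex \<Rightarrow> complex) \<Rightarrow> bool" where
  "weak_derivative D v f g \<longleftrightarrow> (\<forall>\<phi>. test_function D \<phi> \<longrightarrow>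
     (\<integral>z. frechet_derivative \<phi> (at z) v *\<^sub>R f z \<partial>lebesgue_on D) =
     - (\<integral>z. \<phi> z *\<^sub>R g z \<partial>lebesgue_on D))"

definition W11_loc_partials ::
    "complex set \<Rightarrow> (complex \<Rightarrow> complex) \<Rightarrow> (complex \<Rightarrow> complex) \<Rightarrow> (complex \<Rightarrow> complex) \<Rightarrow> bool" where
  "W11_loc_partials D f fx fy \<longleftrightarrow> L1_loc D f \<and> L1_loc D fx \<and> L1_loc D fy \<and>
     weak_derivative D 1 f fx \<and> weak_derivative D \<i> f fy"

text \<open>Weak partial derivatives are unique up to null sets, so it is immaterial which
  representatives \<open>fx\<close>, \<open>fy\<close> are chosen below.\<close>

definition homeomorphic_W11_loc_solution ::
    "(complex \<Rightarrow> complex) \<Rightarrow> complex set \<Rightarrow> (complex \<Rightarrow> complex) \<Rightarrow> bool" where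
  "homeomorphic_W11_loc_solution \<mu> D f \<longleftrightarrow>
     (\<exists>g. homeomorphism D (f ` D) f g) \<and>
     (\<exists>fx fy. W11_loc_partials D f fx fy \<and>
        (AE z in lebesgue_on D. (fx z + \<i> * fy z) / 2 = \<mu> z * ((fx z - \<i> * fy z) / 2)))"

definition tangent_dilatation :: "(complex \<Rightarrow> complex) \<Rightarrow> complex \<Rightarrow> complex \<Rightarrow> real" where
  "tangent_dilatation \<mu> z z0 =
     (cmod (1 - cnj (z - z0) / (z - z0) * \<mu> z))\<^sup>2 / (1 - (cmod (\<mu> z))\<^sup>2)"


section \<open>Integration with respect to arc length\<close>

definition length_on :: "real set \<Rightarrow> (real \<Rightarrow> complex) \<Rightarrow> ennreal" where
  "length_on S p = (SUP ts\<in>{ts. sorted ts \<and> set ts \<subseteq> S}.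
     \<Sum>i<length ts - 1. ennreal (dist (p (ts ! i)) (p (ts ! Suc i))))"

definition rectifiable :: "(real \<Rightarrow> complex) \<Rightarrow> bool" where
  "rectifiable p \<longleftrightarrow> length_on {0..1} p < \<infinity>"

text \<open>For a rectifiable path \<open>p\<close> on \<open>{0..1}\<close>, \<open>ds\<close> is the Stieltjes measure of the length function
  \<open>t \<mapsto> length of p on {0..t}\<close>, extended constantly outside \<open>{0..1}\<close>.
  Integrals along non-rectifiable paths are set to \<open>\<infinity>\<close>: such paths impose no condition on
  admissible functions.  (This is the usual convention.  It does not affect moduli, as the family
  of all curves that are not locally rectifiable has modulus zero.)\<close>

definition arc_length_integral :: "(complex \<Rightarrow> ennreal) \<Rightarrow> (real \<Rightarrow> complex) \<Rightarrow> ennreal" where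
  "arc_length_integral \<rho> p =
     (if rectifiable p
      then \<integral>\<^sup>+t\<in>{0..1}. \<rho> (p t) \<partial>interval_measure (\<lambda>t. enn2real (length_on ({0..1} \<inter> {..t}) p))
      else \<infinity>)"


section \<open>Dashed lines and moduli\<close>

text \<open>A dashed line is represented by its parameter set, a relatively open subset of the real axis
  or of a circle in the complex plane, together with a map whose values matter only on that set.\<close>

type_synonym dashed = "complex set \<times> (complex \<Rightarrow> complex)"

definition dashed_line :: "complex set \<Rightarrow> dashed \<Rightarrow> bool" where
  "dashed_line D = (\<lambda>(T, \<gamma>).
     (openin (top_of_set \<real>) T \<or> (\<exists>c r. r > 0 \<and> openin (top_of_set (sphere c r)) T)) \<and>
     continuous_on T \<gamma> \<and> \<gamma> ` T \<subseteq> D)"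

text \<open>The pieces are the connected components of the parameter set: open intervals, open arcs, or a
  full circle.  The integral over a piece is the supremum of the integrals over its closed subpaths;
  \<open>simple_path\<close> admits loops, so a full circle is itself among its subpaths.\<close>

definition dashed_integral :: "(complex \<Rightarrow> ennreal) \<Rightarrow> dashed \<Rightarrow> ennreal" where
  "dashed_integral \<rho> = (\<lambda>(T, \<gamma>). \<Sum>\<^sub>\<infinity>C\<in>components T.
     SUP p\<in>{p. simple_path p \<and> path_image p \<subseteq> C}. arc_length_integral \<rho> (\<gamma> \<circ> p))"

definition adm :: "dashed set \<Rightarrow> (complex \<Rightarrow> ennreal) set" where
  "adm \<Gamma> = {\<rho> \<in> borel_measurable borel. \<forall>\<gamma>\<in>\<Gamma>. 1 \<le> dashed_integral \<rho> \<gamma>}"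

definition modulus :: "dashed set \<Rightarrow> ennreal" where
  "modulus \<Gamma> = (INF \<rho>\<in>adm \<Gamma>. \<integral>\<^sup>+z. (\<rho> z)\<^sup>2 \<partial>lborel)"

definition almost_every :: "dashed set \<Rightarrow> (dashed \<Rightarrow> bool) \<Rightarrow> bool" where
  "almost_every \<Gamma> P \<longleftrightarrow> modulus {\<gamma>\<in>\<Gamma>. \<not> P \<gamma>} = 0"

text \<open>For a Lebesgue measurable \<open>\<rho>\<close>, measurability along almost every \<open>\<gamma>\<close> (for the completed arc
  length measure) is automatic, since \<open>\<rho>\<close> agrees with a Borel function outside a Borel null set;
  for such \<open>\<gamma>\<close>, the nonnegative integral does not depend on whether the measure is completed.\<close>

definition ext_adm :: "dashed set \<Rightarrow> (complex \<Rightarrow> ennreal) set" where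
  "ext_adm \<Gamma> = {\<rho> \<in> borel_measurable lebesgue. almost_every \<Gamma> (\<lambda>\<gamma>. 1 \<le> dashed_integral \<rho> \<gamma>)}"

definition image_family :: "(complex \<Rightarrow> complex) \<Rightarrow> dashed set \<Rightarrow> dashed set" where
  "image_family f \<Gamma> = (\<lambda>(T, \<gamma>). (T, f \<circ> \<gamma>)) ` \<Gamma>"

definition circle_family :: "complex set \<Rightarrow> complex \<Rightarrow> real \<Rightarrow> real \<Rightarrow> dashed set" where
  "circle_family D z0 \<epsilon> \<epsilon>0 = (\<lambda>r. (sphere z0 r \<inter> D, id)) ` {\<epsilon><..<\<epsilon>0}"

lemma circle_family_dashed_line:
  assumes "open D" "\<epsilon> > 0" "\<gamma> \<in> circle_family D z0 \<epsilon> \<epsilon>0"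
  shows "dashed_line D \<gamma>"
proof -
  obtain r where r: "\<epsilon> < r" "\<gamma> = (sphere z0 r \<inter> D, id)"
    using assms(3) by (auto simp: circle_family_def)
  have "openin (top_of_set (sphere z0 r)) (sphere z0 r \<inter> D)"
    using assms(1) by (simp add: openin_open_Int)
  moreover have "r > 0"
    using assms(2) r(1) by simp
  ultimately show ?thesis
    unfolding dashed_line_def r(2) by auto
qed

lemma image_family_dashed_line:
  assumes "continuous_on D f" "\<And>\<gamma>. \<gamma> \<in> \<Gamma> \<Longrightarrow> dashed_line D \<gamma>" "\<gamma> \<in> image_family f \<Gamma>"
  shows "dashed_line (f ` D) \<gamma>"
proof -
  obtain T \<gamma>' where g: "(T, \<gamma>') \<in> \<Gamma>" "\<gamma> = (T, f \<circ> \<gamma>')"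
    using assms(3) by (auto simp: image_family_def)
  have d: "dashed_line D (T, \<gamma>')"
    by (rule assms(2)[OF g(1)])
  then have "continuous_on T (f \<circ> \<gamma>')"
    by (intro continuous_on_compose continuous_on_subset[OF assms(1)]) (auto simp: dashed_line_def)
  with d show ?thesis
    unfolding dashed_line_def g(2) by auto
qed

end

theory Submission
  imports Defs
begin

text \<open>Let \<open>\<rho>\<close> be admissible for the image family, and let \<open>\<tau> z\<close> be the modulus of the derivative of
  \<open>f\<close> at \<open>z\<close> in the direction tangent to the circle about \<open>z0\<close> through \<open>z\<close>.  The idea is to
  compare with the density \<open>z \<mapsto> \<rho> (f z) * \<tau> z\<close> (\<open>pullback_density\<close>).  Three facts make it work.

  (1) On almost every circle, \<open>f\<close> is absolutely continuous on every arc inside \<open>D\<close>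
  (\<open>absolutely_continuous_on_almost_every_circle\<close>).  The image of such an arc has length element at
  most \<open>\<tau> ds\<close>, hence the new density has at least the integral over the circle that \<open>\<rho>\<close> has
  over its image, which is at least one (\<open>arc_length_integral_pullback\<close>).  The circles with the
  remaining radii fill a null set, on which a density may be infinite at no cost; so they have
  modulus zero (\<open>modulus_null_radii\<close>) and the new density is extensively admissible.

  (2) The Beltrami equation implies that \<open>\<tau>\<^sup>2\<close> is the Jacobian \<open>J\<close> times the tangent dilatation
  (\<open>tangential_derivative_squared\<close>).  The integral to be estimated is therefore that of
  \<open>(\<rho> \<circ> f)\<^sup>2 * J\<close>.

  (3) It is at most the integral of \<open>\<rho>\<^sup>2\<close>, by the area inequality for injective maps
  (\<open>area_inequality_homeomorphism\<close>).

  Facts (1) and (3) are derived from the definition of weak derivatives as follows.  Convolution with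
  a smooth bump gives functions that satisfy the fundamental theorem of calculus along smooth curves,
  and their gradients converge in \<open>L\<^sup>1\<close> on compact sets.  In a family of curves that foliates a piece
  of the plane, Fubini's theorem turns this into convergence in the mean of the integrals along the
  curves, so the limit is absolutely continuous on almost every one of them (\<open>absolutely_continuous_on_almost_every_curve\<close>).
  Concentric circles give (1).  Lines parallel to the axes give difference quotients that converge
  almost everywhere and, by Egorov's theorem, uniformly on sets \<open>E\<close> that exhaust \<open>D\<close> up to a null
  set.  Restricted to such a set, \<open>f\<close> is differentiable
  (\<open>differentiable_within_quotient_close\<close>), and the change of variables formula applies to it; this
  gives (3).\<close>

section \<open>Lebesgue measure in the plane and the area inequality\<close>

lemma measurable_Complex_pair [measurable]:
  "(\<lambda>x. Complex (fst x) (snd x)) \<in> borel \<rightarrow>\<^sub>M borel"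
  by (intro borel_measurable_continuous_onI continuous_intros)

lemma measurable_Complex [measurable (raw)]:
  assumes "u \<in> borel_measurable M" "v \<in> borel_measurable M"
  shows "(\<lambda>x. Complex (u x) (v x)) \<in> borel_measurable M"
  using assms measurable_compose[OF borel_measurable_Pair[OF assms] measurable_Complex_pair] by simp

lemma lborel_complex_prod:
  "lborel = distr (lborel \<Otimes>\<^sub>M lborel) borel (\<lambda>x::real\<times>real. Complex (fst x) (snd x))" (is "_ = ?M")
proof (rule lborel_eqI)
  fix l u :: complex
  assume lu: "\<And>b. b \<in> Basis \<Longrightarrow> l \<bullet> b \<le> u \<bullet> b"
  have *: "(\<lambda>x. Complex (fst x) (snd x)) -` box l u = {Re l<..<Re u} \<times> {Im l<..<Im u}"
    by (auto simp: box_def Basis_complex_def)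
  have "emeasure ?M (box l u) = emeasure (lborel \<Otimes>\<^sub>M lborel) ({Re l<..<Re u} \<times> {Im l<..<Im u})"
    by (subst emeasure_distr) (auto simp: * space_pair_measure)
  also have "\<dots> = ennreal (Re u - Re l) * ennreal (Im u - Im l)"
    using lu[of 1] lu[of \<i>] by (subst lborel.emeasure_pair_measure_Times) (auto simp: Basis_complex_def)
  also have "\<dots> = (\<Prod>b\<in>Basis. (u - l) \<bullet> b)"
    using lu[of 1] lu[of \<i>] by (simp add: Basis_complex_def ennreal_mult)
  finally show "emeasure ?M (box l u) = (\<Prod>b\<in>Basis. (u - l) \<bullet> b)" .
qed simp

lemma nn_integral_complex_iterated:
  assumes [measurable]: "h \<in> borel_measurable borel"
  shows "(\<integral>\<^sup>+z. h z \<partial>lborel) = (\<integral>\<^sup>+s. (\<integral>\<^sup>+t. h (Complex s t) \<partial>lborel) \<partial>lborel)"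
  by (subst lborel_complex_prod, subst nn_integral_distr)
     (simp_all add: lborel.nn_integral_fst[symmetric])

definition vec_complex :: "real^2 \<Rightarrow> complex" where "vec_complex v = Complex (v $ 1) (v $ 2)"

definition complex_vec :: "complex \<Rightarrow> real^2" where "complex_vec z = (\<chi> i. if i = 1 then Re z else Im z)"

lemma vec_complex_inverse [simp]: "complex_vec (vec_complex v) = v" "vec_complex (complex_vec z) = z"
  by (auto simp: vec_complex_def complex_vec_def vec_eq_iff forall_2)

lemma linear_vec_complex: "linear vec_complex" and linear_complex_vec: "linear complex_vec"
  by (auto intro!: linearI simp: vec_complex_def complex_vec_def complex_eq_iff vec_eq_iff)

lemma bounded_linear_vec_complex: "bounded_linear vec_complex" "bounded_linear complex_vec"
  using linear_vec_complex linear_complex_vec linear_conv_bounded_linear by blast+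

lemma measurable_vec_complex [measurable]: "vec_complex \<in> borel \<rightarrow>\<^sub>M borel" "complex_vec \<in> borel \<rightarrow>\<^sub>M borel"
  using bounded_linear_vec_complex by (auto intro!: borel_measurable_continuous_onI linear_continuous_on)

lemma lborel_vec_complex: "lborel = distr lborel borel vec_complex"
proof (rule lborel_eqI)
  fix l u :: complex
  assume lu: "\<And>b. b \<in> Basis \<Longrightarrow> l \<bullet> b \<le> u \<bullet> b"
  have *: "vec_complex -` box l u = box (complex_vec l) (complex_vec u)"
    by (auto simp: in_box_complex_iff mem_box_cart vec_complex_def complex_vec_def forall_2)
  have B: "(\<Prod>b\<in>Basis. (complex_vec u - complex_vec l) \<bullet> b) = (\<Prod>i\<in>UNIV. (complex_vec u - complex_vec l) $ i)"
    by (rule prod.reindex_cong[of "\<lambda>i. axis i 1"]) (auto simp: Basis_vec_def axis_eq_axis inner_axis inj_on_def)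
  have "emeasure (distr lborel borel vec_complex) (box l u) = (\<Prod>b\<in>Basis. (complex_vec u - complex_vec l) \<bullet> b)"
    using lu[of 1] lu[of \<i>]
    by (simp add: emeasure_distr *)
       (intro emeasure_lborel_box, auto simp: Basis_complex_def Basis_vec_def inner_axis complex_vec_def)
  also have "\<dots> = (\<Prod>b\<in>Basis. (u - l) \<bullet> b)"
    unfolding B by (simp add: UNIV_2 complex_vec_def Basis_complex_def)
  finally show "emeasure (distr lborel borel vec_complex) (box l u) = (\<Prod>b\<in>Basis. (u - l) \<bullet> b)" .
qed simp

text \<open>The Jacobian determinant of a real-linear map of the plane.\<close>
definition jac :: "(complex \<Rightarrow> complex) \<Rightarrow> real" where
  "jac L = Re (L 1) * Im (L \<i>) - Im (L 1) * Re (L \<i>)"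

lemma det_matrix_vec_complex:
  assumes "linear L"
  shows "det (matrix (\<lambda>v. complex_vec (L (vec_complex v)))) = jac L"
proof -
  have "vec_complex (axis 1 1) = 1" "vec_complex (axis 2 1) = \<i>"
    by (auto simp: vec_complex_def axis_def complex_eq_iff)
  then show ?thesis
    by (simp add: det_2 matrix_def jac_def complex_vec_def mult.commute)
qed

text \<open>The change of variables formula on \<open>real^2\<close> is transported along the isometry \<open>vec_complex\<close>.  The
  derivative is taken relative to \<open>E\<close>, which may be an arbitrary Borel set; this is what makes the
  inequality applicable to Sobolev maps.\<close>
lemma area_measure_inequality:
  fixes f :: "complex \<Rightarrow> complex"
  assumes [measurable]: "E \<in> sets borel" and A [measurable]: "A \<in> sets borel" "f ` E \<subseteq> A"
    and der: "\<And>z. z \<in> E \<Longrightarrow> (f has_derivative f' z) (at z within E)"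
    and inj: "inj_on f E" and J: "\<And>z. z \<in> E \<Longrightarrow> J z = \<bar>jac (f' z)\<bar>"
    and [measurable]: "J \<in> borel_measurable borel"
  shows "(\<integral>\<^sup>+z\<in>E. ennreal (J z) \<partial>lborel) \<le> emeasure lborel A"
proof (cases "emeasure lborel A < \<infinity>")
  case True
  define E2 where "E2 = vec_complex -` E"
  define g where "g = (\<lambda>v. complex_vec (f (vec_complex v)))"
  define g' where "g' v = (\<lambda>x. complex_vec (f' (vec_complex v) (vec_complex x)))" for v
  have E2 [measurable]: "E2 \<in> sets borel"
    using measurable_sets[OF measurable_vec_complex(1) assms(1)] by (simp add: E2_def)
  have im: "vec_complex ` E2 = E"
    unfolding E2_def by (metis surj_image_vimage_eq vec_complex_inverse(2) surjI)
  have derg: "(g has_derivative g' v) (at v within E2)" if "v \<in> E2" for v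
  proof -
    have 1: "(vec_complex has_derivative vec_complex) (at v within E2)"
      by (simp add: bounded_linear_imp_has_derivative bounded_linear_vec_complex)
    have 2: "(f has_derivative f' (vec_complex v)) (at (vec_complex v) within vec_complex ` E2)"
      using der[of "vec_complex v"] that im by (auto simp: E2_def)
    have 3: "(complex_vec has_derivative complex_vec) (at (f (vec_complex v)))"
      by (simp add: bounded_linear_imp_has_derivative bounded_linear_vec_complex)
    have "((\<lambda>v. f (vec_complex v)) has_derivative (\<lambda>x. f' (vec_complex v) (vec_complex x))) (at v within E2)"
      using has_derivative_in_compose[OF 1 2] by simp
    from has_derivative_compose[OF this 3] show ?thesis unfolding g_def g'_def .
  qed
  have injg: "inj_on g E2"
    using inj unfolding inj_on_def g_def E2_def by (metis vec_complex_inverse vimageE)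
  have A2: "vec_complex -` A \<in> lmeasurable"
  proof -
    have "vec_complex -` A \<in> sets lborel" 
      using measurable_sets[OF measurable_vec_complex(1) A(1)] by simp
    moreover have "emeasure lborel (vec_complex -` A) = emeasure lborel A"
      using emeasure_distr[of vec_complex lborel borel A] by (simp flip: lborel_vec_complex)
    ultimately show ?thesis using True by (auto simp: fmeasurable_def)
  qed
  have sub: "g ` E2 \<subseteq> vec_complex -` A"
    using A(2) by (auto simp: g_def E2_def)
  have gE: "g ` E2 \<in> sets lebesgue"
    by (rule differentiable_image_in_sets_lebesgue)
       (use derg in \<open>auto simp: differentiable_on_def differentiable_def\<close>)
  have lm: "g ` E2 \<in> lmeasurable"
    using A2 gE sub by (metis fmeasurableI2)
  have leb: "E2 \<in> sets lebesgue" by simp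
  have ai: "(\<lambda>x. \<bar>det (matrix (g' x))\<bar>) absolutely_integrable_on E2"
    using measurable_differentiable_image_alt[OF leb derg injg] lm by blast
  have meq: "measure lebesgue (g ` E2) = integral E2 (\<lambda>x. \<bar>det (matrix (g' x))\<bar>)"
    using ai by (intro measure_differentiable_image_eq[OF leb derg injg]) (auto simp: absolutely_integrable_on_def)
  have det: "\<bar>det (matrix (g' v))\<bar> = J (vec_complex v)" if "v \<in> E2" for v
    using that J[of "vec_complex v"] der[of "vec_complex v"] has_derivative_linear
    unfolding g'_def E2_def by (subst det_matrix_vec_complex) auto
  have "(\<integral>\<^sup>+z\<in>E. ennreal (J z) \<partial>lborel) = (\<integral>\<^sup>+v. ennreal (J (vec_complex v)) * indicator E (vec_complex v) \<partial>lborel)"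
    by (subst lborel_vec_complex) (simp add: nn_integral_distr)
  also have "\<dots> = (\<integral>\<^sup>+v. ennreal (\<bar>det (matrix (g' v))\<bar> * indicator E2 v) \<partial>lebesgue)"
    unfolding nn_integral_completion
    by (intro nn_integral_cong) (use det in \<open>auto simp: E2_def split: split_indicator\<close>)
  also have "\<dots> = ennreal (\<integral>v. \<bar>det (matrix (g' v))\<bar> * indicator E2 v \<partial>lebesgue)"
    by (intro nn_integral_eq_integral)
       (use ai in \<open>auto simp: set_integrable_def mult.commute\<close>)
  also have "\<dots> = ennreal (measure lebesgue (g ` E2))"
    unfolding meq set_lebesgue_integral_eq_integral(2)[OF ai, symmetric]
    by (simp add: set_lebesgue_integral_def mult.commute)
  also have "\<dots> \<le> ennreal (measure lebesgue (vec_complex -` A))"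
    using A2 gE sub by (intro ennreal_leI measure_mono_fmeasurable)
  also have "\<dots> = emeasure lebesgue (vec_complex -` A)"
    using A2 by (simp add: emeasure_eq_measure2)
  also have "\<dots> = emeasure lborel A"
    using measurable_sets[OF measurable_vec_complex(1) A(1)] emeasure_distr[of vec_complex lborel borel A]
    by (simp flip: lborel_vec_complex)
  finally show ?thesis .
qed (auto simp: top.not_eq_extremum[symmetric])

text \<open>The push-forward of the measure with density \<open>J\<close> on \<open>S\<close> is dominated by Lebesgue measure on
  all Borel sets, hence also in integrals of nonnegative functions.\<close>
lemma area_inequality:
  fixes f :: "complex \<Rightarrow> complex"
  assumes S [measurable]: "S \<in> sets borel" and f [measurable]: "f \<in> borel_measurable borel"
    and der: "\<And>z. z \<in> S \<Longrightarrow> (f has_derivative f' z) (at z within S)"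
    and inj: "inj_on f S" and J: "\<And>z. z \<in> S \<Longrightarrow> J z = \<bar>jac (f' z)\<bar>"
    and [measurable]: "J \<in> borel_measurable borel" and h [measurable]: "h \<in> borel_measurable borel"
  shows "(\<integral>\<^sup>+z\<in>S. ennreal (J z) * h (f z) \<partial>lborel) \<le> (\<integral>\<^sup>+z. h z \<partial>lborel)"
proof -
  define N where "N = distr (density lborel (\<lambda>z. ennreal (J z) * indicator S z)) borel f"
  have "N \<le> lborel"
  proof (subst le_measure)
    show "\<forall>A\<in>sets N. emeasure N A \<le> emeasure lborel A"
    proof
      fix A assume "A \<in> sets N"
      then have A [measurable]: "A \<in> sets borel" by (simp add: N_def)
      define E where "E = S \<inter> f -` A"
      have E: "E \<in> sets borel" "E \<subseteq> S"
        using measurable_sets[OF f A] S by (auto simp: E_def)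
      have "emeasure N A = (\<integral>\<^sup>+z\<in>E. ennreal (J z) \<partial>lborel)"
        unfolding N_def using measurable_sets[OF f A]
        by (simp add: emeasure_distr emeasure_density)
           (auto simp: E_def intro!: nn_integral_cong split: split_indicator)
      also have "\<dots> \<le> emeasure lborel A"
        using E der inj J
        by (intro area_measure_inequality[of _ _ f f'])
           (auto simp: E_def intro: has_derivative_subset inj_on_subset)
      finally show "emeasure N A \<le> emeasure lborel A" .
    qed
  qed (simp add: N_def)
  have "(\<integral>\<^sup>+z\<in>S. ennreal (J z) * h (f z) \<partial>lborel) = (\<integral>\<^sup>+z. h z \<partial>N)"
    by (simp add: N_def nn_integral_distr nn_integral_density ac_simps)
  also have "\<dots> \<le> (\<integral>\<^sup>+z. h z \<partial>lborel)"
    using \<open>N \<le> lborel\<close> by (intro nn_integral_mono_measure) (simp_all add: N_def)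
  finally show ?thesis .
qed

section \<open>A smooth mollifier\<close>

text \<open>For \<open>k = 0\<close> this is the classical smooth function vanishing on the negative axis.  The derivative
  of a member of the family is a linear combination of two others, so smoothness can be proved for
  all members at once.\<close>
definition exp_cut :: "nat \<Rightarrow> real \<Rightarrow> real" where
  "exp_cut k u = (if u > 0 then inverse u ^ k * exp (- inverse u) else 0)"

lemma exp_cut_tendsto_0: "(exp_cut k \<longlongrightarrow> 0) (at 0)"
proof -
  have "((\<lambda>u. inverse u ^ k / exp (inverse u)) \<longlongrightarrow> 0) (at_right (0::real))"
    by (rule filterlim_compose[OF tendsto_power_div_exp_0 filterlim_inverse_at_top_right])
  then have r: "(exp_cut k \<longlongrightarrow> 0) (at_right 0)"
    by (rule Lim_transform_eventually)
       (auto simp: eventually_at_right_less exp_cut_def exp_minus field_simps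
             intro!: eventually_mono[OF eventually_at_right_less])
  have l: "(exp_cut k \<longlongrightarrow> 0) (at_left 0)"
    by (rule Lim_transform_eventually[OF tendsto_const])
       (auto simp: exp_cut_def eventually_at_left_field intro!: exI[of _ "-1"])
  from l r show ?thesis by (simp add: filterlim_at_split)
qed

lemma exp_cut_deriv: "(exp_cut k has_real_derivative (- real k * exp_cut (Suc k) u + exp_cut (k + 2) u)) (at u)"
proof (cases u "0::real" rule: linorder_cases)
  case greater
    then have 1: "u > 0" .
    have inv: "((\<lambda>u. inverse u ^ k) has_real_derivative (- real k * inverse u ^ Suc k)) (at u)"
    proof (rule DERIV_cong[OF DERIV_power[OF DERIV_inverse]])
      show "u \<noteq> 0" using 1 by simp
      show "real k * (- (inverse u ^ Suc (Suc 0)) * inverse u ^ (k - Suc 0)) = - real k * inverse u ^ Suc k"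
        by (cases k) (simp_all add: algebra_simps)
    qed
    have "((\<lambda>u. inverse u ^ k * exp (- inverse u)) has_real_derivative
       (- real k * exp_cut (Suc k) u + exp_cut (k + 2) u)) (at u)"
    proof (rule DERIV_cong[OF DERIV_mult[OF inv DERIV_fun_exp[OF DERIV_minus[OF DERIV_inverse]]]])
      show "u \<noteq> 0" using 1 by simp
      have "inverse u ^ k * (exp (- inverse u) * inverse u ^ 2) = inverse u ^ (k + 2) * exp (- inverse u)"
        by (simp only: power_add mult_ac)
      then show "- real k * inverse u ^ Suc k * exp (- inverse u) + exp (- inverse u) * - (- (inverse u ^ Suc (Suc 0))) * inverse u ^ k
        = - real k * exp_cut (Suc k) u + exp_cut (k + 2) u"
        using 1 unfolding exp_cut_def by (simp only: if_True numeral_2_eq_2 minus_minus mult_ac)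
    qed
    then show ?thesis
      by (rule has_field_derivative_transform_within_open[where S="{0<..}"]) (use 1 in \<open>auto simp: exp_cut_def\<close>)
  next
    case less
    then have 2: "u < 0" .
    have "((\<lambda>u. 0) has_real_derivative (- real k * exp_cut (Suc k) u + exp_cut (k + 2) u)) (at u)"
      using 2 by (auto simp: exp_cut_def)
    then show ?thesis
      by (rule has_field_derivative_transform_within_open[where S="{..<0}"]) (use 2 in \<open>auto simp: exp_cut_def\<close>)
  next
    case equal
    then have 3: "u = 0" .
    have "exp_cut (Suc k) h = (exp_cut k (0 + h) - exp_cut k 0) / h" for h
      by (cases "h > 0") (simp_all add: exp_cut_def divide_inverse mult_ac)
    then have "(\<lambda>h. (exp_cut k (0 + h) - exp_cut k 0) / h) = exp_cut (Suc k)"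
      by (intro ext) simp
    then have "((\<lambda>h. (exp_cut k (0 + h) - exp_cut k 0) / h) \<longlongrightarrow> 0) (at 0)"
      using exp_cut_tendsto_0[of "Suc k"] by simp
    moreover have "- real k * exp_cut (Suc k) u + exp_cut (k + 2) u = 0"
      using 3 by (simp add: exp_cut_def)
    ultimately show ?thesis
      unfolding DERIV_def 3 by presburger
qed

lemma C_k_SucI:
  assumes "\<And>z. (\<phi> has_derivative \<phi>' z) (at z)" "C_k k (\<lambda>z. \<phi>' z 1)" "C_k k (\<lambda>z. \<phi>' z \<i>)"
  shows "C_k (Suc k) \<phi>"
proof -
  have "frechet_derivative \<phi> (at z) = \<phi>' z" for z
    using frechet_derivative_at[OF assms(1)] by metis
  then show ?thesis
    using assms by (auto simp: differentiable_on_def differentiable_def intro: has_derivative_at_withinI)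
qed

lemma C_k_SucD:
  assumes "C_k (Suc k) \<phi>"
  shows "(\<phi> has_derivative frechet_derivative \<phi> (at z)) (at z)"
    "C_k k (\<lambda>z. frechet_derivative \<phi> (at z) 1)" "C_k k (\<lambda>z. frechet_derivative \<phi> (at z) \<i>)"
  using assms by (auto simp: differentiable_on_def frechet_derivative_works)

lemma C_k_antimono: "C_k (Suc k) \<phi> \<Longrightarrow> C_k k \<phi>"
proof (induction k arbitrary: \<phi>)
  case 0
  then show ?case
    by (simp add: differentiable_imp_continuous_on)
next
  case (Suc k)
  show ?case
    using Suc.IH[OF C_k_SucD(2)[OF Suc.prems]] Suc.IH[OF C_k_SucD(3)[OF Suc.prems]] C_k_SucD(1)[OF Suc.prems]
    by (intro C_k_SucI)
qed

lemma C_k_const: "C_k k (\<lambda>z. c)"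
proof (induction k arbitrary: c)
  case (Suc k)
  show ?case
    by (rule C_k_SucI[of _ "\<lambda>_ _. 0"]) (intro has_derivative_const Suc)+
qed simp

lemma C_k_bounded_linear:
  assumes "bounded_linear L" shows "C_k k (\<lambda>z. L z)"
proof (cases k)
  case 0
  then show ?thesis using assms by (simp add: linear_continuous_on)
next
  case (Suc n)
  then show ?thesis
    unfolding Suc using assms by (intro C_k_SucI[of _ "\<lambda>_. L"] bounded_linear_imp_has_derivative C_k_const)
qed

lemma C_k_add: "C_k k \<phi> \<Longrightarrow> C_k k \<psi> \<Longrightarrow> C_k k (\<lambda>z. \<phi> z + \<psi> z)"
proof (induction k arbitrary: \<phi> \<psi>)
  case (Suc k)
  show ?case
    by (rule C_k_SucI[OF has_derivative_add[OF C_k_SucD(1)[OF Suc.prems(1)] C_k_SucD(1)[OF Suc.prems(2)]]])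
       (intro Suc.IH C_k_SucD Suc.prems)+
qed (auto intro: continuous_on_add)

lemma C_k_mult: "C_k k \<phi> \<Longrightarrow> C_k k \<psi> \<Longrightarrow> C_k k (\<lambda>z. \<phi> z * \<psi> z)"
proof (induction k arbitrary: \<phi> \<psi>)
  case (Suc k)
  show ?case
    by (rule C_k_SucI[OF has_derivative_mult[OF C_k_SucD(1)[OF Suc.prems(1)] C_k_SucD(1)[OF Suc.prems(2)]]])
       (intro C_k_add Suc.IH C_k_SucD[OF Suc.prems(1)] C_k_SucD[OF Suc.prems(2)]
         C_k_antimono[OF Suc.prems(1)] C_k_antimono[OF Suc.prems(2)])+
qed (auto intro: continuous_on_mult)

lemma exp_cut_ball_deriv:
  "((\<lambda>w. exp_cut k (e\<^sup>2 - (cmod (w - z))\<^sup>2)) has_derivative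
     (\<lambda>v. (- 2 * ((w - z) \<bullet> v)) * (- real k * exp_cut (Suc k) (e\<^sup>2 - (cmod (w - z))\<^sup>2) + exp_cut (k + 2) (e\<^sup>2 - (cmod (w - z))\<^sup>2)))) (at w)"
proof -
  have 1: "((\<lambda>w. e\<^sup>2 - (cmod (w - z))\<^sup>2) has_derivative (\<lambda>v. - 2 * ((w - z) \<bullet> v))) (at w)"
  proof -
    have d: "((\<lambda>w. w - z) has_derivative (\<lambda>v. v)) (at w)"
      using has_derivative_diff[OF has_derivative_ident has_derivative_const] by simp
    have "((\<lambda>w. e\<^sup>2 - (w - z) \<bullet> (w - z)) has_derivative (\<lambda>v. 0 - ((w - z) \<bullet> v + v \<bullet> (w - z)))) (at w)"
      by (intro has_derivative_diff has_derivative_const has_derivative_inner d)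
    moreover have "(\<lambda>v. 0 - ((w - z) \<bullet> v + v \<bullet> (w - z))) = (\<lambda>v. - 2 * ((w - z) \<bullet> v))"
      by (rule ext) (subst (2) inner_commute, linarith)
    ultimately show ?thesis
      unfolding power2_norm_eq_inner by simp
  qed
  have 2: "(exp_cut k has_derivative (\<lambda>x. x * (- real k * exp_cut (Suc k) (e\<^sup>2 - (cmod (w - z))\<^sup>2) + exp_cut (k + 2) (e\<^sup>2 - (cmod (w - z))\<^sup>2)))) (at (e\<^sup>2 - (cmod (w - z))\<^sup>2))"
    by (rule has_derivative_eq_rhs[OF exp_cut_deriv[unfolded has_field_derivative_def]], rule ext, rule mult.commute)
  show ?thesis
    by (rule has_derivative_compose[OF 1 2])
qed

text \<open>Each partial derivative is an affine function times a combination of members \<open>Suc k\<close> and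
  \<open>k + 2\<close> of the same family, so the induction on \<open>n\<close> must run over all \<open>k\<close> simultaneously.\<close>
lemma C_k_exp_cut_ball: "C_k n (\<lambda>w. exp_cut k (e\<^sup>2 - (cmod (w - z))\<^sup>2))"
proof (induction n arbitrary: k)
  case 0
  have "isCont (\<lambda>w. exp_cut k (e\<^sup>2 - (cmod (w - z))\<^sup>2)) w" for w
    by (rule has_derivative_continuous[OF exp_cut_ball_deriv])
  then show ?case
    by (simp add: continuous_at_imp_continuous_on)
next
  case (Suc n)
  have L: "C_k n (\<lambda>w. (w - z) \<bullet> v)" for v
    using C_k_add[OF C_k_bounded_linear[OF bounded_linear_inner_left] C_k_const[of n "- (z \<bullet> v)"], of v]
    by (simp add: inner_diff_left)
  show ?case
    by (rule C_k_SucI[OF exp_cut_ball_deriv]) (intro C_k_mult C_k_add C_k_const L Suc.IH)+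
qed

text \<open>The bump is positive exactly on the open disc of radius \<open>\<bar>e\<bar>\<close>.  It is not normalised; the
  convolution below divides by its mass.\<close>
definition bump :: "real \<Rightarrow> complex \<Rightarrow> real" where
  "bump e u = exp_cut 0 (e\<^sup>2 - (cmod u)\<^sup>2)"

definition bump_deriv :: "real \<Rightarrow> complex \<Rightarrow> complex \<Rightarrow> real" where
  "bump_deriv e u v = - 2 * (u \<bullet> v) * exp_cut 2 (e\<^sup>2 - (cmod u)\<^sup>2)"

lemma bump_has_derivative: "(bump e has_derivative bump_deriv e u) (at u)"
  using exp_cut_ball_deriv[of 0 e 0 u] unfolding bump_def[abs_def] bump_deriv_def[abs_def]
  by (simp only: diff_zero of_nat_0 minus_zero mult_zero_left add_0)

lemma bump_nonneg: "0 \<le> bump e u" and bump_le_1: "bump e u \<le> 1"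
  by (auto simp: bump_def exp_cut_def)

lemma bump_pos: "cmod u < e \<Longrightarrow> 0 < bump e u"
  by (auto simp: bump_def exp_cut_def power_strict_mono)

lemma exp_cut_outside:
  assumes "0 \<le> e" "e \<le> cmod u" shows "exp_cut k (e\<^sup>2 - (cmod u)\<^sup>2) = 0"
proof -
  have "e\<^sup>2 \<le> (cmod u)\<^sup>2" using assms by (intro power_mono)
  then show ?thesis by (simp add: exp_cut_def)
qed

lemma bump_outside: "0 \<le> e \<Longrightarrow> e \<le> cmod u \<Longrightarrow> bump e u = 0"
  and bump_deriv_outside: "0 \<le> e \<Longrightarrow> e \<le> cmod u \<Longrightarrow> bump_deriv e u v = 0"
  by (simp_all add: bump_def bump_deriv_def exp_cut_outside)

lemma bump_sym: "bump e (z - w) = bump e (w - z)"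
  by (simp add: bump_def norm_minus_commute)

lemma continuous_on_bump: "continuous_on S (bump e)"
  by (intro continuous_at_imp_continuous_on ballI has_derivative_continuous[OF bump_has_derivative])

lemma measurable_bump [measurable]: "bump e \<in> borel_measurable borel"
  by (intro borel_measurable_continuous_onI continuous_on_bump)

lemma continuous_on_exp_cut: "continuous_on S (exp_cut k)"
  by (intro continuous_at_imp_continuous_on ballI DERIV_isCont[OF exp_cut_deriv])

lemma measurable_exp_cut [measurable]: "exp_cut k \<in> borel_measurable borel"
  by (intro borel_measurable_continuous_onI continuous_on_exp_cut)

lemma measurable_bump_deriv [measurable (raw)]:
  assumes [measurable]: "u \<in> borel_measurable M" "v \<in> borel_measurable M"
  shows "(\<lambda>x. bump_deriv e (u x) (v x)) \<in> borel_measurable M"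
  unfolding bump_deriv_def by measurable

lemma bump_deriv_bound: obtains B where "\<And>u v. \<bar>bump_deriv e u v\<bar> \<le> B * cmod v" "0 \<le> B"
proof -
  have "bounded ((\<lambda>u. norm (2 * (cmod u) * exp_cut 2 (e\<^sup>2 - (cmod u)\<^sup>2))) ` cball 0 \<bar>e\<bar>)"
    by (intro compact_imp_bounded compact_continuous_image continuous_intros
        continuous_on_compose2[OF continuous_on_exp_cut[of UNIV]]) auto
  then obtain B where "\<forall>u\<in>cball 0 \<bar>e\<bar>. 2 * (cmod u) * \<bar>exp_cut 2 (e\<^sup>2 - (cmod u)\<^sup>2)\<bar> \<le> B"
    by (auto simp: bounded_iff abs_mult)
  then have B: "2 * (cmod u) * \<bar>exp_cut 2 (e\<^sup>2 - (cmod u)\<^sup>2)\<bar> \<le> B" if "cmod u \<le> \<bar>e\<bar>" for u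
    using that by simp
  have B0: "0 \<le> B" using B[of 0] by simp
  have "\<bar>bump_deriv e u v\<bar> \<le> B * cmod v" for u v
  proof (cases "cmod u \<le> \<bar>e\<bar>")
    case True
    have "\<bar>bump_deriv e u v\<bar> \<le> 2 * (cmod u * cmod v) * \<bar>exp_cut 2 (e\<^sup>2 - (cmod u)\<^sup>2)\<bar>"
      unfolding bump_deriv_def abs_mult by (intro mult_mono Cauchy_Schwarz_ineq2) auto
    also have "\<dots> \<le> B * cmod v"
      using mult_right_mono[OF B[OF True], of "cmod v"] by (simp add: ac_simps)
    finally show ?thesis .
  next
    case False
    then have "bump_deriv e u v = 0"
      using exp_cut_outside[of "\<bar>e\<bar>" u] by (simp add: bump_deriv_def)
    then show ?thesis using B0 by simp
  qed
  from that[OF this B0] show thesis .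
qed

lemma bump_integrable: "integrable lborel (bump e)"
proof (rule integrableI_bounded_set[where A="cball 0 \<bar>e\<bar>" and B=1])
  show "AE x in lborel. x \<notin> cball 0 \<bar>e\<bar> \<longrightarrow> bump e x = 0"
    using bump_outside[of "\<bar>e\<bar>"] by (auto simp: bump_def)
qed (auto simp: abs_of_nonneg bump_nonneg bump_le_1 emeasure_compact_finite[OF compact_cball, simplified])

definition bump_mass :: "real \<Rightarrow> real" where "bump_mass e = (\<integral>u. bump e u \<partial>lborel)"

lemma bump_mass_pos: assumes "e > 0" shows "0 < bump_mass e"
proof -
  have "bump_mass e \<noteq> 0"
  proof
    assume "bump_mass e = 0"
    then have "AE u in lborel. bump e u = 0"
      unfolding bump_mass_def
      by (subst (asm) integral_nonneg_eq_0_iff_AE) (auto simp: bump_integrable bump_nonneg)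
    then have "AE u in lborel. u \<notin> ball (0::complex) e"
    proof (rule AE_mp, intro AE_I2 impI)
      fix u assume "bump e u = 0" then show "u \<notin> ball 0 e" using bump_pos[of u e] by auto
    qed
    then have "ball (0::complex) e \<in> null_sets lborel"
      using AE_iff_null_sets[of "ball (0::complex) e" lborel] by simp
    then have "negligible (ball (0::complex) e)"
      by (simp add: negligible_iff_null_sets null_sets_completionI)
    then show False using assms open_not_negligible[of "ball (0::complex) e"] by simp
  qed
  moreover have "0 \<le> bump_mass e"
    unfolding bump_mass_def by (simp add: bump_nonneg)
  ultimately show ?thesis by simp
qed

lemma test_function_bump:
  assumes "e > 0" "cball z e \<subseteq> D"
  shows "test_function D (\<lambda>w. bump e (z - w))"
proof -
  have sub: "{w. bump e (z - w) \<noteq> 0} \<subseteq> cball z e"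
  proof
    fix w assume "w \<in> {w. bump e (z - w) \<noteq> 0}"
    then show "w \<in> cball z e" using assms(1) bump_outside[of e "z - w"] by (force simp: dist_norm)
  qed
  then have "closure {w. bump e (z - w) \<noteq> 0} \<subseteq> cball z e"
    by (rule closure_minimal) simp
  moreover have "compact (closure {w. bump e (z - w) \<noteq> 0})"
    unfolding compact_closure by (rule bounded_subset[OF bounded_cball sub])
  moreover have "C_k k (\<lambda>w. bump e (z - w))" for k
    using C_k_exp_cut_ball[of k 0 e z] by (simp add: bump_def norm_minus_commute)
  ultimately show ?thesis
    unfolding test_function_def using assms(2) by blast
qed

lemma frechet_derivative_bump: "frechet_derivative (\<lambda>w. bump e (z - w)) (at w) v = - bump_deriv e (z - w) v"
proof -
  have "((\<lambda>w. bump e (z - w)) has_derivative (\<lambda>v. bump_deriv e (z - w) (- v))) (at w)"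
    by (rule has_derivative_compose[OF _ bump_has_derivative]) (auto intro!: derivative_eq_intros)
  from frechet_derivative_at[OF this] have "frechet_derivative (\<lambda>w. bump e (z - w)) (at w) v = bump_deriv e (z - w) (- v)"
    by metis
  then show ?thesis by (simp add: bump_deriv_def)
qed

section \<open>Mollification of weakly differentiable functions\<close>

text \<open>Indicators of Borel sets are approximated by Urysohn functions between a closed subset and an open
  superset of nearly the same measure; sums and dominated limits follow.\<close>
lemma L1_density_continuous:
  fixes g :: "complex \<Rightarrow> complex"
  assumes "integrable lborel g" "0 < \<eta>"
  shows "\<exists>\<phi>. continuous_on UNIV \<phi> \<and> (\<integral>\<^sup>+z. ennreal (cmod (g z - \<phi> z)) \<partial>lborel) < ennreal \<eta>"
  using assms
proof (induction arbitrary: \<eta> rule: integrable_induct)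
  case (base A c)
  \<comment> \<open>the error is at most \<open>2 * \<eta>' * cmod c\<close>; adding one avoids a division by zero\<close>
  define \<eta>' where "\<eta>' = \<eta> / (2 * (cmod c + 1))"
  have \<eta>': "0 < \<eta>'" using base by (simp add: \<eta>'_def add_nonneg_pos)
  have A: "A \<in> sets lebesgue" using base by simp
  obtain U where U: "open U" "A \<subseteq> U" "emeasure lebesgue (U - A) < ennreal \<eta>'"
    using sets_lebesgue_outer_open[OF A \<eta>'] by metis
  obtain T where T: "closed T" "T \<subseteq> A" "emeasure lebesgue (A - T) < ennreal \<eta>'"
    using sets_lebesgue_inner_closed[OF A \<eta>'] by metis
  obtain \<phi> :: "complex \<Rightarrow> real" where \<phi>: "continuous_on UNIV \<phi>" "\<And>x. \<phi> x \<in> closed_segment 1 0"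
    "\<And>x. x \<in> T \<Longrightarrow> \<phi> x = 1" "\<And>x. x \<in> - U \<Longrightarrow> \<phi> x = 0"
    by (rule Urysohn[of T "- U" "1::real" 0]) (use T U in auto)
  have \<phi>01: "0 \<le> \<phi> x \<and> \<phi> x \<le> 1" for x
    using \<phi>(2)[of x] by (simp add: closed_segment_eq_real_ivl split: if_splits)
  have AB: "A \<in> sets borel" "U \<in> sets borel" "T \<in> sets borel" using base U T by auto
  have "(\<integral>\<^sup>+z. ennreal (cmod (indicator A z *\<^sub>R c - \<phi> z *\<^sub>R c)) \<partial>lborel)
      \<le> (\<integral>\<^sup>+z. ennreal (cmod c) * (indicator (U - A) z + indicator (A - T) z) \<partial>lborel)"
  proof (intro nn_integral_mono)
    fix z
    have ab: "\<bar>indicator A z - \<phi> z\<bar> \<le> (indicator (U - A) z + indicator (A - T) z :: real)"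
      using \<phi>01[of z] \<phi>(3,4)[of z] U(2) T(2) by (auto split: split_indicator)
    have "cmod (indicator A z *\<^sub>R c - \<phi> z *\<^sub>R c) = \<bar>indicator A z - \<phi> z\<bar> * cmod c"
      by (metis norm_scaleR scaleR_diff_left)
    also have "\<dots> \<le> (indicator (U - A) z + indicator (A - T) z) * cmod c"
      by (rule mult_right_mono[OF ab norm_ge_zero])
    finally have "ennreal (cmod (indicator A z *\<^sub>R c - \<phi> z *\<^sub>R c))
        \<le> ennreal ((indicator (U - A) z + indicator (A - T) z) * cmod c)"
      by (rule ennreal_leI)
    also have "\<dots> = ennreal (cmod c) * (indicator (U - A) z + indicator (A - T) z)"
      by (auto split: split_indicator)
    finally show "ennreal (cmod (indicator A z *\<^sub>R c - \<phi> z *\<^sub>R c))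
        \<le> ennreal (cmod c) * (indicator (U - A) z + indicator (A - T) z)" .
  qed
  also have "\<dots> = ennreal (cmod c) * (emeasure lborel (U - A) + emeasure lborel (A - T))"
    using AB by (simp add: nn_integral_cmult nn_integral_add)
  also have "\<dots> \<le> ennreal (cmod c) * (ennreal \<eta>' + ennreal \<eta>')"
    using U(3) T(3) AB by (intro mult_left_mono add_mono) auto
  also have "\<dots> = ennreal (cmod c * (2 * \<eta>'))"
    using \<eta>' by (simp add: ennreal_mult flip: ennreal_plus)
  also have "\<dots> < ennreal \<eta>"
  proof (intro ennreal_lessI base(3))
    have "0 < 2 * (cmod c + 1)" by (simp add: add_nonneg_pos)
    then show "cmod c * (2 * \<eta>') < \<eta>"
      using base(3) by (simp add: \<eta>'_def pos_divide_less_eq algebra_simps)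
  qed
  finally show ?case
    using \<phi>(1) by (intro exI[of _ "\<lambda>z. \<phi> z *\<^sub>R c"]) (auto intro!: continuous_intros)
next
  case (add f g)
  obtain \<phi> where \<phi>: "continuous_on UNIV \<phi>" "(\<integral>\<^sup>+z. ennreal (cmod (f z - \<phi> z)) \<partial>lborel) < ennreal (\<eta>/2)"
    using add(3)[of "\<eta>/2"] add(5) by auto
  obtain \<psi> where \<psi>: "continuous_on UNIV \<psi>" "(\<integral>\<^sup>+z. ennreal (cmod (g z - \<psi> z)) \<partial>lborel) < ennreal (\<eta>/2)"
    using add(4)[of "\<eta>/2"] add(5) by auto
  have [measurable]: "f \<in> borel_measurable borel" "g \<in> borel_measurable borel"
      "\<phi> \<in> borel_measurable borel" "\<psi> \<in> borel_measurable borel"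
    using add \<phi>(1) \<psi>(1) by (auto intro: borel_measurable_continuous_onI)
  have "(\<integral>\<^sup>+z. ennreal (cmod (f z + g z - (\<phi> z + \<psi> z))) \<partial>lborel)
     \<le> (\<integral>\<^sup>+z. ennreal (cmod (f z - \<phi> z)) + ennreal (cmod (g z - \<psi> z)) \<partial>lborel)"
    by (intro nn_integral_mono)
       (simp flip: ennreal_plus add: ennreal_leI norm_diff_triangle_ineq)
  also have "\<dots> < ennreal (\<eta>/2) + ennreal (\<eta>/2)"
    using \<phi>(2) \<psi>(2) by (subst nn_integral_add) (auto intro: add_strict_mono)
  also have "\<dots> = ennreal \<eta>" using add(5) by (simp flip: ennreal_plus)
  finally show ?case
    using \<phi>(1) \<psi>(1) by (intro exI[of _ "\<lambda>z. \<phi> z + \<psi> z"]) (auto intro!: continuous_intros)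
next
  case (lim f s)
  have [measurable]: "f \<in> borel_measurable borel" "s i \<in> borel_measurable borel" for i
    using lim(1,4) by auto
  have "(\<lambda>i. \<integral>\<^sup>+z. ennreal (cmod (f z - s i z)) \<partial>lborel) \<longlonglongrightarrow> (\<integral>\<^sup>+z. ennreal 0 \<partial>(lborel::complex measure))"
  proof (rule nn_integral_dominated_convergence[where w="\<lambda>z. ennreal (3 * cmod (f z))"])
    show "AE z in lborel. (\<lambda>i. ennreal (cmod (f z - s i z))) \<longlonglongrightarrow> ennreal 0"
    proof (intro AE_I2 tendsto_ennrealI)
      fix z
      have "(\<lambda>i. f z - s i z) \<longlonglongrightarrow> f z - f z"
        by (intro tendsto_diff tendsto_const lim(2)) simp
      then show "(\<lambda>i. cmod (f z - s i z)) \<longlonglongrightarrow> 0"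
        by (intro tendsto_norm_zero) simp
    qed
    show "AE z in lborel. ennreal (cmod (f z - s i z)) \<le> ennreal (3 * cmod (f z))" for i
    proof (intro AE_I2 ennreal_leI)
      fix z show "cmod (f z - s i z) \<le> 3 * cmod (f z)"
        using lim(3)[of z i] norm_triangle_ineq4[of "f z" "s i z"] by simp
    qed
    have "integrable lborel (\<lambda>z. 3 * cmod (f z))" using lim(4) by auto
    then show "(\<integral>\<^sup>+z. ennreal (3 * cmod (f z)) \<partial>lborel) < \<infinity>"
      unfolding integrable_iff_bounded by (simp only: real_norm_def abs_mult abs_numeral abs_norm_cancel)
  qed auto
  then have "\<forall>\<^sub>F i in sequentially. (\<integral>\<^sup>+z. ennreal (cmod (f z - s i z)) \<partial>lborel) < ennreal (\<eta>/2)"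
    using lim(6) by (auto dest!: order_tendstoD(2)[where a="ennreal (\<eta>/2)"])
  then obtain i where i: "(\<integral>\<^sup>+z. ennreal (cmod (f z - s i z)) \<partial>lborel) < ennreal (\<eta>/2)"
    by (auto simp: eventually_sequentially)
  obtain \<phi> where \<phi>: "continuous_on UNIV \<phi>" "(\<integral>\<^sup>+z. ennreal (cmod (s i z - \<phi> z)) \<partial>lborel) < ennreal (\<eta>/2)"
    using lim(5)[of "\<eta>/2" i] lim(6) by auto
  have [measurable]: "\<phi> \<in> borel_measurable borel" 
    using \<phi>(1) by (auto intro: borel_measurable_continuous_onI)
  have "(\<integral>\<^sup>+z. ennreal (cmod (f z - \<phi> z)) \<partial>lborel)
     \<le> (\<integral>\<^sup>+z. ennreal (cmod (f z - s i z)) + ennreal (cmod (s i z - \<phi> z)) \<partial>lborel)"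
    by (intro nn_integral_mono)
       (simp flip: ennreal_plus add: ennreal_leI norm_diff_triangle_le[OF order_refl order_refl])
  also have "\<dots> < ennreal (\<eta>/2) + ennreal (\<eta>/2)"
    using i \<phi>(2) by (subst nn_integral_add) (auto intro: add_strict_mono)
  also have "\<dots> = ennreal \<eta>" using lim(6) by (simp flip: ennreal_plus)
  finally show ?case using \<phi>(1) by auto
qed

lemma nn_integral_bump_shift:
  "(\<integral>\<^sup>+w. ennreal (bump e (z - w)) \<partial>lborel) = ennreal (bump_mass e)"
proof -
  have "(\<integral>\<^sup>+w. ennreal (bump e (z - w)) \<partial>lborel) = (\<integral>\<^sup>+w. ennreal (bump e (- z + w)) \<partial>lborel)"
    by (subst bump_sym) simp
  also have "\<dots> = (\<integral>\<^sup>+w. ennreal (bump e w) \<partial>distr lborel borel ((+) (- z)))"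
    by (simp add: nn_integral_distr)
  also have "\<dots> = (\<integral>\<^sup>+w. ennreal (bump e w) \<partial>lborel)"
    by (simp only: lborel_distr_plus)
  also have "\<dots> = ennreal (bump_mass e)"
    unfolding bump_mass_def by (intro nn_integral_eq_integral bump_integrable) (simp add: bump_nonneg)
  finally show ?thesis .
qed

lemma has_bochner_integral_bump_shift:
  assumes "e > 0"
  shows "has_bochner_integral lborel (\<lambda>w. bump e (z - w)) (bump_mass e)"
  by (rule has_bochner_integral_nn_integral)
     (use bump_mass_pos[OF assms] in \<open>auto simp: nn_integral_bump_shift bump_nonneg\<close>)

definition mollify :: "real \<Rightarrow> (complex \<Rightarrow> complex) \<Rightarrow> complex \<Rightarrow> complex" where
  "mollify e g z = (\<integral>w. bump e (z - w) *\<^sub>R g w \<partial>lborel) /\<^sub>R bump_mass e"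

lemma measurable_mollify [measurable]:
  assumes [measurable]: "g \<in> borel_measurable borel"
  shows "mollify e g \<in> borel_measurable borel"
  unfolding mollify_def[abs_def] by measurable

lemma integrable_bump_mult:
  fixes g :: "complex \<Rightarrow> complex"
  assumes "e > 0" and [measurable]: "g \<in> borel_measurable borel" and "set_integrable lborel (cball z e) g"
  shows "integrable lborel (\<lambda>w. bump e (z - w) *\<^sub>R g w)"
proof (rule Bochner_Integration.integrable_bound)
  show "integrable lborel (\<lambda>w. indicator (cball z e) w *\<^sub>R g w)"
    using assms(3) by (simp add: set_integrable_def)
  show "AE w in lborel. norm (bump e (z - w) *\<^sub>R g w) \<le> norm (indicator (cball z e) w *\<^sub>R g w)"
    using assms(1) bump_outside[of e "z - _"] bump_le_1 bump_nonneg
    by (auto simp: indicator_def dist_norm abs_of_nonneg intro!: mult_left_le_one_le)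
qed measurable

lemma mollify_diff:
  assumes "integrable lborel (\<lambda>w. bump e (z - w) *\<^sub>R g w)" "integrable lborel (\<lambda>w. bump e (z - w) *\<^sub>R h w)"
  shows "mollify e (\<lambda>w. g w - h w) z = mollify e g z - mollify e h z"
  using assms by (simp add: mollify_def scaleR_diff_right)

text \<open>Young's inequality for the convolution with the normalised bump.\<close>
lemma nn_integral_mollify_le:
  assumes e: "e > 0" and [measurable]: "g \<in> borel_measurable borel"
  shows "(\<integral>\<^sup>+z. ennreal (cmod (mollify e g z)) \<partial>lborel) \<le> (\<integral>\<^sup>+w. ennreal (cmod (g w)) \<partial>lborel)"
proof -
  let ?m = "bump_mass e"
  have m: "?m > 0" by (rule bump_mass_pos[OF e])
  have "ennreal (cmod (mollify e g z)) \<le> (\<integral>\<^sup>+w. ennreal (bump e (z - w)) * ennreal (cmod (g w)) \<partial>lborel) * ennreal (inverse ?m)" for z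
  proof (cases "integrable lborel (\<lambda>w. bump e (z - w) *\<^sub>R g w)")
    case True
    have "ennreal (cmod (mollify e g z)) = ennreal (cmod (\<integral>w. bump e (z - w) *\<^sub>R g w \<partial>lborel)) * ennreal (inverse ?m)"
      using m by (simp add: mollify_def ennreal_mult mult.commute)
    also have "\<dots> \<le> (\<integral>\<^sup>+w. norm (bump e (z - w) *\<^sub>R g w) \<partial>lborel) * ennreal (inverse ?m)"
      by (intro mult_right_mono integral_norm_bound_ennreal True) simp
    finally show ?thesis
      by (simp add: ennreal_mult abs_of_nonneg bump_nonneg)
  qed (simp add: mollify_def not_integrable_integral_eq)
  then have "(\<integral>\<^sup>+z. ennreal (cmod (mollify e g z)) \<partial>lborel)
      \<le> (\<integral>\<^sup>+z. (\<integral>\<^sup>+w. ennreal (bump e (z - w)) * ennreal (cmod (g w)) \<partial>lborel) * ennreal (inverse ?m) \<partial>lborel)"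
    by (intro nn_integral_mono)
  also have "\<dots> = (\<integral>\<^sup>+z. \<integral>\<^sup>+w. ennreal (bump e (z - w)) * ennreal (cmod (g w)) \<partial>lborel \<partial>lborel) * ennreal (inverse ?m)"
    by (intro nn_integral_multc) measurable
  also have "(\<integral>\<^sup>+z. \<integral>\<^sup>+w. ennreal (bump e (z - w)) * ennreal (cmod (g w)) \<partial>lborel \<partial>lborel)
      = (\<integral>\<^sup>+w. \<integral>\<^sup>+z. ennreal (bump e (z - w)) * ennreal (cmod (g w)) \<partial>lborel \<partial>lborel)"
    by (intro lborel_pair.Fubini') measurable
  also have "\<dots> = (\<integral>\<^sup>+w. ennreal ?m * ennreal (cmod (g w)) \<partial>lborel)"
    by (subst bump_sym) (simp add: nn_integral_multc nn_integral_bump_shift)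
  also have "\<dots> = ennreal ?m * (\<integral>\<^sup>+w. ennreal (cmod (g w)) \<partial>lborel)"
    by (rule nn_integral_cmult) measurable
  also have "\<dots> * ennreal (inverse ?m) = (\<integral>\<^sup>+w. ennreal (cmod (g w)) \<partial>lborel) * (ennreal ?m * ennreal (inverse ?m))"
    by (simp add: ac_simps)
  also have "ennreal ?m * ennreal (inverse ?m) = 1"
    using m by (simp flip: ennreal_mult)
  finally show ?thesis by simp
qed

text \<open>The mollification at \<open>z\<close> averages values at distance less than \<open>e\<close>, which differ little from
  \<open>\<phi> z\<close> by uniform continuity on a compact neighbourhood of \<open>K\<close>.\<close>
lemma mollify_converges_uniformly:
  assumes "open D" "compact K" "K \<subseteq> D" "continuous_on D \<phi>" and [measurable]: "\<phi> \<in> borel_measurable borel" and "\<eta> > 0"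
  obtains \<delta> where "\<delta> > 0" "\<And>z. z \<in> K \<Longrightarrow> cball z \<delta> \<subseteq> D"
    "\<And>e z. \<lbrakk>0 < e; e < \<delta>; z \<in> K\<rbrakk> \<Longrightarrow> cmod (mollify e \<phi> z - \<phi> z) \<le> \<eta>"
proof -
  obtain \<delta>1 where \<delta>1: "\<delta>1 > 0" "(\<Union>x\<in>K. cball x \<delta>1) \<subseteq> D"
    using compact_subset_open_imp_cball_epsilon_subset assms by metis
  let ?L = "\<Union>x\<in>K. cball x \<delta>1"
  have L: "compact ?L" by (rule compact_minkowski_sum_cball) fact
  have "uniformly_continuous_on ?L \<phi>"
    using L \<delta>1 assms by (intro compact_uniformly_continuous) (auto intro: continuous_on_subset)
  then obtain \<delta>2 where \<delta>2: "\<delta>2 > 0" "\<And>z w. z \<in> ?L \<Longrightarrow> w \<in> ?L \<Longrightarrow> dist w z < \<delta>2 \<Longrightarrow> dist (\<phi> w) (\<phi> z) < \<eta>"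
    using \<open>\<eta> > 0\<close> unfolding uniformly_continuous_on_def by metis
  define \<delta> where "\<delta> = min \<delta>1 \<delta>2"
  have "cmod (mollify e \<phi> z - \<phi> z) \<le> \<eta>" if e: "0 < e" "e < \<delta>" "z \<in> K" for e z
  proof -
    have m: "bump_mass e > 0" by (rule bump_mass_pos) fact
    have sub: "cball z e \<subseteq> ?L" using e \<delta>_def by force
    have "set_integrable lborel (cball z e) \<phi>"
      unfolding set_integrable_def using sub \<delta>1 assms(4)
      by (intro borel_integrable_compact) (auto intro: continuous_on_subset)
    then have i1: "integrable lborel (\<lambda>w. bump e (z - w) *\<^sub>R \<phi> w)"
      by (intro integrable_bump_mult e) simp_all
    have hb: "integrable lborel (\<lambda>w. bump e (z - w))" "(\<integral>w. bump e (z - w) \<partial>lborel) = bump_mass e"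
      using has_bochner_integral_bump_shift[OF e(1), of z] by (auto simp: has_bochner_integral_iff)
    have i2: "integrable lborel (\<lambda>w. bump e (z - w) *\<^sub>R \<phi> z)"
      using hb by simp
    have "mollify e \<phi> z - \<phi> z = (\<integral>w. bump e (z - w) *\<^sub>R (\<phi> w - \<phi> z) \<partial>lborel) /\<^sub>R bump_mass e"
      using i1 i2 hb m by (simp add: mollify_def scaleR_diff_right)
    moreover have "cmod (\<integral>w. bump e (z - w) *\<^sub>R (\<phi> w - \<phi> z) \<partial>lborel) \<le> (\<integral>w. bump e (z - w) * \<eta> \<partial>lborel)"
    proof (rule Bochner_Integration.integral_norm_bound_integral)
      fix w
      show "norm (bump e (z - w) *\<^sub>R (\<phi> w - \<phi> z)) \<le> bump e (z - w) * \<eta>"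
      proof (cases "dist z w < e")
        case True
        then have "w \<in> ?L" "z \<in> ?L" "dist w z < \<delta>2"
          using e \<delta>_def \<delta>1 by (auto intro!: bexI[of _ z] simp: dist_commute)
        then have "cmod (\<phi> w - \<phi> z) \<le> \<eta>" using \<delta>2(2)[of z w] by (simp add: dist_norm)
        then show ?thesis by (simp add: abs_of_nonneg bump_nonneg mult_left_mono)
      next
        case False
        then show ?thesis using bump_outside[of e "z - w"] e by (simp add: dist_norm)
      qed
    qed (use i1 i2 hb in \<open>auto simp: scaleR_diff_right\<close>)
    ultimately show ?thesis using hb m by (simp add: field_simps)
  qed
  moreover have "\<delta> > 0" "\<And>z. z \<in> K \<Longrightarrow> cball z \<delta> \<subseteq> D"
    using \<delta>1 \<delta>2 by (force simp: \<delta>_def)+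
  ultimately show thesis using that by blast
qed

text \<open>Cut off outside a compact neighbourhood \<open>L\<close> of \<open>K\<close>, \<open>g\<close> is close in \<open>L\<^sup>1\<close> to a continuous
  \<open>\<phi>\<close>.  Young's inequality bounds the mollification of the difference, and the mollifications of
  \<open>\<phi>\<close> converge uniformly on \<open>K\<close>.\<close>
lemma mollify_converges_L1:
  assumes D: "open D" and K: "compact K" "K \<subseteq> D" and [measurable]: "g \<in> borel_measurable borel"
    and loc: "\<And>L. compact L \<Longrightarrow> L \<subseteq> D \<Longrightarrow> set_integrable lborel L g" and \<eta>: "\<eta> > 0"
  obtains \<delta> where "\<delta> > 0" "\<And>z. z \<in> K \<Longrightarrow> cball z \<delta> \<subseteq> D"
    "\<And>e. \<lbrakk>0 < e; e < \<delta>\<rbrakk> \<Longrightarrow> (\<integral>\<^sup>+z\<in>K. ennreal (cmod (mollify e g z - g z)) \<partial>lborel) \<le> ennreal \<eta>"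
proof -
  obtain \<delta>1 where \<delta>1: "\<delta>1 > 0" "(\<Union>x\<in>K. cball x \<delta>1) \<subseteq> D"
    using compact_subset_open_imp_cball_epsilon_subset K D by metis
  define L where "L = (\<Union>x\<in>K. cball x \<delta>1)"
  have L: "compact L" unfolding L_def by (rule compact_minkowski_sum_cball) fact
  have Lb [measurable]: "L \<in> sets borel" using L by (simp add: borel_compact)
  have [measurable]: "K \<in> sets borel" using K by (simp add: borel_compact)
  define gL where "gL = (\<lambda>w. indicator L w *\<^sub>R g w)"
  have gL: "integrable lborel gL"
    using loc[OF L] \<delta>1 by (simp add: gL_def L_def set_integrable_def)
  have [measurable]: "gL \<in> borel_measurable borel" unfolding gL_def by measurable
  obtain \<phi> where \<phi>: "continuous_on UNIV \<phi>" "(\<integral>\<^sup>+z. ennreal (cmod (gL z - \<phi> z)) \<partial>lborel) < ennreal (\<eta>/3)"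
    using L1_density_continuous[OF gL, of "\<eta>/3"] \<eta> by auto
  have [measurable]: "\<phi> \<in> borel_measurable borel" using \<phi>(1) by (rule borel_measurable_continuous_onI)
  define mK where "mK = measure lborel K"
  have mK: "emeasure lborel K = ennreal mK"
    unfolding mK_def by (intro emeasure_eq_ennreal_measure) (use emeasure_compact_finite[OF K(1)] in auto)
  have mK0: "mK \<ge> 0" by (simp add: mK_def)
  obtain \<delta>2 where \<delta>2: "\<delta>2 > 0" "\<And>e z. \<lbrakk>0 < e; e < \<delta>2; z \<in> K\<rbrakk> \<Longrightarrow> cmod (mollify e \<phi> z - \<phi> z) \<le> \<eta> / (3 * (mK + 1))"
    using mollify_converges_uniformly[of UNIV K \<phi> "\<eta> / (3 * (mK + 1))"] K \<phi>(1) \<eta> mK0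
    by (smt (verit, ccfv_threshold) \<open>\<phi> \<in> borel_measurable borel\<close> divide_pos_pos open_UNIV subset_UNIV)
  define \<delta> where "\<delta> = min \<delta>1 \<delta>2"
  have "(\<integral>\<^sup>+z\<in>K. ennreal (cmod (mollify e g z - g z)) \<partial>lborel) \<le> ennreal \<eta>" if e: "0 < e" "e < \<delta>" for e
  proof -
    have "(\<integral>\<^sup>+z\<in>K. ennreal (cmod (mollify e g z - g z)) \<partial>lborel) \<le>
       (\<integral>\<^sup>+z. ennreal (cmod (mollify e (\<lambda>w. gL w - \<phi> w) z)) + (ennreal (\<eta> / (3 * (mK + 1))) * indicator K z + ennreal (cmod (gL z - \<phi> z))) \<partial>lborel)"
    proof (intro nn_integral_mono)
      fix z
      show "ennreal (cmod (mollify e g z - g z)) * indicator K z \<le> ennreal (cmod (mollify e (\<lambda>w. gL w - \<phi> w) z)) + (ennreal (\<eta> / (3 * (mK + 1))) * indicator K z + ennreal (cmod (gL z - \<phi> z)))"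
      proof (cases "z \<in> K")
        case True
        have sub: "cball z e \<subseteq> L" using True e by (force simp: L_def \<delta>_def)
        have "bump e (z - w) *\<^sub>R g w = bump e (z - w) *\<^sub>R gL w" for w
          using sub bump_outside[of e "z - w"] e by (cases "cmod (z - w) < e") (auto simp: gL_def dist_norm subset_iff)
        then have eq: "mollify e g z = mollify e gL z"
          unfolding mollify_def by (simp only:)
        have eq2: "g z = gL z" using sub e by (simp add: gL_def subset_iff)
        have i1: "integrable lborel (\<lambda>w. bump e (z - w) *\<^sub>R gL w)"
          using gL e by (intro integrable_bump_mult) (auto simp: set_integrable_def intro: integrable_mult_indicator)
        have i2: "integrable lborel (\<lambda>w. bump e (z - w) *\<^sub>R \<phi> w)"
          using e \<phi>(1) by (intro integrable_bump_mult)
             (auto simp: set_integrable_def intro!: borel_integrable_compact intro: continuous_on_subset)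
        have "mollify e g z - g z = mollify e (\<lambda>w. gL w - \<phi> w) z + ((mollify e \<phi> z - \<phi> z) + (\<phi> z - gL z))"
          unfolding mollify_diff[OF i1 i2] eq eq2 by simp
        also have "cmod \<dots> \<le> cmod (mollify e (\<lambda>w. gL w - \<phi> w) z) + (\<eta> / (3 * (mK + 1)) + cmod (gL z - \<phi> z))"
          using \<delta>2(2)[of e z] True e
          by (intro order_trans[OF norm_triangle_ineq] add_mono order_refl) (auto simp: \<delta>_def norm_minus_commute intro!: order_trans[OF norm_triangle_ineq] add_mono)
        finally show ?thesis using True \<eta> mK0 by (simp add: ennreal_leI flip: ennreal_plus)
      qed simp
    qed
    also have "\<dots> = (\<integral>\<^sup>+z. ennreal (cmod (mollify e (\<lambda>w. gL w - \<phi> w) z)) \<partial>lborel) + (ennreal (\<eta> / (3 * (mK + 1))) * ennreal mK + (\<integral>\<^sup>+z. ennreal (cmod (gL z - \<phi> z)) \<partial>lborel))"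
      by (simp add: nn_integral_add nn_integral_cmult_indicator mK)
    also have "\<dots> \<le> ennreal (\<eta>/3) + (ennreal (\<eta> / 3) + ennreal (\<eta>/3))"
    proof (intro add_mono)
      show "(\<integral>\<^sup>+z. ennreal (cmod (mollify e (\<lambda>w. gL w - \<phi> w) z)) \<partial>lborel) \<le> ennreal (\<eta>/3)"
        using nn_integral_mollify_le[of e "\<lambda>w. gL w - \<phi> w"] e \<phi>(2) by auto
      show "ennreal (\<eta> / (3 * (mK + 1))) * ennreal mK \<le> ennreal (\<eta> / 3)"
        using \<eta> mK0 by (subst ennreal_mult[symmetric]) (auto intro!: ennreal_leI simp: field_simps)
    qed (use \<phi>(2) in auto)
    also have "\<dots> = ennreal \<eta>" using \<eta> by (simp flip: ennreal_plus)
    finally show ?thesis .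
  qed
  moreover have "\<delta> > 0" "\<And>z. z \<in> K \<Longrightarrow> cball z \<delta> \<subseteq> D"
    using \<delta>1 \<delta>2 by (force simp: \<delta>_def)+
  ultimately show thesis using that by blast
qed

section \<open>Absolute continuity on almost every curve of a family\<close>

text \<open>\<open>F\<close> is the map extended by zero, and \<open>gx\<close>, \<open>gy\<close> are representatives of its weak partial
  derivatives.  Working with Borel functions on the whole plane gives all integrals along individual
  curves a meaning.\<close>
locale weakly_differentiable =
  fixes D :: "complex set" and F gx gy :: "complex \<Rightarrow> complex"
  assumes open_D: "open D" and cont: "continuous_on D F" and zero: "\<And>z. z \<notin> D \<Longrightarrow> F z = 0"
    and meas_gx [measurable]: "gx \<in> borel_measurable borel" and meas_gy [measurable]: "gy \<in> borel_measurable borel"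
    and int_gx: "\<And>K. compact K \<Longrightarrow> K \<subseteq> D \<Longrightarrow> set_integrable lborel K gx"
    and int_gy: "\<And>K. compact K \<Longrightarrow> K \<subseteq> D \<Longrightarrow> set_integrable lborel K gy"
    and weak_x: "\<And>\<phi>. test_function D \<phi> \<Longrightarrow> (\<integral>z. frechet_derivative \<phi> (at z) 1 *\<^sub>R F z \<partial>lborel) = - (\<integral>z. \<phi> z *\<^sub>R gx z \<partial>lborel)"
    and weak_y: "\<And>\<phi>. test_function D \<phi> \<Longrightarrow> (\<integral>z. frechet_derivative \<phi> (at z) \<i> *\<^sub>R F z \<partial>lborel) = - (\<integral>z. \<phi> z *\<^sub>R gy z \<partial>lborel)"
begin

lemma meas_D [measurable]: "D \<in> sets borel" using open_D by simp

lemma meas_F [measurable]: "F \<in> borel_measurable borel"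
proof -
  have "F = (\<lambda>z. if z \<in> D then F z else 0)" using zero by auto
  also have "\<dots> \<in> borel_measurable borel"
    by (rule borel_measurable_continuous_on_if) (auto intro: cont)
  finally show ?thesis .
qed

text \<open>The disc about \<open>z\<close> lies in \<open>D\<close>, so the bump centred at \<open>z\<close> is a test function, and the
  derivative can be moved from the bump to \<open>F\<close>.\<close>
lemma mollify_weak_derivative:
  assumes e: "e > 0" "cball z e \<subseteq> D"
  shows "(\<integral>w. bump_deriv e (z - w) 1 *\<^sub>R F w \<partial>lborel) = (\<integral>w. bump e (z - w) *\<^sub>R gx w \<partial>lborel)"
    "(\<integral>w. bump_deriv e (z - w) \<i> *\<^sub>R F w \<partial>lborel) = (\<integral>w. bump e (z - w) *\<^sub>R gy w \<partial>lborel)"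
  using weak_x[OF test_function_bump[OF e]] weak_y[OF test_function_bump[OF e]]
  by (simp_all add: frechet_derivative_bump)

lemma bump_deriv_cartesian: "bump_deriv e u v = Re v * bump_deriv e u 1 + Im v * bump_deriv e u \<i>"
  by (simp add: bump_deriv_def inner_complex_def algebra_simps)

lemma integrable_bump_deriv:
  assumes e: "e > 0" "cball z e \<subseteq> D"
  shows "integrable lborel (\<lambda>w. bump_deriv e (z - w) v *\<^sub>R F w)"
proof -
  obtain B where B: "\<And>u v. \<bar>bump_deriv e u v\<bar> \<le> B * cmod v" "0 \<le> B"
    by (rule bump_deriv_bound[of e]) blast
  have "integrable lborel (\<lambda>w. indicator (cball z e) w *\<^sub>R F w)"
    using e by (intro borel_integrable_compact continuous_on_subset[OF cont]) auto
  then have "integrable lborel (\<lambda>w. (B * cmod v) *\<^sub>R (indicator (cball z e) w *\<^sub>R F w))"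
    by (rule integrable_scaleR_right)
  then show ?thesis
  proof (rule Bochner_Integration.integrable_bound)
    have "norm (bump_deriv e (z - w) v *\<^sub>R F w) \<le> norm ((B * cmod v) *\<^sub>R (indicator (cball z e) w *\<^sub>R F w))" for w
      using B(1)[of "z - w" v] B(2) e bump_deriv_outside[of e "z - w" v]
      by (cases "cmod (z - w) \<le> e") (auto simp: dist_norm indicator_def intro!: mult_right_mono)
    then show "AE w in lborel. norm (bump_deriv e (z - w) v *\<^sub>R F w) \<le> norm ((B * cmod v) *\<^sub>R (indicator (cball z e) w *\<^sub>R F w))"
      by simp
  qed measurable
qed

text \<open>The fundamental theorem of calculus is applied to the bump along the curve, for each centre
  \<open>w\<close>; multiplying by \<open>F w\<close> and integrating over the plane, Fubini's theorem produces the
  weak derivatives.  In this way the mollification is never differentiated itself.\<close>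
lemma mollify_along_curve:
  fixes c c' :: "real \<Rightarrow> complex"
  assumes e: "e > 0" and ab: "a \<le> b" and sub: "\<And>t. t \<in> {a..b} \<Longrightarrow> cball (c t) e \<subseteq> D"
    and c: "\<And>t. (c has_vector_derivative c' t) (at t)" and c': "continuous_on UNIV c'"
  defines "G \<equiv> (\<lambda>t. Re (c' t) *\<^sub>R mollify e gx (c t) + Im (c' t) *\<^sub>R mollify e gy (c t))"
  shows "set_integrable lborel {a..b} G"
    "mollify e F (c b) - mollify e F (c a) = (LINT t:{a..b}|lborel. G t)"
proof -
  let ?m = "bump_mass e"
  have m: "?m > 0" by (rule bump_mass_pos[OF e])
  have cc: "continuous_on S c" for S
    using c by (meson continuous_at_imp_continuous_on has_vector_derivative_continuous)
  have [measurable]: "c \<in> borel_measurable borel" "c' \<in> borel_measurable borel"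
    using cc c' by (auto intro: borel_measurable_continuous_onI)
  obtain B where B: "\<And>u v. \<bar>bump_deriv e u v\<bar> \<le> B * cmod v" "0 \<le> B"
    by (rule bump_deriv_bound[of e]) blast
  define K where "K = (\<Union>z\<in>c ` {a..b}. cball z e)"
  have K: "compact K" "K \<subseteq> D"
    unfolding K_def using sub by (intro compact_minkowski_sum_cball compact_continuous_image cc compact_Icc, blast)
  have [measurable]: "K \<in> sets borel" using K by (simp add: borel_compact)
  obtain M1 where M1: "\<And>w. w \<in> K \<Longrightarrow> cmod (F w) \<le> M1"
    using compact_imp_bounded[OF compact_continuous_image[OF continuous_on_subset[OF cont K(2)] K(1)]]
    by (auto simp: bounded_iff)
  have "bounded (c' ` {a..b})"
    by (intro compact_imp_bounded compact_continuous_image continuous_on_subset[OF c']) auto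
  then obtain M2 where M2: "\<And>t. t \<in> {a..b} \<Longrightarrow> cmod (c' t) \<le> M2"
    unfolding bounded_iff by blast
  define k where "k = (\<lambda>t w. indicator {a..b} t *\<^sub>R bump_deriv e (c t - w) (c' t) *\<^sub>R F w)"
  have k_int: "integrable (lborel \<Otimes>\<^sub>M lborel) (\<lambda>(t, w). k t w)"
  proof (rule integrableI_bounded_set[where A="{a..b} \<times> K" and B="B * M2 * M1"])
    show "{a..b} \<times> K \<in> sets (lborel \<Otimes>\<^sub>M lborel)" by measurable
    show "(\<lambda>(t, w). k t w) \<in> borel_measurable (lborel \<Otimes>\<^sub>M lborel)"
      unfolding k_def by measurable
    show "emeasure (lborel \<Otimes>\<^sub>M lborel) ({a..b} \<times> K) < \<infinity>"
      using emeasure_compact_finite[OF K(1)] ab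
      by (subst lborel.emeasure_pair_measure_Times) (auto simp: ennreal_mult_less_top)
    show "AE x in lborel \<Otimes>\<^sub>M lborel. x \<in> {a..b} \<times> K \<longrightarrow> norm (case x of (t, w) \<Rightarrow> k t w) \<le> B * M2 * M1"
    proof (intro AE_I2 impI, clarify)
      fix t w assume tw: "t \<in> {a..b}" "w \<in> K"
      have "\<bar>bump_deriv e (c t - w) (c' t)\<bar> * cmod (F w) \<le> (B * M2) * M1"
        using M1[OF tw(2)] order_trans[OF B(1) mult_left_mono[OF M2[OF tw(1)] B(2)]] order_trans[OF norm_ge_zero M2[OF tw(1)]] B(2)
        by (intro mult_mono) auto
      then show "norm (k t w) \<le> B * M2 * M1" using tw by (simp add: k_def)
    qed
    show "AE x in lborel \<Otimes>\<^sub>M lborel. x \<notin> {a..b} \<times> K \<longrightarrow> (case x of (t, w) \<Rightarrow> k t w) = 0"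
    proof (intro AE_I2 impI)
      fix x assume x: "x \<notin> {a..b} \<times> K"
      obtain t w where tw: "x = (t, w)" "(t, w) \<notin> {a..b} \<times> K" using x by (cases x) auto
      have "k t w = 0"
      proof (cases "t \<in> {a..b}")
        case True
        then have "w \<notin> cball (c t) e" using tw by (auto simp: K_def)
        then show ?thesis using bump_deriv_outside[of e "c t - w" "c' t"] e by (simp add: k_def dist_norm)
      qed (simp add: k_def)
      then show "(case x of (t, w) \<Rightarrow> k t w) = 0" by (simp add: tw(1))
    qed
  qed
  have deriv: "((\<lambda>t. bump e (c t - w)) has_vector_derivative bump_deriv e (c t - w) (c' t)) (at t)" for t w
  proof -
    have "((\<lambda>t. c t - w) has_derivative (\<lambda>x. x *\<^sub>R c' t)) (at t)"
      using has_derivative_diff[OF c[unfolded has_vector_derivative_def] has_derivative_const[of w]] by simp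
    from has_derivative_compose[OF this bump_has_derivative]
    show ?thesis unfolding has_vector_derivative_def by (simp add: bump_deriv_def ac_simps)
  qed
  have cbd: "continuous_on {a..b} (\<lambda>t. bump_deriv e (c t - w) (c' t))" for w
    unfolding bump_deriv_def
    by (intro continuous_intros cc continuous_on_subset[OF c'] continuous_on_compose2[OF continuous_on_exp_cut[of UNIV]]) auto
  have inner1: "(\<integral>t. k t w \<partial>lborel) = bump e (c b - w) *\<^sub>R F w - bump e (c a - w) *\<^sub>R F w" for w
  proof -
    have "(\<integral>t. k t w \<partial>lborel) = (\<integral>t. (indicator {a..b} t *\<^sub>R bump_deriv e (c t - w) (c' t)) *\<^sub>R F w \<partial>lborel)"
      by (simp add: k_def)
    also have "\<dots> = (\<integral>t. (indicator {a..b} t *\<^sub>R bump_deriv e (c t - w) (c' t)) \<partial>lborel) *\<^sub>R F w"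
    proof (rule integral_scaleR_left)
      show "integrable lborel (\<lambda>t. indicator {a..b} t *\<^sub>R bump_deriv e (c t - w) (c' t))"
        by (rule borel_integrable_compact) (auto intro: cbd)
    qed
    also have "(\<integral>t. (indicator {a..b} t *\<^sub>R bump_deriv e (c t - w) (c' t)) \<partial>lborel) = bump e (c b - w) - bump e (c a - w)"
      by (rule integral_FTC_atLeastAtMost[OF ab has_vector_derivative_at_within[OF deriv] cbd])
    finally show ?thesis by (simp add: scaleR_diff_left)
  qed
  have inner2: "(\<integral>w. k t w \<partial>lborel) = ?m *\<^sub>R (indicator {a..b} t *\<^sub>R G t)" for t
  proof (cases "t \<in> {a..b}")
    case True
    note s = sub[OF True]
    have "(\<integral>w. k t w \<partial>lborel) = (\<integral>w. Re (c' t) *\<^sub>R (bump_deriv e (c t - w) 1 *\<^sub>R F w) + Im (c' t) *\<^sub>R (bump_deriv e (c t - w) \<i> *\<^sub>R F w) \<partial>lborel)"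
      using True by (simp add: k_def bump_deriv_cartesian[of e "c t - _" "c' t"] scaleR_add_left)
    also have "\<dots> = Re (c' t) *\<^sub>R (\<integral>w. bump_deriv e (c t - w) 1 *\<^sub>R F w \<partial>lborel) + Im (c' t) *\<^sub>R (\<integral>w. bump_deriv e (c t - w) \<i> *\<^sub>R F w \<partial>lborel)"
      using integrable_bump_deriv[OF e s] by (simp del: scaleR_scaleR)
    also have "\<dots> = ?m *\<^sub>R G t"
      unfolding mollify_weak_derivative[OF e s] G_def mollify_def using m by (simp add: scaleR_add_right field_simps)
    finally show ?thesis using True by simp
  qed (simp add: k_def)
  have "integrable lborel (\<lambda>t. \<integral>w. k t w \<partial>lborel)"
    using lborel_pair.integrable_fst'[OF k_int] by simp
  then have "integrable lborel (\<lambda>t. inverse ?m *\<^sub>R ?m *\<^sub>R (indicator {a..b} t *\<^sub>R G t))"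
    unfolding inner2 by (rule integrable_scaleR_right)
  moreover have "inverse ?m *\<^sub>R ?m *\<^sub>R x = x" for x :: complex
    using m by simp
  ultimately show "set_integrable lborel {a..b} G" by (simp only: set_integrable_def)
  have mF: "integrable lborel (\<lambda>w. bump e (c t - w) *\<^sub>R F w)" if "t \<in> {a..b}" for t
    using e sub[OF that] by (intro integrable_bump_mult)
       (auto simp: set_integrable_def intro!: borel_integrable_compact intro: continuous_on_subset[OF cont])
  have "?m *\<^sub>R (mollify e F (c b) - mollify e F (c a)) = (\<integral>w. \<integral>t. k t w \<partial>lborel \<partial>lborel)"
    unfolding inner1 mollify_def using m ab by (simp add: mF scaleR_diff_right)
  also have "\<dots> = (\<integral>t. \<integral>w. k t w \<partial>lborel \<partial>lborel)"
    by (rule lborel_pair.Fubini_integral[OF k_int])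
  also have "\<dots> = ?m *\<^sub>R (LINT t:{a..b}|lborel. G t)"
    unfolding inner2 by (simp add: set_lebesgue_integral_def del: scaleR_scaleR)
  finally show "mollify e F (c b) - mollify e F (c a) = (LINT t:{a..b}|lborel. G t)"
    using m by simp
qed

end

lemma continuous_on_Complex_vertical: "continuous_on S (Complex s)"
proof -
  have "continuous_on S (\<lambda>t. complex_of_real s + \<i> * complex_of_real t)" by (intro continuous_intros)
  then show ?thesis by (simp add: Complex_eq[abs_def] cong: continuous_on_cong) 
qed

text \<open>Absolute continuity with prescribed derivative.  All pairs of end points are included, which makes
  the property pass to subintervals and add up over adjacent intervals.\<close>
definition indefinite_integral_on :: "(real \<Rightarrow> complex) \<Rightarrow> (real \<Rightarrow> complex) \<Rightarrow> real \<Rightarrow> real \<Rightarrow> bool" where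
  "indefinite_integral_on q q' a b \<longleftrightarrow> set_integrable lborel {a..b} q' \<and>
     (\<forall>u v. a \<le> u \<longrightarrow> u \<le> v \<longrightarrow> v \<le> b \<longrightarrow> q v - q u = (LINT t:{u..v}|lborel. q' t))"

text \<open>Both sides are continuous in the end point, so equality at rational end points suffices.\<close>
lemma indefinite_integral_onI:
  fixes q q' :: "real \<Rightarrow> complex"
  assumes int: "set_integrable lborel {a..b} q'" and cont: "continuous_on {a..b} q" and ab: "a < b"
    and eq: "\<And>t. t \<in> \<rat> \<Longrightarrow> a < t \<Longrightarrow> t < b \<Longrightarrow> q t - q a = (LINT t:{a..t}|lborel. q' t)"
  shows "indefinite_integral_on q q' a b"
proof -
  have hk: "q' integrable_on {a..b}" by (rule set_borel_integral_eq_integral(1)[OF int])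
  have sub: "set_integrable lborel {u..v} q'" if "a \<le> u" "v \<le> b" for u v
    by (rule set_integrable_subset[OF int]) (use that in auto)
  have L: "(LINT t:{u..v}|lborel. q' t) = integral {u..v} q'" if "a \<le> u" "v \<le> b" for u v
    by (rule set_borel_integral_eq_integral(2)[OF sub[OF that]])
  have c: "continuous_on {a..b} (\<lambda>t. q t - q a - integral {a..t} q')"
    by (intro continuous_intros cont indefinite_integral_continuous_1 hk)
  have cl: "closure ({a<..<b} \<inter> \<rat>) = {a..b}"
    using closure_open_Int_superset[of "{a<..<b}" "\<rat>"] Rats_closure_real ab by auto
  have eqI: "q t - q a - integral {a..t} q' = 0" if "t \<in> {a..b}" for t
    using continuous_constant_on_closure[of "{a<..<b} \<inter> \<rat>" "\<lambda>t. q t - q a - integral {a..t} q'" 0 t] c that eq L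
    unfolding cl by auto
  have "q v - q u = (LINT t:{u..v}|lborel. q' t)" if "a \<le> u" "u \<le> v" "v \<le> b" for u v
  proof -
    have "integral {a..u} q' + integral {u..v} q' = integral {a..v} q'"
      by (rule Henstock_Kurzweil_Integration.integral_combine) (use that hk in \<open>auto intro: integrable_on_subinterval\<close>)
    then show ?thesis using eqI[of u] eqI[of v] that by (simp add: L algebra_simps)
  qed
  with int show ?thesis by (simp add: indefinite_integral_on_def)
qed

context weakly_differentiable
begin

text \<open>For fixed \<open>s\<close> the curve is \<open>t \<mapsto> T (Complex s t)\<close>.  The constant \<open>C\<close> bounds how much area \<open>T\<close>
  may compress; with it, \<open>L\<^sup>1\<close> estimates on \<open>T ` cbox p q\<close> become estimates for the integral over \<open>s\<close>
  of integrals along the curves.  For a fixed end point \<open>t\<close>, the defect \<open>\<Delta> s\<close> in the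
  fundamental theorem of calculus is compared with the vanishing defect of the mollification, and its
  integral over \<open>s\<close> turns out to be arbitrarily small.\<close>
theorem absolutely_continuous_on_almost_every_curve:
  fixes T T' :: "complex \<Rightarrow> complex"
  assumes T: "continuous_on UNIV T" and T': "continuous_on UNIV T'"
    and deriv: "\<And>s t. ((\<lambda>t. T (Complex s t)) has_vector_derivative T' (Complex s t)) (at t)"
    and sub: "T ` cbox p q \<subseteq> D" and pq: "Im p < Im q"
    and C: "\<And>h. h \<in> borel_measurable borel \<Longrightarrow> (\<integral>\<^sup>+w\<in>cbox p q. h (T w) \<partial>lborel) \<le> ennreal C * (\<integral>\<^sup>+z. h z \<partial>lborel)" "C \<ge> 0"
  defines "G \<equiv> (\<lambda>w. Re (T' w) *\<^sub>R gx (T w) + Im (T' w) *\<^sub>R gy (T w))"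
  shows "AE s in lborel. s \<in> {Re p..Re q} \<longrightarrow>
    indefinite_integral_on (\<lambda>t. F (T (Complex s t))) (\<lambda>t. G (Complex s t)) (Im p) (Im q)"
proof -
  let ?B = "cbox p q" and ?s1 = "Re p" and ?s2 = "Re q" and ?t1 = "Im p" and ?t2 = "Im q"
  have [measurable]: "T \<in> borel_measurable borel" "T' \<in> borel_measurable borel"
    using T T' by (auto intro: borel_measurable_continuous_onI)
  have [measurable]: "G \<in> borel_measurable borel" unfolding G_def by measurable
  have B: "Complex s t \<in> ?B \<longleftrightarrow> s \<in> {?s1..?s2} \<and> t \<in> {?t1..?t2}" for s t
    by (auto simp: in_cbox_complex_iff)
  define K where "K = T ` ?B"
  have K: "compact K" "K \<subseteq> D"
    unfolding K_def using sub by (auto intro!: compact_continuous_image continuous_on_subset[OF T])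
  have [measurable]: "K \<in> sets borel" using K by (simp add: borel_compact)
  have "bounded (T' ` ?B)"
    by (intro compact_imp_bounded compact_continuous_image continuous_on_subset[OF T']) auto
  then obtain M where M: "\<And>w. w \<in> ?B \<Longrightarrow> cmod (T' w) \<le> M"
    unfolding bounded_iff by blast
  define M' where "M' = \<bar>M\<bar>"
  have M': "\<bar>Re (T' w)\<bar> \<le> M'" "\<bar>Im (T' w)\<bar> \<le> M'" "M' \<ge> 0" if "w \<in> ?B" for w
    using M[OF that] abs_Re_le_cmod[of "T' w"] abs_Im_le_cmod[of "T' w"] by (auto simp: M'_def)
  have M'0: "M' \<ge> 0" by (simp add: M'_def)
  have iterated: "(\<integral>\<^sup>+s\<in>{?s1..?s2}. (\<integral>\<^sup>+t\<in>{?t1..?t2}. h (Complex s t) \<partial>lborel) \<partial>lborel) = (\<integral>\<^sup>+w\<in>?B. h w \<partial>lborel)"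
    if [measurable]: "h \<in> borel_measurable borel" for h :: "complex \<Rightarrow> ennreal"
  proof -
    have "(\<integral>\<^sup>+w\<in>?B. h w \<partial>lborel) = (\<integral>\<^sup>+s. (\<integral>\<^sup>+t. h (Complex s t) * indicator ?B (Complex s t) \<partial>lborel) \<partial>lborel)"
      by (rule nn_integral_complex_iterated) measurable
    also have "\<dots> = (\<integral>\<^sup>+s\<in>{?s1..?s2}. (\<integral>\<^sup>+t\<in>{?t1..?t2}. h (Complex s t) \<partial>lborel) \<partial>lborel)"
      by (intro nn_integral_cong) (auto simp: B indicator_def)
    finally show ?thesis ..
  qed
  have bound: "(\<integral>\<^sup>+w\<in>?B. ennreal (M' * (cmod (u (T w)) + cmod (v (T w)))) \<partial>lborel)
      \<le> ennreal (C * M') * ((\<integral>\<^sup>+z\<in>K. ennreal (cmod (u z)) \<partial>lborel) + (\<integral>\<^sup>+z\<in>K. ennreal (cmod (v z)) \<partial>lborel))"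
    if [measurable]: "u \<in> borel_measurable borel" "v \<in> borel_measurable borel" for u v :: "complex \<Rightarrow> complex"
  proof -
    have "(\<integral>\<^sup>+w\<in>?B. ennreal (M' * (cmod (u (T w)) + cmod (v (T w)))) \<partial>lborel) =
      (\<integral>\<^sup>+w\<in>?B. (\<lambda>z. ennreal (M' * (cmod (u z) + cmod (v z))) * indicator K z) (T w) \<partial>lborel)"
      by (intro nn_integral_cong) (auto simp: K_def indicator_def)
    also have "\<dots> \<le> ennreal C * (\<integral>\<^sup>+z. ennreal (M' * (cmod (u z) + cmod (v z))) * indicator K z \<partial>lborel)"
      by (rule C) measurable
    also have "(\<integral>\<^sup>+z. ennreal (M' * (cmod (u z) + cmod (v z))) * indicator K z \<partial>lborel)
      = (\<integral>\<^sup>+z. ennreal M' * (ennreal (cmod (u z)) * indicator K z + ennreal (cmod (v z)) * indicator K z) \<partial>lborel)"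
      using M'0 by (intro nn_integral_cong) (auto simp: indicator_def ennreal_mult simp flip: ennreal_plus)
    also have "\<dots> = ennreal M' * ((\<integral>\<^sup>+z\<in>K. ennreal (cmod (u z)) \<partial>lborel) + (\<integral>\<^sup>+z\<in>K. ennreal (cmod (v z)) \<partial>lborel))"
      by (simp add: nn_integral_cmult nn_integral_add)
    finally show ?thesis using C(2) M'0 by (simp add: ennreal_mult mult.assoc)
  qed
  have combine: "cmod (Re (T' w) *\<^sub>R x + Im (T' w) *\<^sub>R y) \<le> M' * (cmod x + cmod y)" if "w \<in> ?B" for w x y
    using M'[OF that]
    by (intro order_trans[OF norm_triangle_ineq]) (auto simp: distrib_left intro!: add_mono mult_right_mono)
  have fin: "(\<integral>\<^sup>+z\<in>K. ennreal (cmod (g z)) \<partial>lborel) < \<infinity>" if "set_integrable lborel K g" for g :: "complex \<Rightarrow> complex"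
  proof -
    have "(\<integral>\<^sup>+z\<in>K. ennreal (cmod (g z)) \<partial>lborel) = (\<integral>\<^sup>+z. ennreal (norm (indicator K z *\<^sub>R g z)) \<partial>lborel)"
      by (intro nn_integral_cong) (auto simp: indicator_def)
    then show ?thesis using that unfolding set_integrable_def integrable_iff_bounded by simp
  qed
  have "(\<integral>\<^sup>+s\<in>{?s1..?s2}. (\<integral>\<^sup>+t\<in>{?t1..?t2}. ennreal (cmod (G (Complex s t))) \<partial>lborel) \<partial>lborel) = (\<integral>\<^sup>+w\<in>?B. ennreal (cmod (G w)) \<partial>lborel)"
    by (rule iterated) measurable
  also have "\<dots> \<le> (\<integral>\<^sup>+w\<in>?B. ennreal (M' * (cmod (gx (T w)) + cmod (gy (T w)))) \<partial>lborel)"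
    by (intro nn_integral_mono) (auto simp: indicator_def G_def intro!: ennreal_leI combine)
  also have "\<dots> \<le> ennreal (C * M') * ((\<integral>\<^sup>+z\<in>K. ennreal (cmod (gx z)) \<partial>lborel) + (\<integral>\<^sup>+z\<in>K. ennreal (cmod (gy z)) \<partial>lborel))"
    by (rule bound) measurable
  also have "\<dots> < \<infinity>"
    using fin[OF int_gx[OF K]] fin[OF int_gy[OF K]] by (simp add: ennreal_mult_less_top)
  finally have "AE s in lborel. (\<integral>\<^sup>+t\<in>{?t1..?t2}. ennreal (cmod (G (Complex s t))) \<partial>lborel) * indicator {?s1..?s2} s \<noteq> \<infinity>"
    by (intro nn_integral_noteq_infinite) auto
  then have AE_int: "AE s in lborel. s \<in> {?s1..?s2} \<longrightarrow> set_integrable lborel {?t1..?t2} (\<lambda>t. G (Complex s t))"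
  proof (rule AE_mp, intro AE_I2 impI)
    fix s assume *: "(\<integral>\<^sup>+t\<in>{?t1..?t2}. ennreal (cmod (G (Complex s t))) \<partial>lborel) * indicator {?s1..?s2} s \<noteq> \<infinity>" "s \<in> {?s1..?s2}"
    have "(\<integral>\<^sup>+t\<in>{?t1..?t2}. ennreal (cmod (G (Complex s t))) \<partial>lborel) = (\<integral>\<^sup>+t. ennreal (norm (indicator {?t1..?t2} t *\<^sub>R G (Complex s t))) \<partial>lborel)"
      by (intro nn_integral_cong) (auto simp: indicator_def)
    then show "set_integrable lborel {?t1..?t2} (\<lambda>t. G (Complex s t))"
      unfolding set_integrable_def integrable_iff_bounded using * by (simp add: top.not_eq_extremum)
  qed
  have AE_t: "AE s in lborel. s \<in> {?s1..?s2} \<longrightarrow> F (T (Complex s t)) - F (T (Complex s ?t1)) = (LINT t:{?t1..t}|lborel. G (Complex s t))"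
    if t: "t \<in> {?t1..?t2}" for t
  proof -
    define \<Delta> where "\<Delta> = (\<lambda>s. F (T (Complex s t)) - F (T (Complex s ?t1)) - (LINT t:{?t1..t}|lborel. G (Complex s t)))"
    have [measurable]: "\<Delta> \<in> borel_measurable borel"
      unfolding \<Delta>_def set_lebesgue_integral_def by measurable
    \<comment> \<open>total weight of \<open>\<eta>\<close> in the estimate: two uniform errors over the \<open>s\<close>-interval and two \<open>L\<^sup>1\<close> errors of the gradient; the summand 1 makes it positive\<close>
    define A where "A = 2 * \<bar>?s2 - ?s1\<bar> + 2 * (C * M') + 1"
    have A: "A > 0" using C(2) M'0 by (simp add: A_def add_nonneg_pos)
    have small: "(\<integral>\<^sup>+s\<in>{?s1..?s2}. ennreal (cmod (\<Delta> s)) \<partial>lborel) \<le> ennreal (\<eta> * A)" if \<eta>: "\<eta> > 0" for \<eta>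
    proof -
      obtain \<delta>0 where \<delta>0: "\<delta>0 > 0" "\<And>z. z \<in> K \<Longrightarrow> cball z \<delta>0 \<subseteq> D"
         "\<And>e z. \<lbrakk>0 < e; e < \<delta>0; z \<in> K\<rbrakk> \<Longrightarrow> cmod (mollify e F z - F z) \<le> \<eta>"
        using mollify_converges_uniformly[OF open_D K cont meas_F \<eta>] by metis
      obtain \<delta>x where \<delta>x: "\<delta>x > 0"
         "\<And>e. \<lbrakk>0 < e; e < \<delta>x\<rbrakk> \<Longrightarrow> (\<integral>\<^sup>+z\<in>K. ennreal (cmod (mollify e gx z - gx z)) \<partial>lborel) \<le> ennreal \<eta>"
        using mollify_converges_L1[OF open_D K meas_gx int_gx \<eta>] by metis
      obtain \<delta>y where \<delta>y: "\<delta>y > 0"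
         "\<And>e. \<lbrakk>0 < e; e < \<delta>y\<rbrakk> \<Longrightarrow> (\<integral>\<^sup>+z\<in>K. ennreal (cmod (mollify e gy z - gy z)) \<partial>lborel) \<le> ennreal \<eta>"
        using mollify_converges_L1[OF open_D K meas_gy int_gy \<eta>] by metis
      define e where "e = min \<delta>0 (min \<delta>x \<delta>y) / 2"
      have e: "0 < e" "e < \<delta>0" "e < \<delta>x" "e < \<delta>y" using \<delta>0(1) \<delta>x(1) \<delta>y(1) by (auto simp: e_def)
      define H where "H = (\<lambda>w. ennreal (M' * (cmod (mollify e gx (T w) - gx (T w)) + cmod (mollify e gy (T w) - gy (T w)))))"
      have [measurable]: "H \<in> borel_measurable borel" unfolding H_def by measurable
      have pointwise: "ennreal (cmod (\<Delta> s)) \<le> ennreal (2 * \<eta>) + (\<integral>\<^sup>+t\<in>{?t1..?t2}. H (Complex s t) \<partial>lborel)"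
        if s: "s \<in> {?s1..?s2}" "set_integrable lborel {?t1..?t2} (\<lambda>t. G (Complex s t))" for s
      proof -
        let ?c = "\<lambda>t. T (Complex s t)"
        let ?Ge = "\<lambda>t. Re (T' (Complex s t)) *\<^sub>R mollify e gx (?c t) + Im (T' (Complex s t)) *\<^sub>R mollify e gy (?c t)"
        have inK: "?c r \<in> K" if "r \<in> {?t1..?t2}" for r using B[of s r] s that by (auto simp: K_def)
        have cb: "cball (?c r) e \<subseteq> D" if "r \<in> {?t1..t}" for r
          using \<delta>0(2)[OF inK[of r]] that t e by (auto simp: subset_iff)
        have cT': "continuous_on UNIV (\<lambda>t. T' (Complex s t))"
          by (rule continuous_on_compose2[OF T' continuous_on_Complex_vertical]) simp
        have t1t: "?t1 \<le> t" using t by simp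
        have dc: "(?c has_vector_derivative T' (Complex s r)) (at r)" for r
          by (rule deriv)
        have mc1: "set_integrable lborel {?t1..t} ?Ge"
          by (rule mollify_along_curve(1)[where c="?c" and c'="\<lambda>t. T' (Complex s t)", OF e(1) t1t]) (fact cb dc cT')+
        have mc2: "mollify e F (?c t) - mollify e F (?c ?t1) = (LINT t:{?t1..t}|lborel. ?Ge t)"
          by (rule mollify_along_curve(2)[where c="?c" and c'="\<lambda>t. T' (Complex s t)", OF e(1) t1t]) (fact cb dc cT')+
        have gi: "set_integrable lborel {?t1..t} (\<lambda>t. G (Complex s t))"
          by (rule set_integrable_subset[OF s(2)]) (use t in auto)
        define L where "L = (LINT t:{?t1..t}|lborel. ?Ge t - G (Complex s t))"
        define x y where "x = F (?c t) - mollify e F (?c t)" and "y = mollify e F (?c ?t1) - F (?c ?t1)"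
        have "L = (mollify e F (?c t) - mollify e F (?c ?t1)) - (LINT t:{?t1..t}|lborel. G (Complex s t))"
          unfolding L_def set_integral_diff(2)[OF mc1 gi] mc2[symmetric] ..
        then have "\<Delta> s = x + y + L"
          unfolding \<Delta>_def x_def y_def by simp
        moreover have "cmod x \<le> \<eta>" "cmod y \<le> \<eta>"
          using \<delta>0(3)[OF e(1,2) inK[of t]] \<delta>0(3)[OF e(1,2) inK[of ?t1]] t
          unfolding x_def y_def by (simp_all add: norm_minus_commute)
        ultimately have "cmod (\<Delta> s) \<le> 2 * \<eta> + cmod L"
          using norm_triangle_ineq[of "x + y" L] norm_triangle_ineq[of x y] by (smt (verit))
        then have "ennreal (cmod (\<Delta> s)) \<le> ennreal (2 * \<eta> + cmod L)"
          by (rule ennreal_leI)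
        then have 1: "ennreal (cmod (\<Delta> s)) \<le> ennreal (2 * \<eta>) + ennreal (cmod L)"
          using \<eta> by (subst (asm) ennreal_plus) auto
        have "ennreal (cmod L) \<le> (\<integral>\<^sup>+r. norm (indicator {?t1..t} r *\<^sub>R (?Ge r - G (Complex s r))) \<partial>lborel)"
          using set_integral_diff(1)[OF mc1 gi] unfolding L_def set_lebesgue_integral_def set_integrable_def
          by (rule integral_norm_bound_ennreal)
        also have "\<dots> \<le> (\<integral>\<^sup>+t\<in>{?t1..?t2}. H (Complex s t) \<partial>lborel)"
        proof (intro nn_integral_mono)
          fix r
          show "ennreal (norm (indicator {?t1..t} r *\<^sub>R (?Ge r - G (Complex s r)))) \<le> H (Complex s r) * indicator {?t1..?t2} r"
          proof (cases "r \<in> {?t1..t}")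
            case True
            then have r: "Complex s r \<in> ?B" using t s B by auto
            have "?Ge r - G (Complex s r) = Re (T' (Complex s r)) *\<^sub>R (mollify e gx (?c r) - gx (?c r)) + Im (T' (Complex s r)) *\<^sub>R (mollify e gy (?c r) - gy (?c r))"
              by (simp add: G_def algebra_simps)
            then show ?thesis using True t combine[OF r] by (simp add: H_def ennreal_leI)
          qed simp
        qed
        finally have 2: "ennreal (cmod L) \<le> (\<integral>\<^sup>+t\<in>{?t1..?t2}. H (Complex s t) \<partial>lborel)" .
        show ?thesis by (rule order_trans[OF 1 add_left_mono[OF 2]])
      qed
      have "(\<integral>\<^sup>+s\<in>{?s1..?s2}. ennreal (cmod (\<Delta> s)) \<partial>lborel) \<le>
         (\<integral>\<^sup>+s. ennreal (2 * \<eta>) * indicator {?s1..?s2} s + (\<integral>\<^sup>+t\<in>{?t1..?t2}. H (Complex s t) \<partial>lborel) * indicator {?s1..?s2} s \<partial>lborel)"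
      proof (rule nn_integral_mono_AE, rule AE_mp[OF AE_int], intro AE_I2 impI)
        fix s assume "s \<in> {?s1..?s2} \<longrightarrow> set_integrable lborel {?t1..?t2} (\<lambda>t. G (Complex s t))"
        then show "ennreal (cmod (\<Delta> s)) * indicator {?s1..?s2} s \<le>
            ennreal (2 * \<eta>) * indicator {?s1..?s2} s + (\<integral>\<^sup>+t\<in>{?t1..?t2}. H (Complex s t) \<partial>lborel) * indicator {?s1..?s2} s"
          using pointwise[of s] by (cases "s \<in> {?s1..?s2}") simp_all
      qed
      also have "\<dots> = ennreal (2 * \<eta>) * emeasure lborel {?s1..?s2} + (\<integral>\<^sup>+w\<in>?B. H w \<partial>lborel)"
        by (subst nn_integral_add) (simp_all add: iterated nn_integral_cmult_indicator)
      also have "\<dots> \<le> ennreal (2 * \<eta>) * ennreal \<bar>?s2 - ?s1\<bar> + ennreal (C * M') * (ennreal \<eta> + ennreal \<eta>)"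
      proof (intro add_mono mult_left_mono)
        show "emeasure lborel {?s1..?s2} \<le> ennreal \<bar>?s2 - ?s1\<bar>"
          by (simp add: emeasure_lborel_Icc_eq ennreal_leI)
        have "(\<integral>\<^sup>+w\<in>?B. H w \<partial>lborel) \<le> ennreal (C * M') * ((\<integral>\<^sup>+z\<in>K. ennreal (cmod (mollify e gx z - gx z)) \<partial>lborel) + (\<integral>\<^sup>+z\<in>K. ennreal (cmod (mollify e gy z - gy z)) \<partial>lborel))"
          unfolding H_def by (rule bound) measurable
        also have "\<dots> \<le> ennreal (C * M') * (ennreal \<eta> + ennreal \<eta>)"
          using \<delta>x(2) \<delta>y(2) e by (intro mult_left_mono add_mono) auto
        finally show "(\<integral>\<^sup>+w\<in>?B. H w \<partial>lborel) \<le> ennreal (C * M') * (ennreal \<eta> + ennreal \<eta>)" .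
      qed simp
      also have "\<dots> = ennreal (2 * \<eta> * \<bar>?s2 - ?s1\<bar> + C * M' * (\<eta> + \<eta>))"
        using \<eta> C(2) M'0 by (simp only: ennreal_plus[symmetric] ennreal_mult[symmetric] mult_nonneg_nonneg abs_ge_zero
            add_nonneg_nonneg less_imp_le zero_le_numeral)
      also have "\<dots> \<le> ennreal (\<eta> * A)"
        using \<eta> by (intro ennreal_leI) (simp add: A_def algebra_simps)
      finally show ?thesis .
    qed
    have "(\<integral>\<^sup>+s\<in>{?s1..?s2}. ennreal (cmod (\<Delta> s)) \<partial>lborel) \<le> 0"
    proof (rule ennreal_le_epsilon)
      fix \<eta> :: real assume "0 < \<eta>"
      then show "(\<integral>\<^sup>+s\<in>{?s1..?s2}. ennreal (cmod (\<Delta> s)) \<partial>lborel) \<le> 0 + ennreal \<eta>"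
        using small[of "\<eta> / A"] A by simp
    qed
    then have "AE s in lborel. ennreal (cmod (\<Delta> s)) * indicator {?s1..?s2} s = 0"
      by (subst (asm) le_zero_eq, subst (asm) nn_integral_0_iff_AE) auto
    then show ?thesis
      by (rule AE_mp, intro AE_I2 impI) (auto simp: \<Delta>_def)
  qed
  have "AE s in lborel. \<forall>t\<in>\<rat> \<inter> {?t1..?t2}. s \<in> {?s1..?s2} \<longrightarrow> F (T (Complex s t)) - F (T (Complex s ?t1)) = (LINT t:{?t1..t}|lborel. G (Complex s t))"
  proof (rule AE_ball_countable[THEN iffD2])
    show "countable (\<rat> \<inter> {?t1..?t2})" by (intro countable_Int1 countable_rat)
  qed (intro ballI AE_t, blast)
  from AE_conjI[OF this AE_int] show ?thesis
  proof (rule AE_mp, intro AE_I2 impI)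
    fix s assume h: "(\<forall>t\<in>\<rat> \<inter> {?t1..?t2}. s \<in> {?s1..?s2} \<longrightarrow> F (T (Complex s t)) - F (T (Complex s ?t1)) = (LINT t:{?t1..t}|lborel. G (Complex s t))) \<and> (s \<in> {?s1..?s2} \<longrightarrow> set_integrable lborel {?t1..?t2} (\<lambda>t. G (Complex s t)))"
       and s: "s \<in> {?s1..?s2}"
    have "continuous_on {?t1..?t2} (\<lambda>t. T (Complex s t))"
      by (rule continuous_on_compose2[OF T continuous_on_Complex_vertical]) simp
    then have c: "continuous_on {?t1..?t2} (\<lambda>t. F (T (Complex s t)))"
      by (rule continuous_on_compose2[OF cont]) (use sub B s in auto)
    show "indefinite_integral_on (\<lambda>t. F (T (Complex s t))) (\<lambda>t. G (Complex s t)) ?t1 ?t2"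
      by (rule indefinite_integral_onI[OF _ c pq]) (use h s in auto)
  qed
qed

end

section \<open>Almost everywhere differentiability and the area inequality\<close>

lemma AE_complex_iteratedI:
  assumes P [measurable]: "Measurable.pred borel P" and "AE s in lborel. AE t in lborel. P (Complex s t)"
  shows "AE z in lborel. P z"
proof -
  have "(\<integral>\<^sup>+z. indicator {z. \<not> P z} z \<partial>lborel) = (\<integral>\<^sup>+s. \<integral>\<^sup>+t. indicator {z. \<not> P z} (Complex s t) \<partial>lborel \<partial>lborel)"
    by (rule nn_integral_complex_iterated) measurable
  also have "\<dots> = (\<integral>\<^sup>+s. 0 \<partial>(lborel::real measure))"
  proof (rule nn_integral_cong_AE, rule AE_mp[OF assms(2)], intro AE_I2 impI)
    fix s assume "AE t in lborel. P (Complex s t)"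
    then have "(\<integral>\<^sup>+t. indicator {z. \<not> P z} (Complex s t) \<partial>lborel) = (\<integral>\<^sup>+t. 0 \<partial>(lborel::real measure))"
      by (intro nn_integral_cong_AE, elim AE_mp, intro AE_I2) (simp add: indicator_def)
    then show "(\<integral>\<^sup>+t. indicator {z. \<not> P z} (Complex s t) \<partial>lborel) = 0" by simp
  qed
  finally have "emeasure lborel {z. \<not> P z} = 0" by simp
  then have "AE z in lborel. z \<notin> {z. \<not> P z}"
    by (intro AE_not_in null_setsI) measurable
  then show ?thesis by simp
qed

text \<open>Lebesgue's differentiation theorem on the line, in one-sided form.\<close>
lemma indefinite_integral_right_derivative:
  assumes "indefinite_integral_on q q' a b"
  shows "AE t in lborel. t \<in> {a..<b} \<longrightarrow>
    (\<forall>e>0. \<exists>\<delta>>0. \<forall>h. 0 < h \<and> h < \<delta> \<longrightarrow> cmod (q (t + h) - q t - h *\<^sub>R q' t) \<le> e * h)"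
proof -
  define f where "f = (\<lambda>t. indicator {a..b} t *\<^sub>R q' t)"
  have int: "set_integrable lborel {a..b} q'" 
    and eq: "\<And>u v. a \<le> u \<Longrightarrow> u \<le> v \<Longrightarrow> v \<le> b \<Longrightarrow> q v - q u = (LINT t:{u..v}|lborel. q' t)"
    using assms by (auto simp: indefinite_integral_on_def)
  have "set_integrable lborel (cbox u v) f" for u v
    using int unfolding f_def set_integrable_def by (rule integrable_mult_indicator[rotated]) auto
  then have "f integrable_on cbox u v" for u v
    by (rule set_borel_integral_eq_integral(1))
  then obtain N where N: "negligible N" "\<And>x e. \<lbrakk>x \<notin> N; 0 < e\<rbrakk> \<Longrightarrow>
      \<exists>d>0. \<forall>h. 0 < h \<and> h < d \<longrightarrow> norm (integral (cbox x (x + h *\<^sub>R One)) f /\<^sub>R h ^ DIM(real) - f x) < e"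
    using integrable_ccontinuous_explicit[of f] by metis
  have "N \<in> null_sets lebesgue" using N(1) by (simp add: negligible_iff_null_sets)
  then have "AE t in lebesgue. t \<notin> N" by (rule AE_not_in)
  then have "AE t in lborel. t \<notin> N" by (simp add: AE_completion_iff)
  then show ?thesis
  proof (rule AE_mp, intro AE_I2 impI allI)
    fix t e :: real assume t: "t \<notin> N" "t \<in> {a..<b}" and e: "0 < e"
    obtain d where d: "d > 0" "\<And>h. 0 < h \<Longrightarrow> h < d \<Longrightarrow> norm (integral (cbox t (t + h *\<^sub>R One)) f /\<^sub>R h ^ DIM(real) - f t) < e"
      using N(2)[OF t(1) e] by auto
    define \<delta> where "\<delta> = min d (b - t)"
    have "cmod (q (t + h) - q t - h *\<^sub>R q' t) \<le> e * h" if h: "0 < h" "h < \<delta>" for h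
    proof -
      have sub: "a \<le> t" "t \<le> t + h" "t + h \<le> b" using h t by (auto simp: \<delta>_def)
      have "q (t + h) - q t = (LINT r:{t..t+h}|lborel. q' r)" by (rule eq[OF sub])
      also have "\<dots> = integral {t..t+h} q'"
        by (rule set_borel_integral_eq_integral(2), rule set_integrable_subset[OF int]) (use sub in auto)
      also have "\<dots> = integral {t..t+h} f"
        by (rule Henstock_Kurzweil_Integration.integral_cong) (use sub in \<open>auto simp: f_def\<close>)
      finally have I: "integral (cbox t (t + h *\<^sub>R One)) f = q (t + h) - q t" by simp
      have ft: "f t = q' t" using t by (simp add: f_def)
      have "cmod ((q (t + h) - q t) /\<^sub>R h - q' t) < e"
        using d(2)[of h] h unfolding I ft by (simp add: \<delta>_def)
      moreover have "q (t + h) - q t - h *\<^sub>R q' t = h *\<^sub>R ((q (t + h) - q t) /\<^sub>R h - q' t)"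
        using h by (simp add: scaleR_diff_right)
      moreover have "cmod (h *\<^sub>R x) = h * cmod x" for x :: complex using h by simp
      ultimately show ?thesis using h by (metis less_imp_le mult.commute mult_left_mono)
    qed
    moreover have "\<delta> > 0" using d t by (simp add: \<delta>_def)
    ultimately show "\<exists>\<delta>>0. \<forall>h. 0 < h \<and> h < \<delta> \<longrightarrow> cmod (q (t + h) - q t - h *\<^sub>R q' t) \<le> e * h" by blast
  qed
qed

text \<open>Egorov's theorem in terms of sets: the points where the \<open>k\<close>-th accuracy is reached at a stage
  that may be chosen uniformly fill up \<open>B\<close> up to a set of small measure.\<close>
lemma Egorov_sets:
  fixes V :: "nat \<Rightarrow> nat \<Rightarrow> 'a set"
  assumes V [measurable]: "\<And>n k. V n k \<in> sets M" and inc: "\<And>k. incseq (\<lambda>n. V n k)" and B [measurable]: "B \<in> sets M"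
    and fin: "emeasure M B < \<infinity>" and ae: "\<And>k. AE z in M. z \<in> B \<longrightarrow> (\<exists>n. z \<in> V n k)" and \<eta>: "\<eta> > 0"
  obtains \<nu> where "emeasure M (B - (\<Inter>k. V (\<nu> k) k)) \<le> ennreal \<eta>"
proof -
  have "\<exists>n. emeasure M (B - V n k) < ennreal (\<eta> * (1/2) ^ Suc k)" for k
  proof -
    have "(\<lambda>n. emeasure M (B - V n k)) \<longlonglongrightarrow> emeasure M (\<Inter>n. B - V n k)"
    proof (rule Lim_emeasure_decseq)
      show "decseq (\<lambda>n. B - V n k)" using inc[of k] unfolding decseq_def incseq_def by blast
      show "emeasure M (B - V n k) \<noteq> \<infinity>" for n
        using emeasure_mono[of "B - V n k" B M] fin by (auto simp: top_unique)
    qed auto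
    moreover have "(\<Inter>n. B - V n k) \<in> null_sets M"
    proof -
      have "AE z in M. z \<notin> (\<Inter>n. B - V n k)" by (rule AE_mp[OF ae[of k]], intro AE_I2) auto
      then show ?thesis by (subst AE_iff_null_sets) auto
    qed
    ultimately have "(\<lambda>n. emeasure M (B - V n k)) \<longlonglongrightarrow> 0" by (simp add: null_setsD1)
    moreover have "0 < ennreal (\<eta> * (1/2) ^ Suc k)" using \<eta> by (simp add: zero_less_mult_iff)
    ultimately have "\<forall>\<^sub>F n in sequentially. emeasure M (B - V n k) < ennreal (\<eta> * (1/2) ^ Suc k)"
      by (rule order_tendstoD(2))
    then show ?thesis by (auto simp: eventually_sequentially)
  qed
  then obtain \<nu> where \<nu>: "\<And>k. emeasure M (B - V (\<nu> k) k) < ennreal (\<eta> * (1/2) ^ Suc k)" by metis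
  have "emeasure M (B - (\<Inter>k. V (\<nu> k) k)) = emeasure M (\<Union>k. B - V (\<nu> k) k)"
    by (rule arg_cong[where f="emeasure M"]) auto
  also have "\<dots> \<le> (\<Sum>k. emeasure M (B - V (\<nu> k) k))"
    by (rule emeasure_subadditive_countably) auto
  also have "\<dots> \<le> (\<Sum>k. ennreal (\<eta> * (1/2) ^ Suc k))"
    by (intro suminf_le summableI less_imp_le[OF \<nu>])
  also have "\<dots> = ennreal \<eta>"
  proof (rule suminf_ennreal_eq)
    show "(\<lambda>k. \<eta> * (1/2) ^ Suc k) sums \<eta>"
      using sums_mult[OF power_half_series, of \<eta>] by simp
  qed (use \<eta> in simp)
  finally show thesis by (rule that)
qed

context weakly_differentiable
begin

definition dir_deriv :: "complex \<Rightarrow> complex \<Rightarrow> complex" where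
  "dir_deriv d z = Re d *\<^sub>R gx z + Im d *\<^sub>R gy z"

text \<open>The increments are tested for rational \<open>h\<close> only, which makes the sets Borel; by continuity of
  \<open>F\<close> the estimate then holds for all \<open>h\<close>.\<close>
definition quotient_close :: "complex \<Rightarrow> nat \<Rightarrow> nat \<Rightarrow> complex set" where
  "quotient_close d n k = {z. (\<forall>w\<in>-D. inverse (real (Suc n)) \<le> dist z w) \<and>
     (\<forall>h\<in>\<rat>. 0 < h \<and> h < inverse (real (Suc n)) \<longrightarrow>
        cmod (F (z + h *\<^sub>R d) - F z - h *\<^sub>R dir_deriv d z) \<le> inverse (real (Suc k)) * h)}"

lemma measurable_quotient_close [measurable]: "quotient_close d n k \<in> sets borel"
proof -
  have "{z. \<forall>w\<in>-D. inverse (real (Suc n)) \<le> dist z w} = (\<Inter>w\<in>-D. {z. inverse (real (Suc n)) \<le> dist z w})" by auto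
  also have "closed \<dots>"
    by (intro closed_INT ballI closed_Collect_le continuous_intros)
  finally have 1: "{z. \<forall>w\<in>-D. inverse (real (Suc n)) \<le> dist z w} \<in> sets borel" by (rule borel_closed)
  have "countable (\<rat> :: real set)" by (rule countable_rat)
  then have 2: "{z. \<forall>h\<in>\<rat>. 0 < h \<and> h < inverse (real (Suc n)) \<longrightarrow>
        cmod (F (z + h *\<^sub>R d) - F z - h *\<^sub>R dir_deriv d z) \<le> inverse (real (Suc k)) * h} \<in> sets borel"
    unfolding dir_deriv_def by measurable
  show ?thesis
    unfolding quotient_close_def Collect_conj_eq by (rule sets.Int[OF 1 2])
qed

lemma quotient_close_mono: assumes "n \<le> n'" shows "quotient_close d n k \<subseteq> quotient_close d n' k"
proof -
  have c: "inverse (real (Suc n')) \<le> inverse (real (Suc n))" by (intro le_imp_inverse_le) (use assms in simp_all)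
  then show ?thesis unfolding quotient_close_def 
    by (auto simp del: of_nat_Suc intro: order_trans[OF c] less_le_trans[OF _ c])
qed

lemma quotient_close_all:
  assumes z: "z \<in> quotient_close d n k" and d: "cmod d = 1" and h: "0 < h" "h < inverse (real (Suc n))"
  shows "cmod (F (z + h *\<^sub>R d) - F z - h *\<^sub>R dir_deriv d z) \<le> inverse (real (Suc k)) * h" "z + h *\<^sub>R d \<in> D" "z \<in> D"
proof -
  let ?c = "inverse (real (Suc n))"
  have inD: "z + r *\<^sub>R d \<in> D" if "0 \<le> r" "r < ?c" for r
  proof (rule ccontr)
    assume "z + r *\<^sub>R d \<notin> D"
    then have "?c \<le> dist z (z + r *\<^sub>R d)" using z by (simp add: quotient_close_def)
    then show False using that d by (simp add: dist_norm)
  qed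
  show "z + h *\<^sub>R d \<in> D" "z \<in> D" using inD[of h] inD[of 0] h by auto
  let ?b = "(h + ?c) / 2"
  have cl: "closure ({0<..<?b} \<inter> \<rat>) = {0..?b}"
    using closure_open_Int_superset[of "{0<..<?b}" "\<rat>"] Rats_closure_real h by auto
  let ?f = "\<lambda>r. cmod (F (z + r *\<^sub>R d) - F z - r *\<^sub>R dir_deriv d z) - inverse (real (Suc k)) * r"
  have "continuous_on {0..?b} (\<lambda>r. F (z + r *\<^sub>R d))"
    by (rule continuous_on_compose2[OF cont]) (use h inD in \<open>auto intro!: continuous_intros\<close>)
  then have "continuous_on {0..?b} ?f" by (intro continuous_intros)
  then have "?f h \<le> 0"
    unfolding cl[symmetric]
  proof (rule continuous_le_on_closure)
    show "h \<in> closure ({0<..<?b} \<inter> \<rat>)" unfolding cl using h by simp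
    fix r assume "r \<in> {0<..<?b} \<inter> \<rat>"
    then show "?f r \<le> 0" using z h by (simp add: quotient_close_def)
  qed
  then show "cmod (F (z + h *\<^sub>R d) - F z - h *\<^sub>R dir_deriv d z) \<le> inverse (real (Suc k)) * h" by simp
qed

text \<open>The linear isometry \<open>T\<close> maps vertical lines to lines in the direction \<open>d\<close>.  On almost every such line
  \<open>F\<close> is an indefinite integral inside \<open>D\<close>, and Lebesgue's theorem gives its one-sided derivative at
  almost every point of the line.\<close>
lemma AE_quotient_close:
  assumes d: "cmod d = 1"
  shows "AE z in lborel. z \<in> D \<longrightarrow> (\<forall>k. \<exists>n. z \<in> quotient_close d n k)"
proof -
  define T where "T w = Re w *\<^sub>R (\<i> * d) + Im w *\<^sub>R d" for w
  have T_lin: "bounded_linear T"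
    unfolding T_def[abs_def] by (intro bounded_linear_add bounded_linear_scaleR_const bounded_linear_Re bounded_linear_Im)
  have T_inv: "T w = d * (\<i> * cnj w)" for w
    by (simp add: T_def complex_eq_iff algebra_simps)
  have T_der: "(T has_derivative T) (at w within S)" for w S
    by (rule bounded_linear_imp_has_derivative[OF T_lin])
  have T_cont: "continuous_on S T" for S by (rule linear_continuous_on[OF T_lin])
  have [measurable]: "T \<in> borel_measurable borel" by (intro borel_measurable_continuous_onI T_cont)
  have d0: "d \<noteq> 0" using d by auto
  have inj: "inj_on T S" for S using d0 by (auto simp: inj_on_def T_inv)
  have "jac T = - ((Re d)\<^sup>2 + (Im d)\<^sup>2)"
    by (simp add: jac_def T_def power2_eq_square)
  then have jac: "\<bar>jac T\<bar> = 1" using d by (simp add: cmod_def)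
  define P where "P z \<longleftrightarrow> (\<forall>k. \<exists>n. z \<in> quotient_close d n k)" for z
  have [measurable]: "Measurable.pred borel P" unfolding P_def by measurable
  have box_good: "AE w in lborel. w \<in> cbox p q \<longrightarrow> P (T w)" if sub: "T ` cbox p q \<subseteq> D" for p q
  proof (rule AE_complex_iteratedI)
    show "AE s in lborel. AE t in lborel. Complex s t \<in> cbox p q \<longrightarrow> P (T (Complex s t))"
    proof (cases "Im p < Im q")
      case False
      then have "t \<noteq> Im q \<longrightarrow> Complex s t \<notin> cbox p q" for s t by (auto simp: in_cbox_complex_iff)
      then show ?thesis
        by (intro AE_I2 AE_mp[OF AE_lborel_singleton[of "Im q"]]) auto
    next
      case True
      have le: "(\<integral>\<^sup>+w\<in>cbox p q. h (T w) \<partial>lborel) \<le> ennreal 1 * (\<integral>\<^sup>+z. h z \<partial>lborel)"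
        if [measurable]: "h \<in> borel_measurable borel" for h
      proof -
        have "(\<integral>\<^sup>+w\<in>cbox p q. ennreal 1 * h (T w) \<partial>lborel) \<le> (\<integral>\<^sup>+z. h z \<partial>lborel)"
          by (rule area_inequality[where f'="\<lambda>_. T", OF _ _ T_der inj]) (simp_all add: jac)
        then show ?thesis by simp
      qed
      have vd: "((\<lambda>t. T (Complex s t)) has_vector_derivative d) (at t)" for s t
        unfolding T_def by (auto intro!: derivative_eq_intros)
      have ac: "AE s in lborel. s \<in> {Re p..Re q} \<longrightarrow> indefinite_integral_on (\<lambda>t. F (T (Complex s t)))
           (\<lambda>t. Re d *\<^sub>R gx (T (Complex s t)) + Im d *\<^sub>R gy (T (Complex s t))) (Im p) (Im q)"
        by (rule absolutely_continuous_on_almost_every_curve[where T'="\<lambda>_. d", OF T_cont continuous_on_const vd sub True le])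
           simp_all
      show ?thesis
      proof (rule AE_mp[OF ac], rule AE_I2, rule impI)
        fix s assume s: "s \<in> {Re p..Re q} \<longrightarrow> indefinite_integral_on (\<lambda>t. F (T (Complex s t)))
           (\<lambda>t. Re d *\<^sub>R gx (T (Complex s t)) + Im d *\<^sub>R gy (T (Complex s t))) (Im p) (Im q)"
        show "AE t in lborel. Complex s t \<in> cbox p q \<longrightarrow> P (T (Complex s t))"
        proof (cases "s \<in> {Re p..Re q}")
          case False
          then show ?thesis by (intro AE_I2) (auto simp: in_cbox_complex_iff)
        next
          case True
          have "AE t in lborel. t \<noteq> Im q" by (rule AE_lborel_singleton)
          with indefinite_integral_right_derivative[OF s[rule_format, OF True]] show ?thesis
          proof (rule AE_mp[OF AE_conjI], intro AE_I2 impI)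
            fix t assume h: "(t \<in> {Im p..<Im q} \<longrightarrow> (\<forall>e>0. \<exists>\<delta>>0. \<forall>h. 0 < h \<and> h < \<delta> \<longrightarrow>
               cmod (F (T (Complex s (t + h))) - F (T (Complex s t)) - h *\<^sub>R (Re d *\<^sub>R gx (T (Complex s t)) + Im d *\<^sub>R gy (T (Complex s t)))) \<le> e * h)) \<and> t \<noteq> Im q"
              and t: "Complex s t \<in> cbox p q"
            let ?z = "T (Complex s t)"
            have zD: "?z \<in> D" using sub t by auto
            obtain r where r: "r > 0" "ball ?z r \<subseteq> D" using zD open_D by (auto simp: open_contains_ball)
            have t': "t \<in> {Im p..<Im q}" using h t by (auto simp: in_cbox_complex_iff)
            show "P ?z"
              unfolding P_def
            proof
              fix k
              have k0: "0 < inverse (real (Suc k))" by simp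
              obtain \<delta> where \<delta>: "\<delta> > 0" "\<And>h. 0 < h \<Longrightarrow> h < \<delta> \<Longrightarrow>
                  cmod (F (T (Complex s (t + h))) - F ?z - h *\<^sub>R dir_deriv d ?z) \<le> inverse (real (Suc k)) * h"
                using h[THEN conjunct1, rule_format, OF t' k0] unfolding dir_deriv_def by blast
              obtain n where n: "inverse (real (Suc n)) < min r \<delta>"
                using reals_Archimedean[of "min r \<delta>"] r \<delta> by auto
              have "inverse (real (Suc n)) \<le> dist ?z w" if "w \<in> - D" for w
                using that r(2) n by (force simp: subset_iff)
              moreover have "T (Complex s (t + h)) = ?z + h *\<^sub>R d" for h
                by (simp add: T_def scaleR_add_left)
              ultimately have "?z \<in> quotient_close d n k"
                using \<delta>(2) n by (auto simp: quotient_close_def)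
              then show "\<exists>n. ?z \<in> quotient_close d n k" ..
            qed
          qed
        qed
      qed
    qed
  qed measurable
  have op: "open (T -` D)" by (rule open_vimage[OF open_D T_cont])
  obtain \<D> where \<D>: "countable \<D>" "\<D> \<subseteq> Pow (T -` D)" "\<And>X. X \<in> \<D> \<Longrightarrow> \<exists>a b. X = cbox a b" "\<Union>\<D> = T -` D"
    by (rule open_countable_Union_open_cbox[OF op]) blast
  have "AE w in lborel. \<forall>X\<in>\<D>. w \<in> X \<longrightarrow> P (T w)"
  proof (rule AE_ball_countable[OF \<D>(1), THEN iffD2], intro ballI)
    fix X assume X: "X \<in> \<D>"
    obtain p q where "X = cbox p q" using \<D>(3)[OF X] by blast
    then show "AE w in lborel. w \<in> X \<longrightarrow> P (T w)" using box_good[of p q] X \<D>(2) by auto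
  qed
  then have "AE w in lborel. w \<notin> {w. T w \<in> D \<and> \<not> P (T w)}"
  proof (rule AE_mp, intro AE_I2 impI)
    fix w assume *: "\<forall>X\<in>\<D>. w \<in> X \<longrightarrow> P (T w)"
    show "w \<notin> {w. T w \<in> D \<and> \<not> P (T w)}" using * \<D>(4) by auto
  qed
  then have "{w. T w \<in> D \<and> \<not> P (T w)} \<in> null_sets lborel"
    by (subst AE_iff_null_sets) measurable
  then have "negligible {w. T w \<in> D \<and> \<not> P (T w)}"
    by (simp add: negligible_iff_null_sets null_sets_completionI)
  then have "negligible (T ` {w. T w \<in> D \<and> \<not> P (T w)})"
    by (rule negligible_differentiable_image_negligible[OF order_refl])
       (use T_der in \<open>auto simp: differentiable_on_def differentiable_def\<close>)
  moreover have "T ` {w. T w \<in> D \<and> \<not> P (T w)} = {z. z \<in> D \<and> \<not> P z}"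
  proof -
    have "T (cnj (z / (d * \<i>))) = z" for z using d0 by (simp add: T_inv)
    then have "z \<in> T ` {w. T w \<in> D \<and> \<not> P (T w)}" if "z \<in> D \<and> \<not> P z" for z
      using that by (intro image_eqI[of _ _ "cnj (z / (d * \<i>))"]) simp_all
    then show ?thesis by auto
  qed
  ultimately have "{z. z \<in> D \<and> \<not> P z} \<in> null_sets lebesgue"
    by (simp add: negligible_iff_null_sets)
  then have "AE z in lebesgue. z \<notin> {z. z \<in> D \<and> \<not> P z}" by (rule AE_not_in)
  then have "AE z in lborel. z \<notin> {z. z \<in> D \<and> \<not> P z}" by (simp only: AE_completion_iff)
  then show ?thesis by (simp add: P_def)
qed

end

context weakly_differentiable
begin

text \<open>From \<open>z\<close> to a nearby \<open>w\<close> in \<open>E\<close> one goes first horizontally and then vertically.  The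
  horizontal increment is controlled by the difference quotients at \<open>z\<close>; the vertical one,
  traversed backwards, by those at \<open>w\<close>.  Only the two end points have to lie in \<open>E\<close>, not the
  corner.  It remains to compare \<open>gy w\<close> with \<open>gy z\<close>: on \<open>E\<close>, \<open>gy\<close> is a uniform limit of
  difference quotients with a fixed step, which are continuous.\<close>
lemma differentiable_within_quotient_close:
  assumes E: "\<And>z d k. \<lbrakk>z \<in> E; d \<in> {1, -1, \<i>, -\<i>}\<rbrakk> \<Longrightarrow> z \<in> quotient_close d (\<nu> k) k" and z: "z \<in> E"
  shows "(F has_derivative (\<lambda>v. dir_deriv v z)) (at z within E)"
  unfolding has_derivative_within_alt
proof (intro conjI allI impI)
  show "bounded_linear (\<lambda>v. dir_deriv v z)"
    unfolding dir_deriv_def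
    by (intro bounded_linear_add bounded_linear_scaleR_const bounded_linear_Re bounded_linear_Im)
  fix e :: real assume e: "0 < e"
  \<comment> \<open>the horizontal and the vertical error will be at most \<open>e/8\<close> times the distance each, and \<open>gy w - gy z\<close> at most \<open>4 * e/8\<close>; together less than \<open>e\<close>\<close>
  obtain k where k: "inverse (real (Suc k)) < e / 8" using reals_Archimedean[of "e/8"] e by auto
  define c where "c = inverse (real (Suc (\<nu> k)))"
  define \<kappa> where "\<kappa> = inverse (real (Suc k))"
  have c: "c > 0" by (simp add: c_def)
  have \<kappa>: "0 < \<kappa>" "\<kappa> < e / 8" using k by (simp_all add: \<kappa>_def)
  have q: "cmod (F (u + h *\<^sub>R d) - F u - h *\<^sub>R dir_deriv d u) \<le> \<kappa> * h"
    and qD: "u + h *\<^sub>R d \<in> D" "u \<in> D"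
    if "u \<in> E" "d \<in> {1, -1, \<i>, -\<i>}" "0 < h" "h < c" for u d h
    using quotient_close_all[OF E[OF that(1,2), of k], of h] that by (auto simp: c_def \<kappa>_def)
  have hor: "cmod (F (u + of_real a) - F u - a *\<^sub>R gx u) \<le> \<kappa> * \<bar>a\<bar>" if u: "u \<in> E" "\<bar>a\<bar> < c" for u a
  proof (cases "a = 0" rule: case_split)
    case False
    then consider "a > 0" | "a < 0" by linarith
    then show ?thesis
    proof cases
      case 1 then show ?thesis using q[of u 1 a] u by (simp add: dir_deriv_def scaleR_conv_of_real)
    next
      case 2 then show ?thesis using q[of u "-1" "-a"] u by (simp add: dir_deriv_def scaleR_conv_of_real)
    qed
  qed simp
  have ver: "cmod (F (u + \<i> * of_real b) - F u - b *\<^sub>R gy u) \<le> \<kappa> * \<bar>b\<bar>" if u: "u \<in> E" "\<bar>b\<bar> < c" for u b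
  proof (cases "b = 0" rule: case_split)
    case False
    then consider "b > 0" | "b < 0" by linarith
    then show ?thesis
    proof cases
      case 1 then show ?thesis using q[of u \<i> b] u by (simp add: dir_deriv_def scaleR_conv_of_real mult.commute)
    next
      case 2 then show ?thesis using q[of u "-\<i>" "-b"] u by (simp add: dir_deriv_def scaleR_conv_of_real mult.commute)
    qed
  qed simp
  define h0 where "h0 = c / 2"
  have h0: "0 < h0" "h0 < c" using c by (simp_all add: h0_def)
  have zD: "z + h0 *\<^sub>R \<i> \<in> D" "z \<in> D" using qD[of z \<i> h0] z h0 by auto
  have "isCont F z" "isCont F (z + h0 *\<^sub>R \<i>)"
    using cont open_D zD by (auto simp: continuous_on_eq_continuous_at)
  then obtain \<delta>1 \<delta>2 where \<delta>: "\<delta>1 > 0" "\<And>w. dist w z < \<delta>1 \<Longrightarrow> dist (F w) (F z) < h0 * (e/8)"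
     "\<delta>2 > 0" "\<And>w. dist w (z + h0 *\<^sub>R \<i>) < \<delta>2 \<Longrightarrow> dist (F w) (F (z + h0 *\<^sub>R \<i>)) < h0 * (e/8)"
    unfolding continuous_at_eps_delta using h0 e by (metis divide_pos_pos mult_pos_pos zero_less_numeral)
  define \<delta> where "\<delta> = min c (min \<delta>1 \<delta>2)"
  show "\<exists>d>0. \<forall>w\<in>E. cmod (w - z) < d \<longrightarrow> cmod (F w - F z - dir_deriv (w - z) z) \<le> e * cmod (w - z)"
  proof (intro exI[of _ \<delta>] conjI ballI impI)
    show "\<delta> > 0" using c \<delta> by (simp add: \<delta>_def)
    fix w assume w: "w \<in> E" "cmod (w - z) < \<delta>"
    define a b where "a = Re (w - z)" and "b = Im (w - z)"
    have ab: "\<bar>a\<bar> \<le> cmod (w - z)" "\<bar>b\<bar> \<le> cmod (w - z)" 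
      unfolding a_def b_def by (rule abs_Re_le_cmod abs_Im_le_cmod)+
    have abc: "\<bar>a\<bar> < c" "\<bar>- b\<bar> < c" using ab w(2) by (simp_all add: \<delta>_def)
    have corner: "w + \<i> * of_real (- b) = z + of_real a" by (simp add: a_def b_def complex_eq_iff)
    have gy: "cmod (gy w - gy z) \<le> e / 2"
    proof -
      let ?w = "w + h0 *\<^sub>R \<i>" and ?z = "z + h0 *\<^sub>R \<i>"
      have 1: "cmod (F ?w - F w - h0 *\<^sub>R gy w) \<le> \<kappa> * h0" "cmod (F ?z - F z - h0 *\<^sub>R gy z) \<le> \<kappa> * h0"
        using q[of w \<i> h0] q[of z \<i> h0] w z h0 by (auto simp: dir_deriv_def)
      have 2: "cmod (F w - F z) \<le> h0 * (e/8)" "cmod (F ?w - F ?z) \<le> h0 * (e/8)"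
        using \<delta>(2)[of w] \<delta>(4)[of ?w] w by (auto simp: \<delta>_def dist_norm)
      have "h0 *\<^sub>R (gy w - gy z) = (F ?z - F z - h0 *\<^sub>R gy z) - (F ?w - F w - h0 *\<^sub>R gy w) + ((F ?w - F ?z) - (F w - F z))"
        by (simp add: scaleR_diff_right)
      then have "cmod (h0 *\<^sub>R (gy w - gy z)) \<le> \<kappa> * h0 + \<kappa> * h0 + (h0 * (e/8) + h0 * (e/8))"
        using 1 2 by (smt (verit) norm_triangle_ineq norm_triangle_ineq4)
      moreover have "cmod (h0 *\<^sub>R (gy w - gy z)) = h0 * cmod (gy w - gy z)"
        using h0 by simp
      ultimately have "h0 * cmod (gy w - gy z) \<le> h0 * (2 * \<kappa> + e / 4)"
        by (simp add: algebra_simps)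
      then show ?thesis using h0 \<kappa> by simp
    qed
    have "F w - F z - dir_deriv (w - z) z = (F (z + of_real a) - F z - a *\<^sub>R gx z)
        - (F (w + \<i> * of_real (- b)) - F w - (- b) *\<^sub>R gy w) + b *\<^sub>R (gy w - gy z)"
      unfolding corner by (simp add: dir_deriv_def a_def b_def algebra_simps)
    also have "cmod \<dots> \<le> \<kappa> * \<bar>a\<bar> + \<kappa> * \<bar>- b\<bar> + \<bar>b\<bar> * (e/2)"
    proof -
      have "cmod (b *\<^sub>R (gy w - gy z)) \<le> \<bar>b\<bar> * (e/2)"
        using mult_left_mono[OF gy abs_ge_zero[of b]] by simp
      with hor[OF z abc(1)] ver[OF w(1) abc(2)] show ?thesis
        by (smt (verit) norm_triangle_ineq norm_triangle_ineq4)
    qed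
    also have "\<dots> \<le> e * cmod (w - z)"
    proof -
      have "\<kappa> * \<bar>a\<bar> \<le> (e/8) * cmod (w - z)" "\<kappa> * \<bar>- b\<bar> \<le> (e/8) * cmod (w - z)" "\<bar>b\<bar> * (e/2) \<le> cmod (w - z) * (e/2)"
        by (rule mult_mono; use \<kappa> ab e in simp)+
      moreover have "0 \<le> e * cmod (w - z)" using e by simp
      ultimately show ?thesis by (simp add: algebra_simps)
    qed
    finally show "cmod (F w - F z - dir_deriv (w - z) z) \<le> e * cmod (w - z)" .
  qed
qed

definition jacobian :: "complex \<Rightarrow> real" where
  "jacobian z = \<bar>Re (gx z) * Im (gy z) - Im (gx z) * Re (gy z)\<bar>"

lemma measurable_jacobian [measurable]: "jacobian \<in> borel_measurable borel"
  unfolding jacobian_def[abs_def] by measurable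

text \<open>Egorov's theorem, applied in the four axis directions and in growing discs, gives sets on which \<open>F\<close>
  is differentiable in the relative sense and which exhaust \<open>D\<close> up to a null set.  The area
  inequality holds on each piece of a disjoint refinement, and the images of the pieces are disjoint
  because \<open>F\<close> is injective.\<close>
theorem area_inequality_homeomorphism:
  assumes inj: "inj_on F D" and [measurable]: "h \<in> borel_measurable borel"
  shows "(\<integral>\<^sup>+z\<in>D. ennreal (jacobian z) * h (F z) \<partial>lborel) \<le> (\<integral>\<^sup>+z. h z \<partial>lborel)"
proof -
  define V where "V n k = (\<Inter>d\<in>{1, -1, \<i>, -\<i>}. quotient_close d n k)" for n k
  have [measurable]: "V n k \<in> sets borel" for n k unfolding V_def by (intro sets.finite_INT) auto
  have ae: "AE z in lborel. z \<in> D \<longrightarrow> (\<forall>k. \<exists>n. z \<in> V n k)"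
  proof -
    have "AE z in lborel. \<forall>d\<in>{1, -1, \<i>, -\<i>}. z \<in> D \<longrightarrow> (\<forall>k. \<exists>n. z \<in> quotient_close d n k)"
      by (rule AE_finite_allI) (auto intro: AE_quotient_close)
    then show ?thesis
    proof (rule AE_mp, intro AE_I2 impI allI)
      fix z k assume *: "\<forall>d\<in>{1, -1, \<i>, -\<i>}. z \<in> D \<longrightarrow> (\<forall>k. \<exists>n. z \<in> quotient_close d n k)" "z \<in> D"
      then have "\<forall>d\<in>{1, -1, \<i>, -\<i>}. \<exists>n. z \<in> quotient_close d n k" by blast
      then obtain m where m: "\<And>d. d \<in> {1, -1, \<i>, -\<i>} \<Longrightarrow> z \<in> quotient_close d (m d) k" by metis
      have "z \<in> quotient_close d (Max (m ` {1, -1, \<i>, -\<i>})) k" if "d \<in> {1, -1, \<i>, -\<i>}" for d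
      proof (rule subsetD[OF quotient_close_mono m[OF that]])
        show "m d \<le> Max (m ` {1, -1, \<i>, -\<i>})" using that by (intro Max_ge finite_imageI imageI) auto
      qed
      then show "\<exists>n. z \<in> V n k" unfolding V_def by blast
    qed
  qed
  have inc: "incseq (\<lambda>n. V n k)" for k
  proof (rule monoI)
    fix m n :: nat assume mn: "m \<le> n"
    show "V m k \<subseteq> V n k"
      unfolding V_def by (rule INT_anti_mono[OF subset_refl quotient_close_mono[OF mn]])
  qed
  have "\<exists>\<nu>. emeasure lborel ((D \<inter> ball 0 (real m)) - (\<Inter>k. V (\<nu> k) k)) \<le> ennreal (inverse (real (Suc j)))" for m j
  proof (rule Egorov_sets[of V lborel "D \<inter> ball 0 (real m)" "inverse (real (Suc j))"])
    show "incseq (\<lambda>n. V n k)" for k by (rule inc)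
    show "emeasure lborel (D \<inter> ball 0 (real m)) < \<infinity>"
      by (rule emeasure_bounded_finite) (auto intro: bounded_subset[OF bounded_ball])
    show "AE z in lborel. z \<in> D \<inter> ball 0 (real m) \<longrightarrow> (\<exists>n. z \<in> V n k)" for k
      by (rule AE_mp[OF ae], intro AE_I2) auto
    show "V n k \<in> sets lborel" for n k by simp
    show "D \<inter> ball 0 (real m) \<in> sets lborel" by simp
    show "0 < inverse (real (Suc j))" by simp
    fix \<nu> assume "emeasure lborel ((D \<inter> ball 0 (real m)) - (\<Inter>k. V (\<nu> k) k)) \<le> ennreal (inverse (real (Suc j)))"
    then show "\<exists>\<nu>. emeasure lborel ((D \<inter> ball 0 (real m)) - (\<Inter>k. V (\<nu> k) k)) \<le> ennreal (inverse (real (Suc j)))"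
      by (rule exI[where x=\<nu>])
  qed
  then obtain \<nu> where \<nu>: "\<And>m j. emeasure lborel ((D \<inter> ball 0 (real m)) - (\<Inter>k. V (\<nu> m j k) k)) \<le> ennreal (inverse (real (Suc j)))"
    by metis
  define E where "E m j = (D \<inter> ball 0 (real m)) \<inter> (\<Inter>k. V (\<nu> m j k) k)" for m j
  have E_meas [measurable]: "E m j \<in> sets borel" for m j unfolding E_def by measurable
  define A where "A = disjointed (\<lambda>i. case prod_decode i of (m, j) \<Rightarrow> E m j)"
  have A_sub: "\<exists>m j. A i \<subseteq> E m j" for i
    using disjointed_subset[of "\<lambda>i. case prod_decode i of (m, j) \<Rightarrow> E m j" i] unfolding A_def
    by (cases "prod_decode i") auto
  have A_meas [measurable]: "A i \<in> sets borel" for i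
  proof -
    have "(case prod_decode i of (m, j) \<Rightarrow> E m j) \<in> sets borel" for i
      using E_meas by (cases "prod_decode i") simp
    then show ?thesis
      unfolding A_def disjointed_def by (intro sets.Diff sets.countable_UN'') auto
  qed
  have A_dis: "disjoint_family A" unfolding A_def by (rule disjoint_family_disjointed)
  have A_un: "(\<Union>i. A i) = (\<Union>m j. E m j)"
  proof -
    have "z \<in> (\<Union>i. case prod_decode i of (m, j) \<Rightarrow> E m j)" if "z \<in> E m j" for z m j
      using that by (intro UN_I[of "prod_encode (m, j)"]) simp_all
    then show ?thesis unfolding A_def UN_disjointed_eq by (fastforce split: prod.splits)
  qed
  have A_D: "A i \<subseteq> D" for i using A_sub[of i] by (auto simp: E_def)
  have null: "(D - (\<Union>m j. E m j)) \<in> null_sets lborel"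
  proof -
    have "(D \<inter> ball 0 (real m)) - (\<Union>j. E m j) \<in> null_sets lborel" for m
    proof -
      have "emeasure lborel ((D \<inter> ball 0 (real m)) - (\<Union>j. E m j)) \<le> 0"
      proof (rule ennreal_le_epsilon)
        fix e :: real assume "0 < e"
        then obtain j where j: "inverse (real (Suc j)) < e" using reals_Archimedean by blast
        have "emeasure lborel ((D \<inter> ball 0 (real m)) - (\<Union>j. E m j)) \<le> emeasure lborel ((D \<inter> ball 0 (real m)) - (\<Inter>k. V (\<nu> m j k) k))"
          by (intro emeasure_mono) (auto simp: E_def)
        also have "\<dots> \<le> ennreal (inverse (real (Suc j)))" by (rule \<nu>)
        also have "\<dots> \<le> 0 + ennreal e" using j by (simp add: ennreal_leI del: of_nat_Suc)
        finally show "emeasure lborel ((D \<inter> ball 0 (real m)) - (\<Union>j. E m j)) \<le> 0 + ennreal e" .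
      qed
      then show ?thesis by (intro null_setsI) auto
    qed
    then have "(\<Union>m. (D \<inter> ball 0 (real m)) - (\<Union>j. E m j)) \<in> null_sets lborel" by (rule null_sets_UN)
    moreover have "D - (\<Union>m j. E m j) \<subseteq> (\<Union>m. (D \<inter> ball 0 (real m)) - (\<Union>j. E m j))"
    proof
      fix z assume z: "z \<in> D - (\<Union>m j. E m j)"
      obtain m where "cmod z < real m" using reals_Archimedean2 by blast
      then show "z \<in> (\<Union>m. (D \<inter> ball 0 (real m)) - (\<Union>j. E m j))" using z by (intro UN_I[of m]) auto
    qed
    moreover have "D - (\<Union>m j. E m j) \<in> sets lborel" by measurable
    ultimately show ?thesis using null_sets_subset by blast
  qed
  \<comment> \<open>by invariance of domain the inverse of \<open>F\<close> is a Borel function on an open set, so images of Borel sets are preimages\<close>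
  have FA [measurable]: "F ` A i \<in> sets borel" for i
  proof -
    have op: "open (F ` D)" by (rule invariance_of_domain[OF cont open_D inj])
    obtain g where g: "homeomorphism D (F ` D) F g"
      using invariance_of_domain_homeomorphism[OF open_D cont _ inj] by auto
    define g' where "g' = (\<lambda>w. if w \<in> F ` D then g w else 0)"
    have "g' \<in> borel_measurable borel"
      unfolding g'_def
      by (rule borel_measurable_continuous_on_if) (use op g in \<open>auto simp: homeomorphism_def\<close>)
    then have "g' -` A i \<inter> space borel \<in> sets borel" by (rule measurable_sets) simp
    moreover have "F ` A i = (g' -` A i) \<inter> F ` D"
      using A_D[of i] g by (force simp: g'_def homeomorphism_def)
    ultimately show ?thesis using op by simp
  qed
  have piece: "(\<integral>\<^sup>+z\<in>A i. ennreal (jacobian z) * h (F z) \<partial>lborel) \<le> emeasure (density lborel h) (F ` A i)" for i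
  proof -
    obtain m j where mj: "A i \<subseteq> E m j" using A_sub by blast
    have "(\<integral>\<^sup>+z\<in>A i. ennreal (jacobian z) * h (F z) \<partial>lborel)
       = (\<integral>\<^sup>+z\<in>A i. ennreal (jacobian z) * (h (F z) * indicator (F ` A i) (F z)) \<partial>lborel)"
      by (intro nn_integral_cong) (auto simp: indicator_def)
    also have "\<dots> \<le> (\<integral>\<^sup>+z. h z * indicator (F ` A i) z \<partial>lborel)"
    proof (rule area_inequality[where f=F and f'="\<lambda>z v. dir_deriv v z" and S="A i"])
      show "(F has_derivative (\<lambda>v. dir_deriv v z)) (at z within A i)" if "z \<in> A i" for z
      proof (rule differentiable_within_quotient_close[where \<nu>="\<nu> m j"])
        show "\<And>z d k. \<lbrakk>z \<in> A i; d \<in> {1, -1, \<i>, -\<i>}\<rbrakk> \<Longrightarrow> z \<in> quotient_close d (\<nu> m j k) k"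
          using mj unfolding E_def V_def by blast
      qed fact
      show "inj_on F (A i)" using inj A_D by (rule inj_on_subset)
      show "jacobian z = \<bar>jac (\<lambda>v. dir_deriv v z)\<bar>" for z by (simp add: jacobian_def jac_def dir_deriv_def)
    qed measurable
    also have "\<dots> = emeasure (density lborel h) (F ` A i)" by (simp add: emeasure_density)
    finally show ?thesis .
  qed
  have "AE z in lborel. z \<notin> D - (\<Union>m j. E m j)" using null by (rule AE_not_in)
  then have "(\<integral>\<^sup>+z\<in>D. ennreal (jacobian z) * h (F z) \<partial>lborel) \<le> (\<integral>\<^sup>+z. (\<Sum>i. ennreal (jacobian z) * h (F z) * indicator (A i) z) \<partial>lborel)"
  proof (intro nn_integral_mono_AE, elim AE_mp, intro AE_I2 impI)
    fix z assume z: "z \<notin> D - (\<Union>m j. E m j)"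
    show "ennreal (jacobian z) * h (F z) * indicator D z \<le> (\<Sum>i. ennreal (jacobian z) * h (F z) * indicator (A i) z)"
    proof (cases "z \<in> D")
      case True
      then have "z \<in> (\<Union>i. A i)" unfolding A_un using z by simp
      then obtain i where i: "z \<in> A i" by (rule UN_E)
      have "u i \<le> (\<Sum>i. u i)" for u :: "nat \<Rightarrow> ennreal"
        using sum_le_suminf[OF summableI, of "{i}" u] by simp
      from this[of "\<lambda>i. ennreal (jacobian z) * h (F z) * indicator (A i) z"]
      show ?thesis using i True by (simp only: indicator_simps)
    qed simp
  qed
  also have "\<dots> = (\<Sum>i. \<integral>\<^sup>+z\<in>A i. ennreal (jacobian z) * h (F z) \<partial>lborel)"
    by (rule nn_integral_suminf) measurable
  also have "\<dots> \<le> (\<Sum>i. emeasure (density lborel h) (F ` A i))"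
    by (intro suminf_le summableI piece)
  also have "\<dots> = emeasure (density lborel h) (\<Union>i. F ` A i)"
  proof (rule suminf_emeasure)
    show "disjoint_family (\<lambda>i. F ` A i)"
      unfolding disjoint_family_on_def
    proof (intro ballI impI)
      fix i j :: nat assume "i \<noteq> j"
      then have "A i \<inter> A j = {}" using A_dis by (auto simp: disjoint_family_on_def)
      then show "F ` A i \<inter> F ` A j = {}"
        using inj_on_image_Int[OF inj A_D A_D, of i j] by simp
    qed
  qed auto
  also have "\<dots> \<le> emeasure (density lborel h) UNIV" by (rule emeasure_mono) auto
  also have "\<dots> = (\<integral>\<^sup>+z. h z \<partial>lborel)" by (simp add: emeasure_density)
  finally show ?thesis .
qed

end

section \<open>Absolute continuity on almost every circle\<close>

lemma indefinite_integral_on_subinterval: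
  assumes "indefinite_integral_on q q' a b" "a \<le> c" "d \<le> b"
  shows "indefinite_integral_on q q' c d"
  using assms set_integrable_subset[of lborel "{a..b}" q' "{c..d}"] unfolding indefinite_integral_on_def by auto

lemma indefinite_integral_on_combine:
  assumes ab: "indefinite_integral_on q q' a b" and bc: "indefinite_integral_on q q' b c" and le: "a \<le> b" "b \<le> c"
  shows "indefinite_integral_on q q' a c"
proof -
  have "set_integrable lborel ({a..b} \<union> {b..c}) q'"
    by (rule set_integrable_Un) (use ab bc in \<open>auto simp: indefinite_integral_on_def\<close>)
  also have "{a..b} \<union> {b..c} = {a..c}" using le by auto
  finally have int: "set_integrable lborel {a..c} q'" .
  have L: "(LINT t:{u..v}|lborel. q' t) = integral {u..v} q'" "q' integrable_on {u..v}" if "a \<le> u" "v \<le> c" for u v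
    using set_borel_integral_eq_integral[OF set_integrable_subset[OF int, of "{u..v}"]] that by auto
  have "q v - q u = (LINT t:{u..v}|lborel. q' t)" if uv: "a \<le> u" "u \<le> v" "v \<le> c" for u v
  proof -
    consider "v \<le> b" | "b \<le> u" | "u \<le> b" "b \<le> v" by linarith
    then show ?thesis
    proof cases
      case 3
      have "q v - q b = integral {b..v} q'" "q b - q u = integral {u..b} q'"
        using ab bc 3 uv le by (auto simp: indefinite_integral_on_def L)
      moreover have "integral {u..b} q' + integral {b..v} q' = integral {u..v} q'"
        by (rule Henstock_Kurzweil_Integration.integral_combine) (use 3 L uv in auto)
      ultimately show ?thesis using uv by (simp add: L algebra_simps)
    qed (use ab bc uv in \<open>auto simp: indefinite_integral_on_def\<close>)
  qed
  with int show ?thesis by (simp add: indefinite_integral_on_def)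
qed

text \<open>Polar coordinates about \<open>z0\<close>, with the radius as real part and the angle as imaginary part.  The
  orientation \<open>\<sigma>\<close> is \<open>1\<close> or \<open>-1\<close>, so that clockwise paths are described by increasing
  angles too.\<close>
definition polar :: "complex \<Rightarrow> real \<Rightarrow> complex \<Rightarrow> complex" where
  "polar z0 \<sigma> w = z0 + of_real (Re w) * cis (\<sigma> * Im w)"

definition polar_deriv :: "real \<Rightarrow> complex \<Rightarrow> complex" where
  "polar_deriv \<sigma> w = of_real (\<sigma> * Re w) * (\<i> * cis (\<sigma> * Im w))"

lemma continuous_on_polar: "continuous_on S (polar z0 \<sigma>)" "continuous_on S (polar_deriv \<sigma>)"
  unfolding polar_def[abs_def] polar_deriv_def[abs_def] by (intro continuous_intros)+

lemma has_derivative_polar: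
  "(polar z0 \<sigma> has_derivative (\<lambda>v. of_real (Re v) * cis (\<sigma> * Im w) + of_real (Im v) * polar_deriv \<sigma> w)) (at w within S)"
proof -
  have "((\<lambda>w. cis (\<sigma> * Im w)) has_derivative (\<lambda>v. (\<sigma> * Im v) *\<^sub>R (\<i> * cis (\<sigma> * Im w)))) (at w within S)"
    by (rule has_derivative_cis) (auto intro!: derivative_eq_intros)
  then have "((\<lambda>w. z0 + of_real (Re w) * cis (\<sigma> * Im w)) has_derivative
     (\<lambda>v. 0 + (of_real (Re w) * ((\<sigma> * Im v) *\<^sub>R (\<i> * cis (\<sigma> * Im w))) + of_real (Re v) * cis (\<sigma> * Im w)))) (at w within S)"
    by (intro has_derivative_add has_derivative_const has_derivative_mult) (auto intro!: derivative_eq_intros)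
  then show ?thesis
    unfolding polar_def[abs_def] by (rule has_derivative_eq_rhs) (auto simp: polar_deriv_def algebra_simps scaleR_conv_of_real)
qed

lemma has_vector_derivative_polar:
  "((\<lambda>t. polar z0 \<sigma> (Complex s t)) has_vector_derivative polar_deriv \<sigma> (Complex s t)) (at t)"
proof -
  have "((\<lambda>t. cis (\<sigma> * t)) has_derivative (\<lambda>x. (\<sigma> * x) *\<^sub>R (\<i> * cis (\<sigma> * t)))) (at t)"
    by (rule has_derivative_cis) (auto intro!: derivative_eq_intros)
  then have "((\<lambda>t. z0 + of_real s * cis (\<sigma> * t)) has_derivative (\<lambda>x. 0 + of_real s * ((\<sigma> * x) *\<^sub>R (\<i> * cis (\<sigma> * t))))) (at t)"
    by (intro has_derivative_add has_derivative_const has_derivative_mult_right)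
  then show ?thesis
    unfolding has_vector_derivative_def polar_def polar_deriv_def complex.sel
    by (rule has_derivative_eq_rhs) (simp add: fun_eq_iff scaleR_conv_of_real)
qed

lemma inj_on_polar:
  assumes \<sigma>: "\<bar>\<sigma>\<bar> = 1" and p: "0 < Re p" "Im q - Im p < 2 * pi"
  shows "inj_on (polar z0 \<sigma>) (cbox p q)"
proof (rule inj_onI)
  fix v w assume vw: "v \<in> cbox p q" "w \<in> cbox p q" "polar z0 \<sigma> v = polar z0 \<sigma> w"
  have pos: "Re v > 0" "Re w > 0" using vw p by (auto simp: in_cbox_complex_iff)
  have eq: "of_real (Re v) * cis (\<sigma> * Im v) = of_real (Re w) * cis (\<sigma> * Im w)"
    using vw by (simp add: polar_def)
  then have "cmod (of_real (Re v) * cis (\<sigma> * Im v)) = cmod (of_real (Re w) * cis (\<sigma> * Im w))" by simp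
  then have re: "Re v = Re w" using pos by (simp add: norm_mult)
  then have "cis (\<sigma> * Im v) = cis (\<sigma> * Im w)" using eq pos by simp
  then have "cis (\<sigma> * Im v - \<sigma> * Im w) = 1" by (simp add: cis_divide[symmetric])
  then have "cos (\<sigma> * Im v - \<sigma> * Im w) = 1" by (simp add: complex_eq_iff)
  then obtain n :: int where n: "\<sigma> * Im v - \<sigma> * Im w = of_int n * 2 * pi" by (auto simp: cos_one_2pi_int)
  have "\<bar>\<sigma> * Im v - \<sigma> * Im w\<bar> = \<bar>Im v - Im w\<bar>"
    using \<sigma> by (simp flip: right_diff_distrib add: abs_mult)
  also have "\<dots> < 2 * pi" using vw p by (auto simp: in_cbox_complex_iff)
  finally have "\<bar>of_int n\<bar> * (2 * pi) < 1 * (2 * pi)" unfolding n by (simp add: abs_mult)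
  then have "\<bar>of_int n\<bar> < (1::real)" by (simp only: mult_less_cancel_right) auto
  then have "n = 0" by linarith
  then have "Im v = Im w" using n \<sigma> by auto
  with re show "v = w" by (simp add: complex_eq_iff)
qed

lemma jac_polar:
  assumes \<sigma>: "\<bar>\<sigma>\<bar> = 1"
  shows "\<bar>jac (\<lambda>v. of_real (Re v) * cis (\<sigma> * Im w) + of_real (Im v) * polar_deriv \<sigma> w)\<bar> = \<bar>Re w\<bar>"
proof -
  have "jac (\<lambda>v. of_real (Re v) * u + of_real (Im v) * (of_real m * (\<i> * u))) = m * (cmod u)\<^sup>2" for u m
    unfolding cmod_power2 by (simp add: jac_def power2_eq_square algebra_simps)
  from this[of "cis (\<sigma> * Im w)" "\<sigma> * Re w"] show ?thesis
    using \<sigma> by (simp add: polar_deriv_def abs_mult)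
qed

context weakly_differentiable
begin

text \<open>The Jacobian of polar coordinates is the radius, which is at least \<open>Re p\<close> on the box; so area is
  compressed at most by the factor \<open>inverse (Re p)\<close>.\<close>
lemma absolutely_continuous_on_polar_box:
  assumes \<sigma>: "\<bar>\<sigma>\<bar> = 1" and p: "0 < Re p" "Im q - Im p < 2 * pi" "Im p < Im q" and sub: "polar z0 \<sigma> ` cbox p q \<subseteq> D"
  shows "AE s in lborel. s \<in> {Re p..Re q} \<longrightarrow> indefinite_integral_on (\<lambda>t. F (polar z0 \<sigma> (Complex s t)))
     (\<lambda>t. dir_deriv (polar_deriv \<sigma> (Complex s t)) (polar z0 \<sigma> (Complex s t))) (Im p) (Im q)"
  unfolding dir_deriv_def
proof (rule absolutely_continuous_on_almost_every_curve[OF continuous_on_polar has_vector_derivative_polar sub p(3)])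
  show "0 \<le> inverse (Re p)" using p by simp
  fix h :: "complex \<Rightarrow> ennreal" assume [measurable]: "h \<in> borel_measurable borel"
  have [measurable]: "polar z0 \<sigma> \<in> borel_measurable borel"
    by (intro borel_measurable_continuous_onI continuous_on_polar)
  have "(\<integral>\<^sup>+w\<in>cbox p q. h (polar z0 \<sigma> w) \<partial>lborel)
      \<le> (\<integral>\<^sup>+w. ennreal (inverse (Re p)) * (ennreal \<bar>Re w\<bar> * h (polar z0 \<sigma> w) * indicator (cbox p q) w) \<partial>lborel)"
  proof (intro nn_integral_mono)
    fix w
    show "h (polar z0 \<sigma> w) * indicator (cbox p q) w
        \<le> ennreal (inverse (Re p)) * (ennreal \<bar>Re w\<bar> * h (polar z0 \<sigma> w) * indicator (cbox p q) w)"
    proof (cases "w \<in> cbox p q")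
      case True
      then have "1 \<le> inverse (Re p) * \<bar>Re w\<bar>" using p by (simp add: in_cbox_complex_iff field_simps)
      then have "1 * h (polar z0 \<sigma> w) \<le> ennreal (inverse (Re p) * \<bar>Re w\<bar>) * h (polar z0 \<sigma> w)"
        by (intro mult_right_mono) (auto simp: ennreal_1[symmetric] intro!: ennreal_leI simp del: ennreal_1)
      then show ?thesis using True p by (simp add: ennreal_mult mult.assoc)
    qed simp
  qed
  also have "\<dots> = ennreal (inverse (Re p)) * (\<integral>\<^sup>+w\<in>cbox p q. ennreal \<bar>Re w\<bar> * h (polar z0 \<sigma> w) \<partial>lborel)"
    by (rule nn_integral_cmult) measurable
  also have "\<dots> \<le> ennreal (inverse (Re p)) * (\<integral>\<^sup>+z. h z \<partial>lborel)"
  proof (rule mult_left_mono)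
    show "(\<integral>\<^sup>+w\<in>cbox p q. ennreal \<bar>Re w\<bar> * h (polar z0 \<sigma> w) \<partial>lborel) \<le> (\<integral>\<^sup>+z. h z \<partial>lborel)"
      by (rule area_inequality[OF _ _ has_derivative_polar inj_on_polar[OF \<sigma> p(1,2)]]) (simp_all add: jac_polar[OF \<sigma>])
  qed simp
  finally show "(\<integral>\<^sup>+w\<in>cbox p q. h (polar z0 \<sigma> w) \<partial>lborel) \<le> ennreal (inverse (Re p)) * (\<integral>\<^sup>+z. h z \<partial>lborel)" .
qed

text \<open>Countably many polar boxes with rational corners suffice: an arc in \<open>D\<close> is covered by
  finitely many of them, and absolute continuity is additive over adjacent arcs.\<close>
theorem absolutely_continuous_on_almost_every_circle:
  assumes \<sigma>: "\<bar>\<sigma>\<bar> = 1"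
  shows "AE r in lborel. r > 0 \<longrightarrow> (\<forall>a b. a \<le> b \<longrightarrow> (\<forall>t\<in>{a..b}. polar z0 \<sigma> (Complex r t) \<in> D) \<longrightarrow>
    indefinite_integral_on (\<lambda>t. F (polar z0 \<sigma> (Complex r t)))
     (\<lambda>t. dir_deriv (polar_deriv \<sigma> (Complex r t)) (polar z0 \<sigma> (Complex r t))) a b)"
proof -
  define \<C> where "\<C> = {(s1, s2, t1, t2). s1 \<in> \<rat> \<and> s2 \<in> \<rat> \<and> t1 \<in> \<rat> \<and> t2 \<in> \<rat> \<and> 0 < s1 \<and> t1 < t2 \<and> t2 - t1 < 2 * pi \<and>
     polar z0 \<sigma> ` cbox (Complex s1 t1) (Complex s2 t2) \<subseteq> D}"
  let ?I = "\<lambda>r. indefinite_integral_on (\<lambda>t. F (polar z0 \<sigma> (Complex r t)))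
     (\<lambda>t. dir_deriv (polar_deriv \<sigma> (Complex r t)) (polar z0 \<sigma> (Complex r t)))"
  have "\<C> \<subseteq> \<rat> \<times> \<rat> \<times> \<rat> \<times> \<rat>" by (auto simp: \<C>_def)
  then have count: "countable \<C>" by (rule countable_subset) (intro countable_SIGMA countable_rat)
  have "AE r in lborel. \<forall>x\<in>\<C>. case x of (s1, s2, t1, t2) \<Rightarrow> r \<in> {s1..s2} \<longrightarrow> ?I r t1 t2"
  proof (rule AE_ball_countable[OF count, THEN iffD2], intro ballI)
    fix x assume "x \<in> \<C>"
    then obtain s1 s2 t1 t2 where x: "x = (s1, s2, t1, t2)" "0 < s1" "t1 < t2" "t2 - t1 < 2 * pi"
      "polar z0 \<sigma> ` cbox (Complex s1 t1) (Complex s2 t2) \<subseteq> D" by (auto simp: \<C>_def)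
    show "AE r in lborel. case x of (s1, s2, t1, t2) \<Rightarrow> r \<in> {s1..s2} \<longrightarrow> ?I r t1 t2"
      using absolutely_continuous_on_polar_box[OF \<sigma>, of "Complex s1 t1" "Complex s2 t2" z0] x by simp
  qed
  then show ?thesis
  proof (rule AE_mp, intro AE_I2 impI allI)
    fix r a b :: real
    assume good: "\<forall>x\<in>\<C>. case x of (s1, s2, t1, t2) \<Rightarrow> r \<in> {s1..s2} \<longrightarrow> ?I r t1 t2"
      and r: "r > 0" and ab: "a \<le> b" and arc: "\<forall>t\<in>{a..b}. polar z0 \<sigma> (Complex r t) \<in> D"
    have "open (polar z0 \<sigma> -` D)" by (rule open_vimage[OF open_D continuous_on_polar(1)])
    show "?I r a b"
      using ab
    proof (induction rule: Bolzano)
      case (trans u v w)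
      then show ?case by (intro indefinite_integral_on_combine[of _ _ u v w])
    next
      case (local t)
      then have "Complex r t \<in> polar z0 \<sigma> -` D" using arc by simp
      then obtain \<delta> where \<delta>: "\<delta> > 0" "ball (Complex r t) \<delta> \<subseteq> polar z0 \<sigma> -` D"
        using \<open>open (polar z0 \<sigma> -` D)\<close> openE by blast
      define \<eta> where "\<eta> = min (\<delta> / 2) (min r pi)"
      have \<eta>: "0 < \<eta>" "\<eta> \<le> \<delta> / 2" "\<eta> \<le> r" "\<eta> \<le> pi" using \<delta> r by (auto simp: \<eta>_def)
      obtain s1 where s1: "s1 \<in> \<rat>" "r - \<eta> < s1" "s1 < r" using Rats_dense_in_real[of "r - \<eta>" r] \<eta> by auto
      obtain s2 where s2: "s2 \<in> \<rat>" "r < s2" "s2 < r + \<eta>" using Rats_dense_in_real[of r "r + \<eta>"] \<eta> by auto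
      obtain t1 where t1: "t1 \<in> \<rat>" "t - \<eta> < t1" "t1 < t" using Rats_dense_in_real[of "t - \<eta>" t] \<eta> by auto
      obtain t2 where t2: "t2 \<in> \<rat>" "t < t2" "t2 < t + \<eta>" using Rats_dense_in_real[of t "t + \<eta>"] \<eta> by auto
      have "cbox (Complex s1 t1) (Complex s2 t2) \<subseteq> ball (Complex r t) \<delta>"
      proof
        fix w assume "w \<in> cbox (Complex s1 t1) (Complex s2 t2)"
        then have "\<bar>Re (Complex r t - w)\<bar> < \<eta>" "\<bar>Im (Complex r t - w)\<bar> < \<eta>"
          using s1 s2 t1 t2 by (auto simp: in_cbox_complex_iff)
        then have "cmod (Complex r t - w) < \<delta>" using cmod_le[of "Complex r t - w"] \<eta> by linarith
        then show "w \<in> ball (Complex r t) \<delta>" by (simp add: dist_norm)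
      qed
      then have "(s1, s2, t1, t2) \<in> \<C>" using s1 s2 t1 t2 \<delta> \<eta> by (auto simp: \<C>_def)
      with good have I: "?I r t1 t2" using s1 s2 by auto
      show ?case
      proof (intro exI[of _ "min (t - t1) (t2 - t)"] conjI allI impI)
        show "0 < min (t - t1) (t2 - t)" using t1 t2 by simp
        fix u v assume uv: "u \<le> t \<and> t \<le> v \<and> v - u < min (t - t1) (t2 - t)"
        show "?I r u v"
          by (rule indefinite_integral_on_subinterval[OF I]) (use uv in auto)
      qed
    qed
  qed
qed

end

section \<open>Arc length integrals along monotone parametrisations\<close>

text \<open>The length of an inscribed polygon, in recursive form for inductions over the list of parameters.\<close>
fun chain_length :: "(real \<Rightarrow> complex) \<Rightarrow> real list \<Rightarrow> real" where
  "chain_length p (x # y # zs) = dist (p x) (p y) + chain_length p (y # zs)"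
| "chain_length p _ = 0"

lemma chain_length_nonneg: "0 \<le> chain_length p ts"
  by (induction p ts rule: chain_length.induct) auto

lemma chain_length_eq_sum: "(\<Sum>i<length ts - 1. dist (p (ts ! i)) (p (ts ! Suc i))) = chain_length p ts"
proof (induction p ts rule: chain_length.induct)
  case (1 p x y zs)
  have "(\<Sum>i<length (x # y # zs) - 1. dist (p ((x # y # zs) ! i)) (p ((x # y # zs) ! Suc i)))
    = (\<Sum>i<Suc (length zs). dist (p ((x # y # zs) ! i)) (p ((y # zs) ! i)))" by simp
  also have "\<dots> = dist (p x) (p y) + (\<Sum>i<length zs. dist (p ((y # zs) ! i)) (p (zs ! i)))"
    by (subst sum.lessThan_Suc_shift) simp
  also have "(\<Sum>i<length zs. dist (p ((y # zs) ! i)) (p (zs ! i))) = chain_length p (y # zs)"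
    using 1 by simp
  finally show ?case by simp
qed auto

lemma length_on_eq: "length_on S p = (SUP ts\<in>{ts. sorted ts \<and> set ts \<subseteq> S}. ennreal (chain_length p ts))"
  unfolding length_on_def by (intro SUP_cong refl) (simp flip: chain_length_eq_sum)

lemma length_on_upper: "sorted ts \<Longrightarrow> set ts \<subseteq> S \<Longrightarrow> ennreal (chain_length p ts) \<le> length_on S p"
  unfolding length_on_eq by (rule SUP_upper) simp

text \<open>A new vertex does not shorten an inscribed polygon, by the triangle inequality.\<close>
lemma chain_length_insert: "chain_length p (xs @ ys) \<le> chain_length p (xs @ [s]) + chain_length p (s # ys)"
proof (induction xs)
  case Nil
  then show ?case by (cases ys) auto
next
  case (Cons x xs)
  show ?case
  proof (cases xs)
    case Nil
    have "dist (p x) (p y) \<le> dist (p x) (p s) + dist (p s) (p y)" for y by (rule dist_triangle)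
    then show ?thesis using Nil by (cases ys) auto
  next
    case (Cons y zs)
    then show ?thesis using Cons.IH by simp
  qed
qed

lemma chain_length_le_increment:
  assumes "\<And>u v. u \<in> S \<Longrightarrow> v \<in> S \<Longrightarrow> u \<le> v \<Longrightarrow> dist (p u) (p v) \<le> \<Phi> v - \<Phi> u"
    and "sorted (x # ts)" "set (x # ts) \<subseteq> S"
  shows "chain_length p (x # ts) \<le> \<Phi> (last (x # ts)) - \<Phi> x"
  using assms(2,3)
proof (induction ts arbitrary: x)
  case (Cons y ts)
  then have "chain_length p (y # ts) \<le> \<Phi> (last (y # ts)) - \<Phi> y" "dist (p x) (p y) \<le> \<Phi> y - \<Phi> x"
    by (auto intro!: assms(1))
  then show ?case by simp
qed simp

text \<open>If the chords of \<open>p\<close> are dominated by the increments of \<open>\<Phi>\<close>, so are the increments of its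
  length: insert \<open>s\<close> as a vertex into an inscribed polygon over \<open>{0..t}\<close>, and bound the part after
  \<open>s\<close> by telescoping.\<close>
lemma length_function_increment:
  assumes \<Phi>: "\<And>u v. 0 \<le> u \<Longrightarrow> u \<le> v \<Longrightarrow> v \<le> 1 \<Longrightarrow> dist (p u) (p v) \<le> \<Phi> v - \<Phi> u"
    and st: "0 \<le> s" "s \<le> t" "t \<le> 1"
  shows "length_on ({0..1} \<inter> {..t}) p \<le> length_on ({0..1} \<inter> {..s}) p + ennreal (\<Phi> t - \<Phi> s)"
  unfolding length_on_eq[of "{0..1} \<inter> {..t}"]
proof (rule SUP_least)
  fix ts assume "ts \<in> {ts. sorted ts \<and> set ts \<subseteq> {0..1} \<inter> {..t}}"
  then have ts: "sorted ts" "set ts \<subseteq> {0..t}" by auto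
  define xs where "xs = takeWhile (\<lambda>x. x \<le> s) ts"
  define ys where "ys = dropWhile (\<lambda>x. x \<le> s) ts"
  have split: "ts = xs @ ys" by (simp add: xs_def ys_def)
  have "sorted xs" using ts unfolding split by (simp add: sorted_append)
  moreover have "set xs \<subseteq> {0..s}"
  proof
    fix x assume "x \<in> set xs"
    then have "x \<in> set ts \<and> x \<le> s" unfolding xs_def by (rule set_takeWhileD)
    then show "x \<in> {0..s}" using ts(2) by auto
  qed
  ultimately have xs: "sorted xs" "set xs \<subseteq> {0..s}" .
  have ys: "sorted ys" "set ys \<subseteq> {0..t}" using ts unfolding split by (auto simp: sorted_append)
  have ys_ge: "s \<le> y" if "y \<in> set ys" for y
  proof (cases ys)
    case (Cons y0 zs)
    then have "\<not> y0 \<le> s" using hd_dropWhile[of "\<lambda>x. x \<le> s" ts] by (simp add: ys_def)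
    then show ?thesis using that ys(1) Cons by auto
  qed (use that in simp)
  have "chain_length p (s # ys) \<le> \<Phi> (last (s # ys)) - \<Phi> s"
  proof (rule chain_length_le_increment[of "{0..1}"])
    show "sorted (s # ys)" using ys ys_ge by simp
    show "set (s # ys) \<subseteq> {0..1}" using ys st by auto
  qed (use \<Phi> in auto)
  also have "\<Phi> (last (s # ys)) \<le> \<Phi> t"
  proof -
    have l: "last (s # ys) \<in> set (s # ys)" by (rule last_in_set) simp
    then have "0 \<le> last (s # ys)" "last (s # ys) \<le> t" using ys st by auto
    then show ?thesis using \<Phi>[of "last (s # ys)" t] st zero_le_dist[of "p (last (s # ys))" "p t"] by linarith
  qed
  finally have 1: "chain_length p (s # ys) \<le> \<Phi> t - \<Phi> s" by simp
  have "ennreal (chain_length p (xs @ [s])) \<le> length_on ({0..1} \<inter> {..s}) p"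
    by (rule length_on_upper) (use xs st in \<open>auto simp: sorted_append\<close>)
  moreover have "ennreal (chain_length p ts) \<le> ennreal (chain_length p (xs @ [s])) + ennreal (\<Phi> t - \<Phi> s)"
  proof -
    have "0 \<le> \<Phi> t - \<Phi> s" using 1 chain_length_nonneg[of p "s # ys"] by linarith
    moreover have "ennreal (chain_length p ts) \<le> ennreal (chain_length p (xs @ [s]) + (\<Phi> t - \<Phi> s))"
      using chain_length_insert[of p xs ys s] 1 unfolding split by (intro ennreal_leI) linarith
    ultimately show ?thesis by (simp only: ennreal_plus chain_length_nonneg)
  qed
  ultimately show "ennreal (chain_length p ts) \<le> length_on ({0..1} \<inter> {..s}) p + ennreal (\<Phi> t - \<Phi> s)"
    by (meson add_right_mono order_trans)
qed

lemma length_on_mono: "S \<subseteq> S' \<Longrightarrow> length_on S p \<le> length_on S' p"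
  unfolding length_on_def by (intro SUP_subset_mono) auto

lemma length_on_Iic_0: "t \<le> 0 \<Longrightarrow> length_on ({0..1} \<inter> {..t}) p = 0"
proof -
  assume "t \<le> 0"
  then have "set ts \<subseteq> {0}" if "set ts \<subseteq> {0..1} \<inter> {..t}" for ts using that by auto
  moreover have "chain_length p ts = 0" if "set ts \<subseteq> {0}" for ts
    using that by (induction p ts rule: chain_length.induct) auto
  ultimately have "length_on ({0..1} \<inter> {..t}) p \<le> 0"
    unfolding length_on_eq by (intro SUP_least) auto
  then show ?thesis by simp
qed

text \<open>Length functions are constant outside the unit interval; composing with \<open>clamp01\<close> extends other
  functions in the same way.\<close>
definition clamp01 :: "real \<Rightarrow> real" where "clamp01 t = max 0 (min 1 t)"

definition length_function :: "(real \<Rightarrow> complex) \<Rightarrow> real \<Rightarrow> real" where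
  "length_function p t = enn2real (length_on ({0..1} \<inter> {..t}) p)"

lemma clamp01_simps [simp]: "0 \<le> clamp01 t" "clamp01 t \<le> 1" "t \<in> {0..1} \<Longrightarrow> clamp01 t = t"
  "t \<le> 0 \<Longrightarrow> clamp01 t = 0" "1 \<le> t \<Longrightarrow> clamp01 t = 1"
  by (auto simp: clamp01_def)

lemma clamp01_mono: "s \<le> t \<Longrightarrow> clamp01 s \<le> clamp01 t" by (auto simp: clamp01_def)

lemma continuous_on_clamp01: "continuous_on S clamp01"
  unfolding clamp01_def[abs_def] by (intro continuous_intros)

lemma length_function_clamp: "length_function p t = length_function p (clamp01 t)"
proof -
  consider "t < 0" | "t \<in> {0..1}" | "1 < t" by fastforce
  then show ?thesis
  proof cases
    case 1 then show ?thesis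
      using length_on_Iic_0[of t p] length_on_Iic_0[of 0 p]
      by (simp only: length_function_def clamp01_simps(4) less_imp_le order_refl)
  next
    case 3
    then have "{0..1} \<inter> {..t} = {0..1} \<inter> {..1::real}" by auto
    then show ?thesis using 3 by (simp add: length_function_def)
  qed simp
qed

lemma rectifiable_dominated:
  assumes \<Phi>: "\<And>u v. 0 \<le> u \<Longrightarrow> u \<le> v \<Longrightarrow> v \<le> 1 \<Longrightarrow> dist (p u) (p v) \<le> \<Phi> v - \<Phi> u"
  shows "rectifiable p" "length_on ({0..1} \<inter> {..t}) p < \<infinity>"
proof -
  have "length_on ({0..1} \<inter> {..1}) p \<le> length_on ({0..1} \<inter> {..0}) p + ennreal (\<Phi> 1 - \<Phi> 0)"
    by (rule length_function_increment[OF \<Phi>]) auto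
  then have fin: "length_on {0..1} p < \<infinity>"
    using length_on_Iic_0[of 0 p] by (simp add: atLeastAtMost_def Int_assoc order_le_less_trans)
  then show "rectifiable p" by (simp add: rectifiable_def)
  show "length_on ({0..1} \<inter> {..t}) p < \<infinity>"
    using order_le_less_trans[OF length_on_mono fin] by blast
qed

lemma length_function_dominated:
  assumes \<Phi>: "\<And>u v. 0 \<le> u \<Longrightarrow> u \<le> v \<Longrightarrow> v \<le> 1 \<Longrightarrow> dist (p u) (p v) \<le> \<Phi> v - \<Phi> u" and "s \<le> t"
  shows "length_function p s \<le> length_function p t"
    "length_function p t - length_function p s \<le> \<Phi> (clamp01 t) - \<Phi> (clamp01 s)"
proof -
  let ?s = "clamp01 s" and ?t = "clamp01 t"
  have st: "0 \<le> ?s" "?s \<le> ?t" "?t \<le> 1" using assms(2) clamp01_mono by auto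
  note fin = rectifiable_dominated(2)[of p \<Phi>, OF \<Phi>]
  have le: "length_on ({0..1} \<inter> {..?s}) p \<le> length_on ({0..1} \<inter> {..?t}) p"
    by (rule length_on_mono) (use st in auto)
  show "length_function p s \<le> length_function p t"
    unfolding length_function_clamp[of p s] length_function_clamp[of p t]
    using enn2real_mono[OF le fin[unfolded infinity_ennreal_def]] by (simp add: length_function_def)
  have pos: "0 \<le> \<Phi> ?t - \<Phi> ?s" using \<Phi>[OF st] zero_le_dist order_trans by blast
  have "length_on ({0..1} \<inter> {..?t}) p \<le> length_on ({0..1} \<inter> {..?s}) p + ennreal (\<Phi> ?t - \<Phi> ?s)"
    by (rule length_function_increment[OF \<Phi> st])
  then have "ennreal (length_function p ?t) \<le> ennreal (length_function p ?s) + ennreal (\<Phi> ?t - \<Phi> ?s)"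
    unfolding length_function_def by (simp only: ennreal_enn2real[OF fin[unfolded infinity_ennreal_def]])
  also have "\<dots> = ennreal (length_function p ?s + (\<Phi> ?t - \<Phi> ?s))"
    using pos by (simp add: length_function_def ennreal_plus[symmetric] del: ennreal_plus)
  finally have "length_function p ?t \<le> length_function p ?s + (\<Phi> ?t - \<Phi> ?s)"
    using pos by (subst (asm) ennreal_le_iff) (simp_all add: length_function_def add_nonneg_nonneg)
  then show "length_function p t - length_function p s \<le> \<Phi> ?t - \<Phi> ?s"
    unfolding length_function_clamp[of p s] length_function_clamp[of p t] by simp
qed

lemma emeasure_interval_measure_greaterThan:
  assumes mono: "mono V" and cont: "continuous_on UNIV V" and const: "\<And>t. 1 \<le> t \<Longrightarrow> V t = V 1"
  shows "emeasure (interval_measure V) {x<..} = ennreal (V 1 - V x)"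
proof -
  have Ioc: "emeasure (interval_measure V) {x<..x + real n} = ennreal (V (x + real n) - V x)" for n
    by (rule emeasure_interval_measure_Ioc)
       (use mono cont in \<open>auto simp: mono_def continuous_on_eq_continuous_within intro: continuous_within_subset\<close>)
  have un: "(\<Union>n. {x<..x + real n}) = {x<..}"
  proof -
    have "\<exists>n. y \<le> x + real n" for y using real_arch_simple[of "y - x"] by (auto simp: algebra_simps)
    then show ?thesis by auto
  qed
  have "(\<lambda>n. emeasure (interval_measure V) {x<..x + real n}) \<longlonglongrightarrow> emeasure (interval_measure V) (\<Union>n. {x<..x + real n})"
    by (rule Lim_emeasure_incseq) (auto simp: incseq_def)
  moreover have "(\<lambda>n. emeasure (interval_measure V) {x<..x + real n}) \<longlonglongrightarrow> ennreal (V 1 - V x)"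
  proof (rule tendsto_eventually)
    obtain N where N: "1 - x \<le> real N" using real_arch_simple by blast
    have "V (x + real n) = V 1" if "n \<ge> N" for n
    proof (rule const)
      have "real N \<le> real n" using that by simp
      with N show "1 \<le> x + real n" by linarith
    qed
    then show "\<forall>\<^sub>F n in sequentially. emeasure (interval_measure V) {x<..x + real n} = ennreal (V 1 - V x)"
      unfolding Ioc eventually_sequentially by (intro exI[of _ N]) simp
  qed
  ultimately show ?thesis unfolding un by (rule LIMSEQ_unique)
qed

text \<open>The difference of the two distribution functions is a distribution function as well.  Adding its
  measure to the smaller one gives a measure with the larger distribution function, which is the
  larger measure by uniqueness.\<close>
lemma interval_measure_mono:
  assumes V: "mono V" "continuous_on UNIV V" "\<And>t. 1 \<le> t \<Longrightarrow> V t = V 1"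
    and \<Psi>: "mono \<Psi>" "continuous_on UNIV \<Psi>" "\<And>t. 1 \<le> t \<Longrightarrow> \<Psi> t = \<Psi> 1"
    and diff: "mono (\<lambda>t. \<Psi> t - V t)"
  shows "interval_measure V \<le> interval_measure \<Psi>"
proof -
  let ?M = "interval_measure V" and ?N = "interval_measure \<Psi>" and ?R = "interval_measure (\<lambda>t. \<Psi> t - V t)"
  define S where "S = measure_of UNIV (sets borel) (\<lambda>A. emeasure ?M A + emeasure ?R A)"
  have sets_S: "sets S = sets borel"
    unfolding S_def by (simp add: sigma_algebra.sigma_sets_eq[OF sets.sigma_algebra_axioms[of borel, simplified]] sets_measure_of_conv)
  have eS: "emeasure S A = emeasure ?M A + emeasure ?R A" if "A \<in> sets borel" for A
    unfolding S_def
  proof (rule emeasure_measure_of_sigma)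
    show "sigma_algebra UNIV (sets borel)" using sets.sigma_algebra_axioms[of borel] by simp
    show "countably_additive (sets borel) (\<lambda>A. emeasure ?M A + emeasure ?R A)"
      unfolding countably_additive_def
    proof (intro allI impI)
      fix A :: "nat \<Rightarrow> real set" assume "range A \<subseteq> sets borel" "disjoint_family A"
      then show "(\<Sum>i. emeasure ?M (A i) + emeasure ?R (A i)) = emeasure ?M (\<Union>i. A i) + emeasure ?R (\<Union>i. A i)"
        by (subst suminf_add[symmetric]) (auto simp: suminf_emeasure)
    qed
  qed (use that in \<open>auto simp: positive_def\<close>)
  have mV: "V x \<le> V 1 \<and> \<Psi> x - V x \<le> \<Psi> 1 - V 1" for x
  proof (cases "x \<le> 1")
    case True
    then show ?thesis using monoD[OF V(1) True] monoD[OF diff True] by blast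
  next
    case False
    then have "V x = V 1" "\<Psi> x = \<Psi> 1" using V(3)[of x] \<Psi>(3)[of x] by linarith+
    then show ?thesis by simp
  qed
  have "S = ?N"
  proof (rule measure_eqI_lessThan)
    fix x
    have m: "emeasure ?M {x<..} = ennreal (V 1 - V x)"
      by (rule emeasure_interval_measure_greaterThan[OF V(1,2)]) (rule V(3))
    have n: "emeasure ?N {x<..} = ennreal (\<Psi> 1 - \<Psi> x)"
      by (rule emeasure_interval_measure_greaterThan[OF \<Psi>(1,2)]) (rule \<Psi>(3))
    have r: "emeasure ?R {x<..} = ennreal ((\<Psi> 1 - V 1) - (\<Psi> x - V x))"
    proof (rule emeasure_interval_measure_greaterThan[OF diff])
      show "continuous_on UNIV (\<lambda>t. \<Psi> t - V t)" by (rule continuous_on_diff[OF \<Psi>(2) V(2)])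
      fix t :: real assume t: "1 \<le> t"
      show "\<Psi> t - V t = \<Psi> 1 - V 1" using V(3)[OF t] \<Psi>(3)[OF t] by simp
    qed
    have "emeasure S {x<..} = ennreal (V 1 - V x) + ennreal ((\<Psi> 1 - V 1) - (\<Psi> x - V x))"
      by (simp only: eS[OF borel_open[OF open_greaterThan]] m r)
    also have "\<dots> = ennreal (\<Psi> 1 - \<Psi> x)"
      using mV[of x] by (subst ennreal_plus[symmetric]) auto
    finally show "emeasure S {x<..} = emeasure ?N {x<..}" "emeasure S {x<..} < \<infinity>"
      by (simp_all add: n)
  qed (simp_all add: sets_S)
  then have "emeasure ?M A \<le> emeasure ?N A" for A
    using eS[of A] by (cases "A \<in> sets borel") (auto simp: emeasure_notin_sets)
  then show ?thesis by (subst le_measure) auto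
qed

section \<open>Change of parameter and arcs of circles\<close>

locale monotone_reparametrisation =
  fixes \<theta> :: "real \<Rightarrow> real" and a b :: real
  assumes cont: "continuous_on {0..1} \<theta>" and smono: "strict_mono_on {0..1} \<theta>" and ends: "\<theta> 0 = a" "\<theta> 1 = b"
begin

lemma inj: "inj_on \<theta> {0..1}" using smono by (rule strict_mono_on_imp_inj_on)

lemma less_iff: "s \<in> {0..1} \<Longrightarrow> t \<in> {0..1} \<Longrightarrow> \<theta> s < \<theta> t \<longleftrightarrow> s < t"
  using smono by (simp add: strict_mono_on_less)

lemma le_iff: "s \<in> {0..1} \<Longrightarrow> t \<in> {0..1} \<Longrightarrow> \<theta> s \<le> \<theta> t \<longleftrightarrow> s \<le> t"
  using smono by (simp add: strict_mono_on_less_eq)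

lemma a_less_b: "a < b" using less_iff[of 0 1] ends by simp

lemma theta_in: "t \<in> {0..1} \<Longrightarrow> \<theta> t \<in> {a..b}"
  using le_iff[of 0 t] le_iff[of t 1] ends by simp

lemma image: "\<theta> ` {0..1} = {a..b}"
proof
  show "\<theta> ` {0..1} \<subseteq> {a..b}" using theta_in by blast
  show "{a..b} \<subseteq> \<theta> ` {0..1}"
  proof
    fix s assume "s \<in> {a..b}"
    then obtain t where "0 \<le> t" "t \<le> 1" "\<theta> t = s" using IVT'[of \<theta> 0 s 1] cont ends by auto
    then show "s \<in> \<theta> ` {0..1}" by auto
  qed
qed

definition inverse_param :: "real \<Rightarrow> real" where
  "inverse_param s = (if s \<in> {a..b} then the_inv_into {0..1} \<theta> s else 0)"

lemma inverse_param_in: "s \<in> {a..b} \<Longrightarrow> inverse_param s \<in> {0..1}"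
  and theta_inverse_param: "s \<in> {a..b} \<Longrightarrow> \<theta> (inverse_param s) = s"
  using the_inv_into_into[OF inj _ subset_refl] f_the_inv_into_f[OF inj] image by (simp_all only: inverse_param_def if_True)

lemma measurable_inverse_param [measurable]: "inverse_param \<in> borel_measurable borel"
  unfolding inverse_param_def[abs_def]
proof (rule borel_measurable_continuous_on_if)
  show "continuous_on {a..b} (the_inv_into {0..1} \<theta>)"
    using continuous_on_inv_into[OF cont compact_Icc inj] by (simp add: image)
qed auto

lemma less_inverse_param: "s \<in> {a..b} \<Longrightarrow> x \<in> {0..1} \<Longrightarrow> x < inverse_param s \<longleftrightarrow> \<theta> x < s"
  using less_iff[of x "inverse_param s"] inverse_param_in theta_inverse_param by auto

end

text \<open>The curve \<open>q\<close> has chords dominated by the integral of \<open>w\<close>, and \<open>p\<close> runs through it by the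
  monotone change of parameter \<open>\<theta>\<close>.\<close>
locale dominated_path = monotone_reparametrisation +
  fixes q :: "real \<Rightarrow> complex" and p :: "real \<Rightarrow> complex" and w :: "real \<Rightarrow> real"
  assumes q: "continuous_on {a..b} q" and p: "\<And>t. t \<in> {0..1} \<Longrightarrow> p t = q (\<theta> t)"
    and w [measurable]: "w \<in> borel_measurable borel" and w_nonneg: "\<And>s. 0 \<le> w s" and w_int: "set_integrable lborel {a..b} w"
    and chord: "\<And>u v. a \<le> u \<Longrightarrow> u \<le> v \<Longrightarrow> v \<le> b \<Longrightarrow> dist (q u) (q v) \<le> (LINT s:{u..v}|lborel. w s)"
begin

definition dominating :: "real \<Rightarrow> real" where
  "dominating t = (LINT s:{a..\<theta> (clamp01 t)}|lborel. w s)"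

lemma w_sub: assumes "a \<le> u" "v \<le> b"
  shows "set_integrable lborel {u..v} w" "(LINT s:{u..v}|lborel. w s) = integral {u..v} w" "w integrable_on {u..v}"
proof -
  show *: "set_integrable lborel {u..v} w" by (rule set_integrable_subset[OF w_int]) (use assms in auto)
  show "(LINT s:{u..v}|lborel. w s) = integral {u..v} w" "w integrable_on {u..v}"
    using set_borel_integral_eq_integral[OF *] by auto
qed

lemma w_split: assumes "a \<le> u" "u \<le> v" "v \<le> b"
  shows "(LINT s:{a..v}|lborel. w s) - (LINT s:{a..u}|lborel. w s) = (LINT s:{u..v}|lborel. w s)"
  using Henstock_Kurzweil_Integration.integral_combine[of a u v w] w_sub assms by simp

lemma w_nn: assumes "a \<le> u" "v \<le> b"
  shows "(\<integral>\<^sup>+s\<in>{u..v}. ennreal (w s) \<partial>lborel) = ennreal (LINT s:{u..v}|lborel. w s)" "0 \<le> (LINT s:{u..v}|lborel. w s)"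
proof -
  have "(\<integral>\<^sup>+s\<in>{u..v}. ennreal (w s) \<partial>lborel) = (\<integral>\<^sup>+s. ennreal (indicator {u..v} s *\<^sub>R w s) \<partial>lborel)"
    by (intro nn_integral_cong) (auto simp: indicator_def)
  also have "\<dots> = ennreal (LINT s:{u..v}|lborel. w s)"
    unfolding set_lebesgue_integral_def using w_sub(1)[OF assms] w_nonneg
    by (intro nn_integral_eq_integral) (auto simp: set_integrable_def)
  finally show "(\<integral>\<^sup>+s\<in>{u..v}. ennreal (w s) \<partial>lborel) = ennreal (LINT s:{u..v}|lborel. w s)" .
  show "0 \<le> (LINT s:{u..v}|lborel. w s)"
    unfolding set_lebesgue_integral_def by (intro integral_nonneg_AE) (auto simp: w_nonneg)
qed

lemma theta_clamp: "\<theta> (clamp01 t) \<in> {a..b}" by (rule theta_in) simp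

lemma dominating_diff:
  assumes "s \<le> t"
  shows "dominating t - dominating s = (LINT x:{\<theta> (clamp01 s)..\<theta> (clamp01 t)}|lborel. w x)" "dominating s \<le> dominating t"
proof -
  have le: "\<theta> (clamp01 s) \<le> \<theta> (clamp01 t)" using clamp01_mono[OF assms] by (subst le_iff) auto
  show *: "dominating t - dominating s = (LINT x:{\<theta> (clamp01 s)..\<theta> (clamp01 t)}|lborel. w x)"
    unfolding dominating_def by (rule w_split) (use le theta_clamp in auto)
  show "dominating s \<le> dominating t" using w_nn(2)[of "\<theta> (clamp01 s)" "\<theta> (clamp01 t)"] theta_clamp * by auto
qed

lemma dominating_mono: "mono dominating" using dominating_diff(2) by (rule monoI)

lemma dominating_cont: "continuous_on UNIV dominating"
proof -
  have 1: "continuous_on {a..b} (\<lambda>x. integral {a..x} w)"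
    by (rule indefinite_integral_continuous_1) (rule w_sub(3), auto)
  have 2: "continuous_on UNIV (\<lambda>t. \<theta> (clamp01 t))"
    by (rule continuous_on_compose2[OF cont continuous_on_clamp01]) auto
  have "continuous_on UNIV (\<lambda>t. integral {a..\<theta> (clamp01 t)} w)"
    by (rule continuous_on_compose2[OF 1 2]) (use theta_clamp in auto)
  moreover have "dominating t = integral {a..\<theta> (clamp01 t)} w" for t
    unfolding dominating_def by (rule w_sub(2)) (use theta_clamp in auto)
  ultimately show ?thesis by simp
qed

lemma dominating_const: "1 \<le> t \<Longrightarrow> dominating t = dominating 1" by (simp add: dominating_def)

lemma p_chord: "0 \<le> u \<Longrightarrow> u \<le> v \<Longrightarrow> v \<le> 1 \<Longrightarrow> dist (p u) (p v) \<le> dominating v - dominating u"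
  using chord[of "\<theta> u" "\<theta> v"] dominating_diff(1)[of u v] theta_in[of u] theta_in[of v] le_iff[of u v] by (simp add: p)

lemma rectifiable: "rectifiable p"
  by (rule rectifiable_dominated(1)[of p dominating, OF p_chord])

lemma length_diff:
  assumes "s \<le> t"
  shows "length_function p s \<le> length_function p t" "length_function p t - length_function p s \<le> dominating t - dominating s"
proof -
  have c: "dominating (clamp01 x) = dominating x" for x by (simp add: dominating_def clamp01_def)
  show "length_function p s \<le> length_function p t" "length_function p t - length_function p s \<le> dominating t - dominating s"
    using length_function_dominated[of p dominating s t, OF p_chord assms] by (simp_all add: c)
qed

lemma length_cont: "continuous_on UNIV (length_function p)"
proof (rule continuous_at_imp_continuous_on, intro ballI)
  fix x
  have "(dominating \<longlongrightarrow> dominating x) (at x)"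
    using dominating_cont by (simp add: continuous_on_def)
  then have "((\<lambda>t. \<bar>dominating t - dominating x\<bar>) \<longlongrightarrow> 0) (at x)"
    by (intro tendsto_rabs_zero LIM_zero)
  then have "((\<lambda>t. length_function p t - length_function p x) \<longlongrightarrow> 0) (at x)"
  proof (rule Lim_null_comparison[rotated])
    have "norm (length_function p t - length_function p x) \<le> \<bar>dominating t - dominating x\<bar>" for t
      using length_diff[of x t] length_diff[of t x] by (cases "x \<le> t") auto
    then show "\<forall>\<^sub>F t in at x. norm (length_function p t - length_function p x) \<le> \<bar>dominating t - dominating x\<bar>" by simp
  qed
  then show "isCont (length_function p) x" unfolding isCont_def by (rule LIM_zero_cancel)
qed

lemma length_const: "1 \<le> t \<Longrightarrow> length_function p t = length_function p 1"
  using length_function_clamp[of p t] by simp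

lemma interval_measure_length_le: "interval_measure (length_function p) \<le> interval_measure dominating"
proof (rule interval_measure_mono[OF _ length_cont length_const dominating_mono dominating_cont dominating_const])
  show "mono (length_function p)" by (rule monoI, rule length_diff(1))
  show "mono (\<lambda>t. dominating t - length_function p t)"
  proof (rule monoI)
    fix s t :: real assume "s \<le> t"
    from length_diff(2)[OF this] show "dominating s - length_function p s \<le> dominating t - length_function p t" by linarith
  qed
qed

text \<open>The Stieltjes measure of the integral of \<open>w\<close> up to \<open>\<theta> t\<close> is the measure \<open>w ds\<close>
  transported by the inverse of \<open>\<theta>\<close>: both have the same distribution function.\<close>
lemma interval_measure_dominating:
  "interval_measure dominating = distr (density lborel (\<lambda>s. ennreal (w s) * indicator {a..b} s)) borel inverse_param"
  (is "_ = ?N")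
proof (rule measure_eqI_lessThan)
  fix x
  let ?c = "\<theta> (clamp01 x)"
  have M: "emeasure (interval_measure dominating) {x<..} = ennreal (dominating 1 - dominating x)"
    by (rule emeasure_interval_measure_greaterThan[OF dominating_mono dominating_cont]) (rule dominating_const)
  have "dominating 1 - dominating x = (LINT s:{?c..b}|lborel. w s)"
    using w_split[of ?c b] theta_clamp[of x] by (simp add: dominating_def ends)
  also have "ennreal \<dots> = (\<integral>\<^sup>+s\<in>{?c..b}. ennreal (w s) \<partial>lborel)"
    using w_nn(1)[of ?c b] theta_clamp[of x] by simp
  also have "\<dots> = (\<integral>\<^sup>+s. ennreal (w s) * indicator {a..b} s * indicator {x<..} (inverse_param s) \<partial>lborel)"
  proof (rule nn_integral_cong_AE)
    have "AE s in lborel. s \<noteq> ?c" by (rule AE_lborel_singleton)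
    moreover have "AE s in lborel. s \<noteq> a" by (rule AE_lborel_singleton)
    ultimately show "AE s in lborel. ennreal (w s) * indicator {?c..b} s = ennreal (w s) * indicator {a..b} s * indicator {x<..} (inverse_param s)"
    proof (elim AE_mp, intro AE_I2 impI)
      fix s assume ne: "s \<noteq> a" "s \<noteq> ?c"
      have "s \<in> {?c..b} \<longleftrightarrow> s \<in> {a..b} \<and> x < inverse_param s"
      proof (cases "s \<in> {a..b}")
        case True
        consider "x < 0" | "x \<in> {0..1}" | "1 < x" by fastforce
        then show ?thesis
        proof cases
          case 1 then show ?thesis using True inverse_param_in[OF True] ends by auto
        next
          case 2 then show ?thesis using True less_inverse_param[OF True 2] ne by auto
        next
          case 3 then show ?thesis using True inverse_param_in[OF True] ne ends by auto
        qed
      qed (use theta_clamp[of x] in auto)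
      then show "ennreal (w s) * indicator {?c..b} s = ennreal (w s) * indicator {a..b} s * indicator {x<..} (inverse_param s)"
        by (auto simp: indicator_def)
    qed
  qed
  also have "\<dots> = emeasure ?N {x<..}"
  proof -
    have [measurable]: "inverse_param -` {x<..} \<in> sets borel"
      using measurable_sets[OF measurable_inverse_param, of "{x<..}"] by simp
    have "emeasure ?N {x<..} = (\<integral>\<^sup>+s. ennreal (w s) * indicator {a..b} s * indicator (inverse_param -` {x<..}) s \<partial>lborel)"
      by (simp add: emeasure_distr emeasure_density)
    then show ?thesis by (simp add: indicator_def)
  qed
  finally show "emeasure (interval_measure dominating) {x<..} = emeasure ?N {x<..}" unfolding M by simp
  show "emeasure (interval_measure dominating) {x<..} < \<infinity>" unfolding M by simp
qed simp_all

lemma nn_integral_dominating: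
  assumes [measurable]: "\<rho> \<in> borel_measurable borel"
  shows "(\<integral>\<^sup>+t\<in>{0..1}. \<rho> (p t) \<partial>interval_measure dominating) = (\<integral>\<^sup>+s\<in>{a..b}. \<rho> (q s) * ennreal (w s) \<partial>lborel)"
proof -
  define p' where "p' = (\<lambda>t. if t \<in> {0..1} then q (\<theta> t) else 0)"
  have [measurable]: "p' \<in> borel_measurable borel"
    unfolding p'_def
  proof (rule borel_measurable_continuous_on_if)
    show "continuous_on {0..1} (\<lambda>t. q (\<theta> t))"
      by (rule continuous_on_compose2[OF q cont]) (use theta_in in auto)
  qed auto
  have "(\<integral>\<^sup>+t\<in>{0..1}. \<rho> (p t) \<partial>interval_measure dominating) = (\<integral>\<^sup>+t. \<rho> (p' t) * indicator {0..1} t \<partial>interval_measure dominating)"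
    by (intro nn_integral_cong) (auto simp: indicator_def p'_def p)
  also have "\<dots> = (\<integral>\<^sup>+s. ennreal (w s) * indicator {a..b} s * (\<rho> (p' (inverse_param s)) * indicator {0..1} (inverse_param s)) \<partial>lborel)"
    unfolding interval_measure_dominating by (simp add: nn_integral_distr nn_integral_density)
  also have "\<dots> = (\<integral>\<^sup>+s\<in>{a..b}. \<rho> (q s) * ennreal (w s) \<partial>lborel)"
    using inverse_param_in theta_inverse_param by (intro nn_integral_cong) (auto simp: indicator_def p'_def mult.commute)
  finally show ?thesis .
qed

text \<open>The length measure of \<open>p\<close> is at most the Stieltjes measure of \<open>dominating\<close>, which becomes
  \<open>w ds\<close> in the parameter of \<open>q\<close>.\<close>
theorem arc_length_integral_le:
  assumes [measurable]: "\<rho> \<in> borel_measurable borel"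
  shows "arc_length_integral \<rho> p \<le> (\<integral>\<^sup>+s\<in>{a..b}. \<rho> (q s) * ennreal (w s) \<partial>lborel)"
proof -
  have "arc_length_integral \<rho> p = (\<integral>\<^sup>+t\<in>{0..1}. \<rho> (p t) \<partial>interval_measure (length_function p))"
    using rectifiable by (simp add: arc_length_integral_def length_function_def[abs_def])
  also have "\<dots> \<le> (\<integral>\<^sup>+t\<in>{0..1}. \<rho> (p t) \<partial>interval_measure dominating)"
    using interval_measure_length_le by (intro nn_integral_mono_measure) simp_all
  finally show ?thesis by (simp add: nn_integral_dominating)
qed

text \<open>A length function that is dominated by \<open>dominating\<close> and nowhere below it coincides with it, so
  the estimate of the two Stieltjes measures becomes an equality.\<close>
lemma arc_length_integral_eq:
  assumes [measurable]: "\<rho> \<in> borel_measurable borel"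
    and full: "\<And>t. t \<in> {0..1} \<Longrightarrow> ennreal (dominating t) \<le> length_on ({0..1} \<inter> {..t}) p"
  shows "arc_length_integral \<rho> p = (\<integral>\<^sup>+s\<in>{a..b}. \<rho> (q s) * ennreal (w s) \<partial>lborel)"
proof -
  have d0: "dominating 0 = 0"
  proof -
    have "(\<integral>\<^sup>+s\<in>{a..a}. ennreal (w s) \<partial>lborel) = (\<integral>\<^sup>+s. 0 \<partial>(lborel::real measure))"
      by (rule nn_integral_cong_AE, rule AE_mp[OF AE_lborel_singleton[of a]], intro AE_I2) (simp add: indicator_def)
    then have "ennreal (LINT s:{a..a}|lborel. w s) = 0" using w_nn(1)[of a a] a_less_b by simp
    then show ?thesis using w_nn(2)[of a a] a_less_b by (simp add: dominating_def ends)
  qed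
  have "length_function p t = dominating t" for t
  proof -
    let ?t = "clamp01 t"
    have "dominating ?t \<le> length_function p ?t"
    proof -
      have "dominating ?t = enn2real (ennreal (dominating ?t))"
        using dominating_diff(2)[of 0 ?t] d0 by simp
      also have "\<dots> \<le> length_function p ?t"
        unfolding length_function_def
        using full[of ?t] rectifiable_dominated(2)[of p dominating ?t, OF p_chord] by (intro enn2real_mono) auto
      finally show ?thesis .
    qed
    moreover have "length_function p ?t \<le> dominating ?t"
      using length_diff(2)[of 0 ?t] d0 length_on_Iic_0[of 0 p] unfolding length_function_def by simp
    ultimately show ?thesis using length_function_clamp[of p t] by (simp add: dominating_def clamp01_def)
  qed
  then have "length_function p = dominating" by auto
  then show ?thesis
    using rectifiable by (simp add: arc_length_integral_def length_function_def[abs_def] nn_integral_dominating)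
qed

end

lemma dist_cis: "dist (cis x) (cis y) = 2 * \<bar>sin ((x - y) / 2)\<bar>"
proof -
  have "cis x - cis y = cis y * (exp (\<i> * of_real (x - y)) - 1)"
    by (simp add: cis_conv_exp algebra_simps flip: exp_add)
  then show ?thesis using dist_exp_i_1[of "x - y"] by (simp add: dist_norm norm_mult)
qed

lemma dist_polar:
  assumes "\<bar>\<sigma>\<bar> = 1" "r > 0"
  shows "dist (polar z0 \<sigma> (Complex r x)) (polar z0 \<sigma> (Complex r y)) = 2 * r * \<bar>sin ((x - y) / 2)\<bar>"
proof -
  have "dist (polar z0 \<sigma> (Complex r x)) (polar z0 \<sigma> (Complex r y)) = r * dist (cis (\<sigma> * x)) (cis (\<sigma> * y))"
    using assms by (simp add: polar_def dist_norm norm_mult flip: right_diff_distrib)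
  also have "\<dots> = 2 * r * \<bar>sin (\<sigma> * ((x - y) / 2))\<bar>" by (simp add: dist_cis right_diff_distrib diff_divide_distrib)
  also have "\<bar>sin (\<sigma> * ((x - y) / 2))\<bar> = \<bar>sin ((x - y) / 2)\<bar>"
  proof -
    have "\<sigma> = 1 \<or> \<sigma> = - 1" using assms(1) by linarith
    then show ?thesis by (elim disjE) (simp_all only: mult_minus_left mult_1 sin_minus abs_minus_cancel)
  qed
  finally show ?thesis .
qed

lemma circle_subdivision_limit: "(\<lambda>n. real (Suc n) * (2 * r * \<bar>sin ((d / real (Suc n)) / 2)\<bar>)) \<longlonglongrightarrow> r * \<bar>d\<bar>"
proof (cases "d = 0")
  case False
  have s: "((\<lambda>h. sin h / h) \<longlongrightarrow> 1) (at (0::real))"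
    using DERIV_sin[of "0::real"] by (simp add: DERIV_def)
  have "(\<lambda>n. (d / 2) * inverse (real (Suc n))) \<longlonglongrightarrow> (d / 2) * 0"
    by (intro tendsto_mult tendsto_const LIMSEQ_inverse_real_of_nat)
  moreover have "d / real (Suc n) / 2 = (d / 2) * inverse (real (Suc n))" for n
    by (simp only: divide_inverse mult_ac)
  ultimately have "(\<lambda>n. d / real (Suc n) / 2) \<longlonglongrightarrow> 0"
    by (simp only: mult_zero_right)
  moreover have "d / real (Suc n) / 2 \<noteq> 0" for n using False by simp
  ultimately have "filterlim (\<lambda>n. d / real (Suc n) / 2) (at 0) sequentially"
    unfolding filterlim_at by (intro conjI always_eventually allI) blast+
  then have "(\<lambda>n. sin (d / real (Suc n) / 2) / (d / real (Suc n) / 2)) \<longlonglongrightarrow> 1"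
    by (rule filterlim_compose[OF s])
  then have "(\<lambda>n. r * \<bar>d\<bar> * \<bar>sin (d / real (Suc n) / 2) / (d / real (Suc n) / 2)\<bar>) \<longlonglongrightarrow> r * \<bar>d\<bar> * \<bar>1\<bar>"
    by (intro tendsto_intros)
  moreover have "r * \<bar>d\<bar> * \<bar>sin (d / real (Suc n) / 2) / (d / real (Suc n) / 2)\<bar> = real (Suc n) * (2 * r * \<bar>sin ((d / real (Suc n)) / 2)\<bar>)" for n
    using False by (simp add: abs_mult abs_divide field_simps del: of_nat_Suc)
  ultimately show ?thesis by simp
qed simp

text \<open>Here \<open>q\<close> is an arc of a circle, and the dominating function is its exact arc length: inscribed
  polygons with equal central angles show that nothing is lost.\<close>
locale circular_path = monotone_reparametrisation +
  fixes z0 :: complex and \<sigma> r :: real and p :: "real \<Rightarrow> complex"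
  assumes \<sigma>: "\<bar>\<sigma>\<bar> = 1" and r: "r > 0" and pc: "\<And>t. t \<in> {0..1} \<Longrightarrow> p t = polar z0 \<sigma> (Complex r (\<theta> t))"
begin

lemma continuous_on_circle: "continuous_on S (\<lambda>s. polar z0 \<sigma> (Complex r s))"
  by (rule continuous_on_compose2[OF continuous_on_polar(1)[of UNIV] continuous_on_Complex_vertical]) simp

lemma LINT_const: "u \<le> v \<Longrightarrow> (LINT s:{u..v}|lborel. r) = r * (v - u)"
  by (simp add: set_lebesgue_integral_def)

sublocale dominated_path \<theta> a b "\<lambda>s. polar z0 \<sigma> (Complex r s)" p "\<lambda>_. r"
proof
  fix u v :: real assume uv: "u \<le> v"
  have "dist (polar z0 \<sigma> (Complex r u)) (polar z0 \<sigma> (Complex r v)) \<le> 2 * r * \<bar>(u - v) / 2\<bar>"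
    unfolding dist_polar[OF \<sigma> r] using r by (intro mult_left_mono abs_sin_x_le_abs_x) simp
  then show "dist (polar z0 \<sigma> (Complex r u)) (polar z0 \<sigma> (Complex r v)) \<le> (LINT s:{u..v}|lborel. r)"
    using uv by (simp add: LINT_const)
next
  show "set_integrable lborel {a..b} (\<lambda>_. r)"
    unfolding set_integrable_def by (rule borel_integrable_compact) auto
qed (use pc r in \<open>auto intro: continuous_on_circle\<close>)

lemma length_lower_bound:
  assumes t: "t \<in> {0..1}"
  shows "ennreal (r * (\<theta> t - a)) \<le> length_on ({0..1} \<inter> {..t}) p"
proof -
  define d where "d = \<theta> t - a"
  have d: "0 \<le> d" using theta_in[OF t] by (simp add: d_def)
  have lower: "ennreal (real (Suc n) * (2 * r * \<bar>sin ((d / real (Suc n)) / 2)\<bar>)) \<le> length_on ({0..1} \<inter> {..t}) p" for n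
  proof -
    define x where "x i = a + real i * (d / real (Suc n))" for i :: nat
    define ts where "ts = map (\<lambda>i. inverse_param (x i)) [0..<Suc (Suc n)]"
    have x_le: "x i \<le> \<theta> t" if "i \<le> Suc n" for i
    proof -
      have "real i * (d / real (Suc n)) \<le> real (Suc n) * (d / real (Suc n))"
        using that d by (intro mult_right_mono) auto
      then show ?thesis by (simp add: x_def d_def del: of_nat_Suc)
    qed
    have x_mono: "x i \<le> x j" if "i \<le> j" for i j
      unfolding x_def using that d by (intro add_left_mono mult_right_mono) (simp_all del: of_nat_Suc)
    have x_in: "x i \<in> {a..b}" if "i \<le> Suc n" for i
      using x_le[OF that] x_mono[of 0 i] theta_in[OF t] by (simp add: x_def)
    have ip: "inverse_param (x i) \<in> {0..1}" "\<theta> (inverse_param (x i)) = x i" "inverse_param (x i) \<le> t" if "i \<le> Suc n" for i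
      using inverse_param_in[OF x_in[OF that]] theta_inverse_param[OF x_in[OF that]] x_le[OF that] le_iff[of "inverse_param (x i)" t] t
      by auto
    have "sorted ts"
      unfolding ts_def sorted_iff_nth_mono
    proof (intro allI impI)
      fix i j assume ij: "i \<le> j" "j < length (map (\<lambda>i. inverse_param (x i)) [0..<Suc (Suc n)])"
      then have "inverse_param (x i) \<le> inverse_param (x j)"
        using ip[of i] ip[of j] x_mono[of i j] le_iff[of "inverse_param (x i)" "inverse_param (x j)"] by simp
      then show "map (\<lambda>i. inverse_param (x i)) [0..<Suc (Suc n)] ! i \<le> map (\<lambda>i. inverse_param (x i)) [0..<Suc (Suc n)] ! j"
        using ij by (simp del: upt_Suc)
    qed
    moreover have "set ts \<subseteq> {0..1} \<inter> {..t}"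
      using ip by (auto simp: ts_def simp del: upt_Suc)
    ultimately have "ennreal (chain_length p ts) \<le> length_on ({0..1} \<inter> {..t}) p" by (rule length_on_upper)
    moreover have "chain_length p ts = real (Suc n) * (2 * r * \<bar>sin ((d / real (Suc n)) / 2)\<bar>)"
    proof -
      have "chain_length p ts = (\<Sum>i<Suc n. dist (p (inverse_param (x i))) (p (inverse_param (x (Suc i)))))"
        unfolding chain_length_eq_sum[symmetric] ts_def by (intro sum.cong) (simp_all del: upt_Suc)
      also have "\<dots> = (\<Sum>i<Suc n. 2 * r * \<bar>sin ((d / real (Suc n)) / 2)\<bar>)"
      proof (rule sum.cong[OF refl])
        fix i assume "i \<in> {..<Suc n}"
        then have i: "i \<le> Suc n" "Suc i \<le> Suc n" by auto
        have "dist (p (inverse_param (x i))) (p (inverse_param (x (Suc i)))) = 2 * r * \<bar>sin ((x i - x (Suc i)) / 2)\<bar>"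
          using ip[OF i(1)] ip[OF i(2)] by (simp only: pc dist_polar[OF \<sigma> r])
        also have "x i - x (Suc i) = - (d / real (Suc n))"
        proof -
          have "(a + real i * c) - (a + real (Suc i) * c) = - c" for c by (simp add: algebra_simps)
          then show ?thesis by (simp only: x_def)
        qed
        finally show "dist (p (inverse_param (x i))) (p (inverse_param (x (Suc i)))) = 2 * r * \<bar>sin ((d / real (Suc n)) / 2)\<bar>"
          by (simp only: minus_divide_left[symmetric] sin_minus abs_minus_cancel)
      qed
      finally show ?thesis by simp
    qed
    ultimately show ?thesis by simp
  qed
  have "(\<lambda>n. ennreal (real (Suc n) * (2 * r * \<bar>sin ((d / real (Suc n)) / 2)\<bar>))) \<longlonglongrightarrow> ennreal (r * \<bar>d\<bar>)"
    by (intro tendsto_ennrealI circle_subdivision_limit)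
  then have "ennreal (r * \<bar>d\<bar>) \<le> length_on ({0..1} \<inter> {..t}) p"
    by (rule LIMSEQ_le_const2) (use lower in blast)
  then show ?thesis using d by (simp add: d_def)
qed

theorem arc_length_integral_circle:
  assumes "\<rho> \<in> borel_measurable borel"
  shows "arc_length_integral \<rho> p = (\<integral>\<^sup>+s\<in>{a..b}. \<rho> (polar z0 \<sigma> (Complex r s)) * ennreal r \<partial>lborel)"
proof (rule arc_length_integral_eq[OF assms])
  fix t :: real assume t: "t \<in> {0..1}"
  have "dominating t = r * (\<theta> t - a)"
    unfolding dominating_def using t theta_in[OF t] by (simp add: LINT_const)
  then show "ennreal (dominating t) \<le> length_on ({0..1} \<inter> {..t}) p" using length_lower_bound[OF t] by simp
qed

end

text \<open>Away from either end of the interval the function is injective, hence monotone; the two pieces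
  overlap, so it increases on both, and the two end values differ.\<close>
lemma strict_mono_of_loop_free:
  fixes \<phi> :: "real \<Rightarrow> real"
  assumes cont: "continuous_on {0..1} \<phi>"
    and lf: "\<And>s t. s \<in> {0..1} \<Longrightarrow> t \<in> {0..1} \<Longrightarrow> \<phi> s = \<phi> t \<Longrightarrow> s = t \<or> s = 0 \<and> t = 1 \<or> s = 1 \<and> t = 0"
    and up: "\<phi> 0 < \<phi> (1/2)"
  shows "strict_mono_on {0..1} \<phi>"
proof -
  have sub: "continuous_on {x..y} \<phi>" if "0 \<le> x" "y \<le> 1" for x y
    using continuous_on_subset[OF cont] that by simp
  have inj1: "inj_on \<phi> {0..y}" if "y < 1" for y
  proof (rule inj_onI)
    fix s t assume "s \<in> {0..y}" "t \<in> {0..y}" "\<phi> s = \<phi> t"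
    then show "s = t" using lf[of s t] that by auto
  qed
  have inj2: "inj_on \<phi> {x..1}" if "0 < x" for x
  proof (rule inj_onI)
    fix s t assume "s \<in> {x..1}" "t \<in> {x..1}" "\<phi> s = \<phi> t"
    then show "s = t" using lf[of s t] that by auto
  qed
  \<comment> \<open>on \<open>{0..3/4}\<close> and on \<open>{1/2..1}\<close> the function is injective and hence monotone; the overlap forces the same direction on both\<close>
  have "\<phi> (1/2) < \<phi> (3/4)"
    using continuous_inj_imp_mono[of 0 "1/2" "3/4" \<phi>, OF _ _ sub inj1] up by auto
  moreover have "\<phi> (1/2) < \<phi> (3/4) \<and> \<phi> (3/4) < \<phi> 1 \<or> \<phi> 1 < \<phi> (3/4) \<and> \<phi> (3/4) < \<phi> (1/2)"
    using continuous_inj_imp_mono[of "1/2" "3/4" 1 \<phi>, OF _ _ sub inj2] by auto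
  ultimately have ends: "\<phi> 0 < \<phi> 1" using up by linarith
  have inj: "inj_on \<phi> {0..1}"
  proof (rule inj_onI)
    fix s t assume "s \<in> {0..1}" "t \<in> {0..1}" "\<phi> s = \<phi> t"
    then show "s = t" using lf[of s t] ends by auto
  qed
  have mid: "\<phi> 0 < \<phi> x \<and> \<phi> x < \<phi> 1" if "0 < x" "x < 1" for x
    using continuous_inj_imp_mono[of 0 x 1 \<phi>, OF that cont inj] ends by linarith
  show ?thesis
  proof (rule strict_mono_onI)
    fix u v :: real assume uv: "u \<in> {0..1}" "v \<in> {0..1}" "u < v"
    consider "u = 0" "v = 1" | "u = 0" "v < 1" | "0 < u" "v = 1" | "0 < u" "v < 1" using uv by fastforce
    then show "\<phi> u < \<phi> v"
    proof cases
      case 4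
      then have "\<phi> 0 < \<phi> u \<and> \<phi> u < \<phi> v \<or> \<phi> v < \<phi> u \<and> \<phi> u < \<phi> 0"
        using uv by (intro continuous_inj_imp_mono sub inj1) auto
      then show ?thesis using mid[of u] uv 4 by linarith
    qed (use mid[of u] mid[of v] ends uv in auto)
  qed
qed

text \<open>The angle is found by lifting through the exponential function.  It is injective up to the closing
  point, hence monotone, and \<open>\<sigma>\<close> is chosen so that it increases.\<close>
lemma simple_path_in_circle:
  assumes r: "r > 0" and p: "simple_path p" "path_image p \<subseteq> sphere z0 r"
  obtains \<sigma> \<theta> where "\<bar>\<sigma>\<bar> = 1" "continuous_on {0..1} \<theta>" "strict_mono_on {0..1} \<theta>"
    "\<And>t. t \<in> {0..1} \<Longrightarrow> p t = polar z0 \<sigma> (Complex r (\<theta> t))"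
proof -
  have norm: "cmod (p t - z0) = r" if "t \<in> {0..1}" for t
  proof -
    have "p t \<in> sphere z0 r" using p(2) that unfolding path_image_def by blast
    then show ?thesis by (simp add: dist_norm norm_minus_commute)
  qed
  have pcont: "continuous_on {0..1} p" using p(1) by (simp add: simple_path_def path_def)
  have c: "continuous_on {0..1} (\<lambda>t. (p t - z0) / of_real r)"
    using r by (intro continuous_intros pcont) auto
  have contr: "contractible {0..1::real}" by (rule convex_imp_contractible) simp
  have nz: "(p t - z0) / of_real r \<noteq> 0" if "t \<in> {0..1}" for t using norm[OF that] r by auto
  obtain g where g: "continuous_on {0..1} g" "\<And>t. t \<in> {0..1} \<Longrightarrow> (p t - z0) / of_real r = exp (g t)"
  proof (rule continuous_logarithm_on_contractible[OF c contr nz])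
    fix h assume h: "continuous_on {0..1} h" "\<And>t. t \<in> {0..1} \<Longrightarrow> (p t - z0) / of_real r = exp (h t)"
    show thesis by (rule that[OF h])
  qed
  define \<phi> where "\<phi> t = Im (g t)" for t
  have \<phi>c: "continuous_on {0..1} \<phi>" unfolding \<phi>_def[abs_def] by (intro continuous_intros g)
  have p_eq: "p t = z0 + of_real r * cis (\<phi> t)" if t: "t \<in> {0..1}" for t
  proof -
    have "exp (Re (g t)) = cmod ((p t - z0) / of_real r)" using g(2)[OF t] by simp
    also have "\<dots> = 1" using norm[OF t] r by (simp add: norm_divide)
    finally have "Re (g t) = 0" by simp
    then have "exp (g t) = cis (\<phi> t)" by (simp add: exp_eq_polar \<phi>_def)
    then show ?thesis using g(2)[OF t] r by (simp add: field_simps)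
  qed
  have lf: "s = t \<or> s = 0 \<and> t = 1 \<or> s = 1 \<and> t = 0" if "s \<in> {0..1}" "t \<in> {0..1}" "\<phi> s = \<phi> t" for s t
    using p(1) p_eq[OF that(1)] p_eq[OF that(2)] that unfolding simple_path_def loop_free_def by auto
  have "\<phi> 0 \<noteq> \<phi> (1/2)" using lf[of 0 "1/2"] by auto
  then consider "\<phi> 0 < \<phi> (1/2)" | "- \<phi> 0 < - \<phi> (1/2)" by linarith
  then show thesis
  proof cases
    case 1
    show thesis
    proof (rule that[of 1 \<phi>])
      show "strict_mono_on {0..1} \<phi>" by (rule strict_mono_of_loop_free[OF \<phi>c lf 1])
      show "p t = polar z0 1 (Complex r (\<phi> t))" if "t \<in> {0..1}" for t using p_eq[OF that] by (simp add: polar_def)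
    qed (simp_all add: \<phi>c)
  next
    case 2
    have c: "continuous_on {0..1} (\<lambda>t. - \<phi> t)" by (intro continuous_intros \<phi>c)
    have lf': "s = t \<or> s = 0 \<and> t = 1 \<or> s = 1 \<and> t = 0" if "s \<in> {0..1}" "t \<in> {0..1}" "- \<phi> s = - \<phi> t" for s t
      using lf[of s t] that by simp
    show thesis
    proof (rule that[of "-1" "\<lambda>t. - \<phi> t"])
      show "strict_mono_on {0..1} (\<lambda>t. - \<phi> t)" by (rule strict_mono_of_loop_free[OF c lf' 2])
      show "p t = polar z0 (-1) (Complex r (- \<phi> t))" if "t \<in> {0..1}" for t using p_eq[OF that] by (simp add: polar_def)
    qed (simp_all add: c)
  qed
qed

section \<open>Circles with radii in a null set\<close>

lemma arc_length_integral_le_dashed: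
  assumes "C \<in> components T" "simple_path p" "path_image p \<subseteq> C"
  shows "arc_length_integral \<rho> (\<gamma> \<circ> p) \<le> dashed_integral \<rho> (T, \<gamma>)"
proof -
  let ?s = "\<lambda>C. SUP p\<in>{p. simple_path p \<and> path_image p \<subseteq> C}. arc_length_integral \<rho> (\<gamma> \<circ> p)"
  have "arc_length_integral \<rho> (\<gamma> \<circ> p) \<le> ?s C" by (rule SUP_upper) (use assms in simp)
  also have "\<dots> = infsum ?s {C}" by simp
  also have "\<dots> \<le> infsum ?s (components T)"
    by (rule infsum_mono_neutral) (use assms in \<open>auto intro: nonneg_summable_on_complete\<close>)
  finally show ?thesis by (simp add: dashed_integral_def)
qed

lemma dashed_integral_mono:
  assumes "\<And>C p. C \<in> components T \<Longrightarrow> simple_path p \<Longrightarrow> path_image p \<subseteq> C \<Longrightarrow>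
    arc_length_integral \<rho> (\<gamma> \<circ> p) \<le> arc_length_integral \<rho>' (\<gamma>' \<circ> p)"
  shows "dashed_integral \<rho> (T, \<gamma>) \<le> dashed_integral \<rho>' (T, \<gamma>')"
  unfolding dashed_integral_def prod.case
  by (intro infsum_mono nonneg_summable_on_complete SUP_mono) (use assms in auto)

lemma modulus_mono: "\<Gamma> \<subseteq> \<Gamma>' \<Longrightarrow> modulus \<Gamma> \<le> modulus \<Gamma>'"
  unfolding modulus_def by (intro INF_superset_mono) (auto simp: adm_def)

text \<open>The set is contained in the image under polar coordinates, a differentiable map, of the null set of points with
  real part in \<open>N\<close>.\<close>
lemma null_set_of_radii:
  assumes N: "N \<in> null_sets lborel"
  shows "{z. cmod (z - z0) \<in> N} \<in> null_sets lborel"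
proof -
  have [measurable]: "N \<in> sets borel" using N by auto
  have "AE w in lborel. Re w \<notin> N"
  proof (rule AE_complex_iteratedI)
    have "AE s in lborel. s \<notin> N" by (rule AE_not_in[OF N])
    then show "AE s in lborel. AE t in lborel. Re (Complex s t) \<notin> N"
    proof (rule AE_mp, intro AE_I2)
      fix s show "s \<notin> N \<longrightarrow> (AE t in lborel. Re (Complex s t) \<notin> N)" by simp
    qed
  qed measurable
  then have "AE w in lborel. w \<notin> {w. Re w \<in> N}" by simp
  then have "{w. Re w \<in> N} \<in> null_sets lborel" by (subst AE_iff_null_sets) measurable
  then have "negligible {w. Re w \<in> N}" by (simp add: negligible_iff_null_sets null_sets_completionI)
  then have "negligible (polar z0 1 ` {w. Re w \<in> N})"
    by (rule negligible_differentiable_image_negligible[OF order_refl])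
       (auto simp: differentiable_on_def differentiable_def intro: has_derivative_polar)
  moreover have "{z. cmod (z - z0) \<in> N} \<subseteq> polar z0 1 ` {w. Re w \<in> N}"
  proof
    fix z assume z: "z \<in> {z. cmod (z - z0) \<in> N}"
    have "polar z0 1 (Complex (cmod (z - z0)) (Arg (z - z0))) = z"
      using rcis_cmod_Arg[of "z - z0"] by (simp add: polar_def rcis_def)
    then show "z \<in> polar z0 1 ` {w. Re w \<in> N}" using z by (intro image_eqI[of _ _ "Complex (cmod (z - z0)) (Arg (z - z0))"]) auto
  qed
  ultimately have "negligible {z. cmod (z - z0) \<in> N}" by (rule negligible_subset)
  then have "AE z in lebesgue. z \<notin> {z. cmod (z - z0) \<in> N}"
    by (intro AE_not_in) (simp add: negligible_iff_null_sets)
  then have "AE z in lborel. z \<notin> {z. cmod (z - z0) \<in> N}" by (simp only: AE_completion_iff)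
  then show ?thesis by (subst AE_iff_null_sets) measurable
qed

text \<open>The density that is infinite on the circles and zero elsewhere vanishes almost everywhere.  It is
  admissible because each circle meets \<open>D\<close> in a relatively open set, which contains an arc of
  positive length.\<close>
lemma modulus_null_radii:
  assumes D: "open D" and N: "N \<in> null_sets lborel" and pos: "\<And>r. r \<in> N' \<Longrightarrow> r \<in> N \<and> r > 0 \<and> sphere z0 r \<inter> D \<noteq> {}"
  shows "modulus ((\<lambda>r. (sphere z0 r \<inter> D, id)) ` N') = 0"
proof -
  define \<rho> :: "complex \<Rightarrow> ennreal" where "\<rho> = (\<lambda>z. top * indicator {z. cmod (z - z0) \<in> N} z)"
  note null = null_set_of_radii[OF N, of z0]
  have [measurable]: "{z. cmod (z - z0) \<in> N} \<in> sets borel" using null by auto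
  have [measurable]: "\<rho> \<in> borel_measurable borel" unfolding \<rho>_def by measurable
  have "1 \<le> dashed_integral \<rho> (sphere z0 r \<inter> D, id)" if "r \<in> N'" for r
  proof -
    have rN: "r \<in> N" and r: "r > 0" "sphere z0 r \<inter> D \<noteq> {}" using pos[OF that] by auto
    then obtain z where z: "z \<in> sphere z0 r" "z \<in> D" by blast
    define \<alpha> where "\<alpha> = Arg (z - z0)"
    have z_eq: "polar z0 1 (Complex r \<alpha>) = z"
      using rcis_cmod_Arg[of "z - z0"] z(1) by (simp add: polar_def rcis_def \<alpha>_def dist_norm norm_minus_commute)
    have "open ((\<lambda>t. polar z0 1 (Complex r t)) -` D)"
      by (rule open_vimage[OF D], rule continuous_on_compose2[OF continuous_on_polar(1)[of UNIV] continuous_on_Complex_vertical]) simp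
    then obtain e where e: "e > 0" "\<And>t. dist t \<alpha> < e \<Longrightarrow> polar z0 1 (Complex r t) \<in> D"
      using z_eq z(2) unfolding open_dist by (auto simp: vimage_def)
    define \<delta> where "\<delta> = min (e / 2) 1"
    have \<delta>: "0 < \<delta>" "\<delta> < e" "\<delta> \<le> 1" using e by (auto simp: \<delta>_def)
    define \<theta> where "\<theta> t = \<alpha> + \<delta> * t" for t
    define p where "p t = polar z0 1 (Complex r (\<theta> t))" for t
    interpret circular_path \<theta> \<alpha> "\<alpha> + \<delta>" z0 1 r p
      by unfold_locales (use r \<delta> in \<open>auto simp: \<theta>_def p_def intro!: continuous_intros strict_mono_onI\<close>)
    have inD: "p t \<in> D" if "t \<in> {0..1}" for t
      unfolding p_def
    proof (rule e(2))
      have "\<delta> * t \<le> \<delta> * 1" using that \<delta> by (intro mult_left_mono) auto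
      moreover have "dist (\<theta> t) \<alpha> = \<delta> * t" using that \<delta> by (simp add: \<theta>_def dist_real_def abs_mult)
      ultimately show "dist (\<theta> t) \<alpha> < e" using \<delta> by linarith
    qed
    have "path p"
      unfolding path_def p_def
      by (rule continuous_on_compose2[OF continuous_on_circle[of UNIV] cont]) simp
    moreover have "p s = p t \<Longrightarrow> s = t" if "s \<in> {0..1}" "t \<in> {0..1}" for s t
    proof -
      assume "p s = p t"
      moreover have "inj_on (polar z0 1) (cbox (Complex r \<alpha>) (Complex r (\<alpha> + \<delta>)))"
        by (rule inj_on_polar) (use r \<delta> pi_gt3 in auto)
      moreover have "Complex r (\<theta> u) \<in> cbox (Complex r \<alpha>) (Complex r (\<alpha> + \<delta>))" if "u \<in> {0..1}" for u
        using theta_in[OF that] by (simp add: in_cbox_complex_iff)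
      ultimately have "Complex r (\<theta> s) = Complex r (\<theta> t)"
        using that unfolding p_def inj_on_def by blast
      then show "s = t" using \<delta> by (simp add: \<theta>_def)
    qed
    ultimately have sp: "simple_path p" unfolding simple_path_def loop_free_def by blast
    have on_sphere: "p t \<in> sphere z0 r" for t
      using r by (simp add: p_def polar_def dist_norm norm_mult)
    have sub: "path_image p \<subseteq> sphere z0 r \<inter> D"
      using inD on_sphere unfolding path_image_def by blast
    have zp: "p 0 = z" using z_eq by (simp add: p_def \<theta>_def)
    define C where "C = connected_component_set (sphere z0 r \<inter> D) z"
    have C: "C \<in> components (sphere z0 r \<inter> D)" unfolding C_def by (rule componentsI) (use z in auto)
    have pC: "path_image p \<subseteq> C"
      unfolding C_def
    proof (rule connected_component_maximal)
      show "z \<in> path_image p" using zp unfolding path_image_def by force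
      show "connected (path_image p)" by (rule connected_path_image) fact
    qed (rule sub)
    have "arc_length_integral \<rho> p = (\<integral>\<^sup>+s\<in>{\<alpha>..\<alpha> + \<delta>}. \<rho> (polar z0 1 (Complex r s)) * ennreal r \<partial>lborel)"
      by (rule arc_length_integral_circle) measurable
    also have "\<dots> = (\<integral>\<^sup>+s. top * indicator {\<alpha>..\<alpha> + \<delta>} s \<partial>lborel)"
    proof (intro nn_integral_cong)
      fix s
      have "cmod (polar z0 1 (Complex r s) - z0) = r" using r by (simp add: polar_def norm_mult)
      then have "\<rho> (polar z0 1 (Complex r s)) = top" using rN by (simp add: \<rho>_def)
      then show "\<rho> (polar z0 1 (Complex r s)) * ennreal r * indicator {\<alpha>..\<alpha> + \<delta>} s = top * indicator {\<alpha>..\<alpha> + \<delta>} s"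
        using r by (simp add: ennreal_top_mult)
    qed
    also have "\<dots> = top * ennreal \<delta>" using \<delta> by (simp add: nn_integral_cmult)
    also have "\<dots> = top" using \<delta> by (simp add: ennreal_top_mult)
    finally have "top \<le> dashed_integral \<rho> (sphere z0 r \<inter> D, id)"
      using arc_length_integral_le_dashed[OF C sp pC, of \<rho> id] by simp
    then show ?thesis by (simp add: top_unique)
  qed
  then have "\<rho> \<in> adm ((\<lambda>r. (sphere z0 r \<inter> D, id)) ` N')" by (auto simp: adm_def)
  then have "modulus ((\<lambda>r. (sphere z0 r \<inter> D, id)) ` N') \<le> (\<integral>\<^sup>+z. (\<rho> z)\<^sup>2 \<partial>lborel)"
    unfolding modulus_def by (rule INF_lower)
  also have "\<dots> = (\<integral>\<^sup>+z. 0 \<partial>(lborel::complex measure))"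
    by (rule nn_integral_cong_AE, rule AE_mp[OF AE_not_in[OF null]], intro AE_I2) (simp add: \<rho>_def)
  finally show ?thesis by simp
qed

section \<open>The pulled back density\<close>

context weakly_differentiable
begin

text \<open>The direction \<open>\<i> * sgn (z - z0)\<close> is the unit tangent at \<open>z\<close> of the circle about \<open>z0\<close>.\<close>
definition pullback_density :: "complex \<Rightarrow> (complex \<Rightarrow> ennreal) \<Rightarrow> complex \<Rightarrow> ennreal" where
  "pullback_density z0 \<rho> z = \<rho> (F z) * ennreal (cmod (dir_deriv (\<i> * sgn (z - z0)) z)) * indicator D z"

lemma measurable_pullback_density [measurable]:
  assumes [measurable]: "\<rho> \<in> borel_measurable borel"
  shows "pullback_density z0 \<rho> \<in> borel_measurable borel"
  unfolding pullback_density_def[abs_def] dir_deriv_def sgn_div_norm by measurable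

lemma tangential_derivative:
  assumes \<sigma>: "\<bar>\<sigma>\<bar> = 1" and r: "r > 0" and z: "z = polar z0 \<sigma> (Complex r t)"
  shows "cmod (dir_deriv (polar_deriv \<sigma> (Complex r t)) z) = cmod (dir_deriv (\<i> * sgn (z - z0)) z) * r"
proof -
  have "z - z0 = of_real r * cis (\<sigma> * t)" using z by (simp add: polar_def)
  then have s: "sgn (z - z0) = cis (\<sigma> * t)" using r by (simp add: sgn_mult sgn_of_real)
  have lin: "dir_deriv (of_real c * v) z = c *\<^sub>R dir_deriv v z" for c v
    by (simp add: dir_deriv_def scaleR_add_right)
  show ?thesis
    unfolding s polar_deriv_def complex.sel lin using \<sigma> r by (simp add: abs_mult)
qed

text \<open>In the angular parameter the image path has chords dominated by the integral of the derivative,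
  while on the circle arc length is exactly \<open>r\<close> times the angle; the factor \<open>r\<close> turns the
  angular derivative into the tangential one.\<close>
lemma arc_length_integral_pullback:
  assumes [measurable]: "\<rho> \<in> borel_measurable borel" and r: "r > 0"
    and good: "\<And>\<sigma> a b. \<lbrakk>\<bar>\<sigma>\<bar> = 1; a \<le> b; \<And>t. t \<in> {a..b} \<Longrightarrow> polar z0 \<sigma> (Complex r t) \<in> D\<rbrakk> \<Longrightarrow>
      indefinite_integral_on (\<lambda>t. F (polar z0 \<sigma> (Complex r t)))
       (\<lambda>t. dir_deriv (polar_deriv \<sigma> (Complex r t)) (polar z0 \<sigma> (Complex r t))) a b"
    and p: "simple_path p" "path_image p \<subseteq> sphere z0 r \<inter> D" and f: "\<And>z. z \<in> D \<Longrightarrow> f z = F z"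
  shows "arc_length_integral \<rho> (f \<circ> p) \<le> arc_length_integral (pullback_density z0 \<rho>) p"
proof -
  obtain \<sigma> \<theta> where \<sigma>: "\<bar>\<sigma>\<bar> = 1" and \<theta>: "continuous_on {0..1} \<theta>" "strict_mono_on {0..1} \<theta>"
    and p_eq: "\<And>t. t \<in> {0..1} \<Longrightarrow> p t = polar z0 \<sigma> (Complex r (\<theta> t))"
    using simple_path_in_circle[OF r p(1), of z0] p(2) by blast
  define a b where "a = \<theta> 0" and "b = \<theta> 1"
  interpret C: circular_path \<theta> a b z0 \<sigma> r p
    by unfold_locales (use \<theta> \<sigma> r p_eq in \<open>auto simp: a_def b_def\<close>)
  let ?c = "\<lambda>s. polar z0 \<sigma> (Complex r s)"
  let ?d = "\<lambda>s. dir_deriv (polar_deriv \<sigma> (Complex r s)) (?c s)"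
  have pD: "p t \<in> D" if "t \<in> {0..1}" for t using p(2) that unfolding path_image_def by blast
  have cD: "?c s \<in> D" if "s \<in> {a..b}" for s
    using pD[OF C.inverse_param_in[OF that]] p_eq[OF C.inverse_param_in[OF that]] C.theta_inverse_param[OF that] by simp
  have ind: "indefinite_integral_on (\<lambda>t. F (?c t)) ?d a b"
    by (rule good[OF \<sigma> less_imp_le[OF C.a_less_b] cD])
  have [measurable]: "?c \<in> borel_measurable borel"
    by (intro borel_measurable_continuous_onI C.continuous_on_circle)
  have [measurable]: "(\<lambda>s. polar_deriv \<sigma> (Complex r s)) \<in> borel_measurable borel"
    by (intro borel_measurable_continuous_onI
        continuous_on_compose2[OF continuous_on_polar(2)[of UNIV] continuous_on_Complex_vertical]) simp
  interpret E: dominated_path \<theta> a b "\<lambda>s. F (?c s)" "f \<circ> p" "\<lambda>s. cmod (?d s)"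
  proof
    show "continuous_on {a..b} (\<lambda>s. F (?c s))"
      by (rule continuous_on_compose2[OF cont C.continuous_on_circle]) (use cD in auto)
    show "(f \<circ> p) t = F (?c (\<theta> t))" if "t \<in> {0..1}" for t
      using f[OF pD[OF that]] p_eq[OF that] by simp
    show "(\<lambda>s. cmod (?d s)) \<in> borel_measurable borel" unfolding dir_deriv_def by measurable
    show "set_integrable lborel {a..b} (\<lambda>s. cmod (?d s))"
      using ind unfolding indefinite_integral_on_def by (intro set_integrable_norm) blast
    fix u v assume uv: "a \<le> u" "u \<le> v" "v \<le> b"
    have eq: "F (?c v) - F (?c u) = (LINT t:{u..v}|lborel. ?d t)" and int: "set_integrable lborel {a..b} ?d"
      using ind uv unfolding indefinite_integral_on_def by blast+
    have "set_integrable lborel {u..v} ?d" by (rule set_integrable_subset[OF int]) (use uv in auto)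
    then have "cmod (LINT t:{u..v}|lborel. ?d t) \<le> (LINT t:{u..v}|lborel. cmod (?d t))"
      by (rule set_integral_norm_bound)
    then show "dist (F (?c u)) (F (?c v)) \<le> (LINT t:{u..v}|lborel. cmod (?d t))"
      unfolding eq[symmetric] by (simp add: dist_norm norm_minus_commute)
  qed simp
  have "arc_length_integral \<rho> (f \<circ> p) \<le> (\<integral>\<^sup>+s\<in>{a..b}. \<rho> (F (?c s)) * ennreal (cmod (?d s)) \<partial>lborel)"
    by (rule E.arc_length_integral_le) measurable
  also have "\<dots> = (\<integral>\<^sup>+s\<in>{a..b}. pullback_density z0 \<rho> (?c s) * ennreal r \<partial>lborel)"
  proof (intro nn_integral_cong)
    fix s
    show "\<rho> (F (?c s)) * ennreal (cmod (?d s)) * indicator {a..b} s = pullback_density z0 \<rho> (?c s) * ennreal r * indicator {a..b} s"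
    proof (cases "s \<in> {a..b}")
      case True
      then show ?thesis
        using cD[OF True] r by (simp add: pullback_density_def tangential_derivative[OF \<sigma> r refl] ennreal_mult mult.assoc)
    qed simp
  qed
  also have "\<dots> = arc_length_integral (pullback_density z0 \<rho>) p"
    by (rule C.arc_length_integral_circle[symmetric]) measurable
  finally show ?thesis .
qed

text \<open>The circles on which absolute continuity may fail, in either orientation, have radii in a null set
  and form a family of modulus zero; on all others the line integrals are compared path by path.\<close>
lemma pullback_density_ext_adm:
  assumes \<rho>: "\<rho> \<in> adm (image_family f (circle_family D z0 \<epsilon> \<epsilon>0))" and f: "\<And>z. z \<in> D \<Longrightarrow> f z = F z"
    and \<epsilon>: "0 < \<epsilon>" and meets: "\<And>r. \<epsilon> < r \<Longrightarrow> r < \<epsilon>0 \<Longrightarrow> sphere z0 r \<inter> D \<noteq> {}"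
  shows "pullback_density z0 \<rho> \<in> ext_adm (circle_family D z0 \<epsilon> \<epsilon>0)"
proof -
  have [measurable]: "\<rho> \<in> borel_measurable borel" using \<rho> by (simp add: adm_def)
  define good where "good \<sigma> r \<longleftrightarrow> (\<forall>a b. a \<le> b \<longrightarrow> (\<forall>t\<in>{a..b}. polar z0 \<sigma> (Complex r t) \<in> D) \<longrightarrow>
    indefinite_integral_on (\<lambda>t. F (polar z0 \<sigma> (Complex r t)))
     (\<lambda>t. dir_deriv (polar_deriv \<sigma> (Complex r t)) (polar z0 \<sigma> (Complex r t))) a b)" for \<sigma> r
  have "AE r in lborel. r > 0 \<longrightarrow> good 1 r" "AE r in lborel. r > 0 \<longrightarrow> good (-1) r"
    using absolutely_continuous_on_almost_every_circle[of 1 z0] absolutely_continuous_on_almost_every_circle[of "-1" z0]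
    by (simp_all add: good_def)
  from AE_conjI[OF this] obtain N where N: "N \<in> null_sets lborel"
    "{r. \<not> ((r > 0 \<longrightarrow> good 1 r) \<and> (r > 0 \<longrightarrow> good (-1) r))} \<subseteq> N"
    by (elim AE_E) (auto simp: null_sets_def)
  have *: "1 \<le> dashed_integral (pullback_density z0 \<rho>) (sphere z0 r \<inter> D, id)" if r: "\<epsilon> < r" "r < \<epsilon>0" "r \<notin> N" for r
  proof -
    have r0: "r > 0" using r \<epsilon> by simp
    have g: "good 1 r" "good (-1) r" using N(2) r(3) r0 by blast+
    have "1 \<le> dashed_integral \<rho> (sphere z0 r \<inter> D, f \<circ> id)"
    proof -
      have "(sphere z0 r \<inter> D, f \<circ> id) \<in> image_family f (circle_family D z0 \<epsilon> \<epsilon>0)"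
        using r unfolding image_family_def circle_family_def by (intro image_eqI[of _ _ "(sphere z0 r \<inter> D, id)"]) auto
      then show ?thesis using \<rho> by (simp add: adm_def)
    qed
    also have "\<dots> \<le> dashed_integral (pullback_density z0 \<rho>) (sphere z0 r \<inter> D, id)"
    proof (rule dashed_integral_mono)
      fix C p assume C: "C \<in> components (sphere z0 r \<inter> D)" and p: "simple_path p" "path_image p \<subseteq> C"
      have sub: "path_image p \<subseteq> sphere z0 r \<inter> D" using in_components_subset[OF C] p(2) by blast
      have "arc_length_integral \<rho> (f \<circ> p) \<le> arc_length_integral (pullback_density z0 \<rho>) p"
      proof (rule arc_length_integral_pullback[OF _ r0 _ p(1) sub f])
        fix \<sigma> a b :: real
        assume \<sigma>: "\<bar>\<sigma>\<bar> = 1" and ab: "a \<le> b" and inD: "\<And>t. t \<in> {a..b} \<Longrightarrow> polar z0 \<sigma> (Complex r t) \<in> D"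
        have "\<sigma> = 1 \<or> \<sigma> = -1" using \<sigma> by linarith
        then have "good \<sigma> r" using g by blast
        then show "indefinite_integral_on (\<lambda>t. F (polar z0 \<sigma> (Complex r t)))
           (\<lambda>t. dir_deriv (polar_deriv \<sigma> (Complex r t)) (polar z0 \<sigma> (Complex r t))) a b"
          using ab inD unfolding good_def by blast
      qed simp_all
      then show "arc_length_integral \<rho> (f \<circ> id \<circ> p) \<le> arc_length_integral (pullback_density z0 \<rho>) (id \<circ> p)"
        by (simp only: comp_id id_comp)
    qed
    finally show ?thesis .
  qed
  have "{\<gamma> \<in> circle_family D z0 \<epsilon> \<epsilon>0. \<not> 1 \<le> dashed_integral (pullback_density z0 \<rho>) \<gamma>}
      \<subseteq> (\<lambda>r. (sphere z0 r \<inter> D, id)) ` (N \<inter> {\<epsilon><..<\<epsilon>0})"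
  proof (intro subsetI)
    fix \<gamma> assume "\<gamma> \<in> {\<gamma> \<in> circle_family D z0 \<epsilon> \<epsilon>0. \<not> 1 \<le> dashed_integral (pullback_density z0 \<rho>) \<gamma>}"
    then obtain r where "\<epsilon> < r" "r < \<epsilon>0" "\<gamma> = (sphere z0 r \<inter> D, id)"
      "\<not> 1 \<le> dashed_integral (pullback_density z0 \<rho>) (sphere z0 r \<inter> D, id)"
      by (auto simp: circle_family_def)
    moreover from this have "r \<in> N" using *[of r] by blast
    ultimately show "\<gamma> \<in> (\<lambda>r. (sphere z0 r \<inter> D, id)) ` (N \<inter> {\<epsilon><..<\<epsilon>0})" by simp
  qed
  then have "modulus {\<gamma> \<in> circle_family D z0 \<epsilon> \<epsilon>0. \<not> 1 \<le> dashed_integral (pullback_density z0 \<rho>) \<gamma>}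
      \<le> modulus ((\<lambda>r. (sphere z0 r \<inter> D, id)) ` (N \<inter> {\<epsilon><..<\<epsilon>0}))"
    by (rule modulus_mono)
  also have "\<dots> = 0"
    by (rule modulus_null_radii[OF open_D N(1)]) (use \<epsilon> meets in auto)
  finally have "almost_every (circle_family D z0 \<epsilon> \<epsilon>0) (\<lambda>\<gamma>. 1 \<le> dashed_integral (pullback_density z0 \<rho>) \<gamma>)"
    by (simp add: almost_every_def)
  moreover have "pullback_density z0 \<rho> \<in> borel_measurable lebesgue"
    by (rule measurable_completion) simp
  ultimately show ?thesis by (simp add: ext_adm_def)
qed

end

section \<open>Solutions of the Beltrami equation\<close>

lemma completion_ex_borel_measurable_complex:
  fixes g :: "'a \<Rightarrow> complex"
  assumes g: "g \<in> borel_measurable (completion M)"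
  obtains g' where "g' \<in> borel_measurable M" "AE x in M. g x = g' x"
proof -
  obtain u where u: "u \<in> borel_measurable M" "AE x in M. Re (g x) = u x"
    using completion_ex_borel_measurable_real[of "\<lambda>x. Re (g x)" M] g by auto
  obtain v where v: "v \<in> borel_measurable M" "AE x in M. Im (g x) = v x"
    using completion_ex_borel_measurable_real[of "\<lambda>x. Im (g x)" M] g by auto
  have "AE x in M. g x = Complex (u x) (v x)"
    by (rule AE_mp[OF AE_conjI[OF u(2) v(2)]], intro AE_I2) (simp add: complex_eq_iff)
  moreover have "(\<lambda>x. Complex (u x) (v x)) \<in> borel_measurable M" using u v by measurable
  ultimately show thesis using that by blast
qed

lemma L1_loc_measurable:
  assumes "open D" "L1_loc D g"
  shows "(\<lambda>z. indicator D z *\<^sub>R g z) \<in> borel_measurable lebesgue"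
proof -
  obtain C where C: "\<And>n. compact (C n)" "\<And>n. C n \<subseteq> D" "\<And>n. C n \<subseteq> interior (C (Suc n))" "\<Union>(range C) = D"
    using open_Union_compact_subsets[OF assms(1)] by metis
  have mono: "C m \<subseteq> C n" if "m \<le> n" for m n
    by (rule lift_Suc_mono_le[OF _ that]) (use C(3) interior_subset in blast)
  show ?thesis
  proof (rule borel_measurable_LIMSEQ_metric)
    show "(\<lambda>z. indicator (C n) z *\<^sub>R g z) \<in> borel_measurable lebesgue" for n
      using assms(2) C(1,2) unfolding L1_loc_def set_integrable_def by (intro borel_measurable_integrable) blast
    fix z
    show "(\<lambda>n. indicator (C n) z *\<^sub>R g z) \<longlonglongrightarrow> indicator D z *\<^sub>R g z"
    proof (cases "z \<in> D")
      case True
      then obtain m where m: "z \<in> C m" using C(4) by blast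
      have "\<forall>\<^sub>F n in sequentially. indicator (C n) z *\<^sub>R g z = indicator D z *\<^sub>R g z"
        unfolding eventually_sequentially using subsetD[OF mono m] True by (intro exI[of _ m]) simp
      then show ?thesis by (rule tendsto_eventually)
    next
      case False
      then have "z \<notin> C n" for n using C(2) by blast
      then show ?thesis using False by simp
    qed
  qed
qed

text \<open>Values on a single curve depend on the representative, and integrals along curves refer to Borel
  measures; so a Lebesgue measurable weak derivative is first replaced by a Borel function.\<close>
lemma Borel_representative:
  assumes D: "open D" and g: "L1_loc D g"
  obtains g' where "g' \<in> borel_measurable borel" "AE z in lborel. z \<in> D \<longrightarrow> g z = g' z"
    "\<And>K. compact K \<Longrightarrow> K \<subseteq> D \<Longrightarrow> set_integrable lborel K g'"
proof -
  obtain g' where g': "g' \<in> borel_measurable lborel" "AE z in lborel. indicator D z *\<^sub>R g z = g' z"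
    using completion_ex_borel_measurable_complex[OF L1_loc_measurable[OF D g]] by blast
  have ae: "AE z in lborel. z \<in> D \<longrightarrow> g z = g' z"
    by (rule AE_mp[OF g'(2)], intro AE_I2) auto
  have "set_integrable lborel K g'" if K: "compact K" "K \<subseteq> D" for K
  proof -
    have [measurable]: "K \<in> sets borel" using K by (simp add: borel_compact)
    have [measurable]: "g' \<in> borel_measurable borel" using g'(1) by simp
    have m: "(\<lambda>z. indicator K z *\<^sub>R g' z) \<in> borel_measurable lborel" by measurable
    have "integrable lebesgue (\<lambda>z. indicator K z *\<^sub>R g z)" using g K by (simp add: L1_loc_def set_integrable_def)
    moreover have "AE z in lebesgue. indicator K z *\<^sub>R g z = indicator K z *\<^sub>R g' z"
      unfolding AE_completion_iff by (rule AE_mp[OF ae], intro AE_I2) (use K in \<open>auto simp: indicator_def\<close>)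
    ultimately have "integrable lebesgue (\<lambda>z. indicator K z *\<^sub>R g' z)"
      using integrable_cong_AE_imp[of lebesgue "\<lambda>z. indicator K z *\<^sub>R g z" "\<lambda>z. indicator K z *\<^sub>R g' z"] measurable_completion[OF m]
      by (auto elim: AE_mp)
    then show ?thesis using m by (simp add: set_integrable_def integrable_completion)
  qed
  with g'(1) ae show thesis using that by simp
qed

lemma test_functionD:
  assumes "test_function D \<phi>"
  shows "continuous_on UNIV \<phi>" "continuous_on UNIV (\<lambda>z. frechet_derivative \<phi> (at z) 1)"
    "continuous_on UNIV (\<lambda>z. frechet_derivative \<phi> (at z) \<i>)" "z \<notin> D \<Longrightarrow> \<phi> z = 0"
proof -
  have c: "C_k k \<phi>" for k using assms by (simp add: test_function_def)
  show "continuous_on UNIV \<phi>" "continuous_on UNIV (\<lambda>z. frechet_derivative \<phi> (at z) 1)"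
    "continuous_on UNIV (\<lambda>z. frechet_derivative \<phi> (at z) \<i>)" using c[of 0] c[of "Suc 0"] by auto
  show "\<phi> z = 0" if "z \<notin> D"
    using assms that closure_subset[of "{z. \<phi> z \<noteq> 0}"] unfolding test_function_def by auto
qed

lemma weak_derivative_lborel:
  assumes D: "open D" and w: "weak_derivative D v f g" and f: "continuous_on D f"
    and g' [measurable]: "g' \<in> borel_measurable borel" and ae: "AE z in lborel. z \<in> D \<longrightarrow> g z = g' z" and \<phi>: "test_function D \<phi>" and v: "v \<in> {1, \<i>}"
  shows "(\<integral>z. frechet_derivative \<phi> (at z) v *\<^sub>R (if z \<in> D then f z else 0) \<partial>lborel) = - (\<integral>z. \<phi> z *\<^sub>R g' z \<partial>lborel)"
proof -
  have Dl: "D \<inter> space lebesgue \<in> sets lebesgue" using D by simp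
  have [measurable]: "D \<in> sets borel" using D by simp
  have [measurable]: "(\<lambda>z. if z \<in> D then f z else 0) \<in> borel_measurable borel"
    by (rule borel_measurable_continuous_on_if) (auto intro: f)
  have [measurable]: "\<phi> \<in> borel_measurable borel" "(\<lambda>z. frechet_derivative \<phi> (at z) v) \<in> borel_measurable borel"
    using test_functionD(1-3)[OF \<phi>] v by (auto intro: borel_measurable_continuous_onI)
  have "(\<integral>z. frechet_derivative \<phi> (at z) v *\<^sub>R (if z \<in> D then f z else 0) \<partial>lborel)
     = (\<integral>z. frechet_derivative \<phi> (at z) v *\<^sub>R (if z \<in> D then f z else 0) \<partial>lebesgue)"
    by (rule integral_completion[symmetric]) measurable
  also have "\<dots> = (\<integral>z. frechet_derivative \<phi> (at z) v *\<^sub>R f z \<partial>lebesgue_on D)"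
    by (subst integral_restrict_space[OF Dl]) (intro Bochner_Integration.integral_cong, auto simp: indicator_def)
  also have "\<dots> = - (\<integral>z. \<phi> z *\<^sub>R g z \<partial>lebesgue_on D)"
    using w \<phi> by (simp add: weak_derivative_def)
  also have "(\<integral>z. \<phi> z *\<^sub>R g z \<partial>lebesgue_on D) = (\<integral>z. indicator D z *\<^sub>R \<phi> z *\<^sub>R g z \<partial>lebesgue)"
    by (rule integral_restrict_space[OF Dl])
  also have "\<dots> = (\<integral>z. \<phi> z *\<^sub>R g' z \<partial>lebesgue)"
  proof -
    have e: "AE z in lebesgue. indicator D z *\<^sub>R \<phi> z *\<^sub>R g z = \<phi> z *\<^sub>R g' z"
      unfolding AE_completion_iff
      by (rule AE_mp[OF ae], intro AE_I2) (use test_functionD(4)[OF \<phi>] in \<open>auto simp: indicator_def\<close>)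
    have m: "(\<lambda>z. \<phi> z *\<^sub>R g' z) \<in> borel_measurable lebesgue" by (rule measurable_completion) measurable
    have "(\<lambda>z. indicator D z *\<^sub>R \<phi> z *\<^sub>R g z) \<in> borel_measurable lebesgue"
      by (rule borel_measurable_AE[OF m]) (use e in \<open>auto elim: AE_mp\<close>)
    then show ?thesis using m e by (rule integral_cong_AE)
  qed
  also have "\<dots> = (\<integral>z. \<phi> z *\<^sub>R g' z \<partial>lborel)" by (rule integral_completion) measurable
  finally show ?thesis .
qed

text \<open>Write \<open>P\<close> for \<open>f_z\<close> and \<open>m * P\<close> for \<open>f_zbar\<close>, and let \<open>u\<close> be the direction of \<open>z - z0\<close>.  The
  derivative in the tangential direction \<open>\<i> * u\<close> is \<open>\<i> * (u * P - cnj u * (m * P))\<close>, and the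
  Jacobian is the difference of the squared moduli of \<open>P\<close> and \<open>m * P\<close>; the factor relating them is
  the tangent dilatation.\<close>
lemma tangential_derivative_squared:
  fixes X Y m z z0 :: complex
  assumes z: "z \<noteq> z0" and m: "cmod m < 1" and beltrami: "(X + \<i> * Y) / 2 = m * ((X - \<i> * Y) / 2)"
  defines "v \<equiv> \<i> * sgn (z - z0)"
  shows "(cmod (Re v *\<^sub>R X + Im v *\<^sub>R Y))\<^sup>2 = \<bar>Re X * Im Y - Im X * Re Y\<bar> * ((cmod (1 - cnj (z - z0) / (z - z0) * m))\<^sup>2 / (1 - (cmod m)\<^sup>2))"
    "0 < (cmod (1 - cnj (z - z0) / (z - z0) * m))\<^sup>2 / (1 - (cmod m)\<^sup>2)"
proof -
  define P where "P = (X - \<i> * Y) / 2"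
  define u where "u = sgn (z - z0)"
  have u: "cmod u = 1" using z by (simp add: u_def norm_sgn)
  then have u0: "u \<noteq> 0" by auto
  have Q: "(X + \<i> * Y) / 2 = m * P" using beltrami unfolding P_def .
  have X: "X = P + m * P" unfolding Q[symmetric] unfolding P_def by (simp add: field_simps)
  have Y: "Y = \<i> * (P - m * P)" unfolding Q[symmetric] unfolding P_def by (simp add: field_simps)
  have quot: "cnj (z - z0) / (z - z0) = cnj u / u"
    using z by (simp add: u_def sgn_div_norm scaleR_conv_of_real field_simps)
  have m1: "0 < 1 - (cmod m)\<^sup>2" using m by (simp add: power_less_one_iff)
  have "Re v *\<^sub>R X + Im v *\<^sub>R Y = \<i> * (u * P - cnj u * (m * P))"
    unfolding v_def u_def[symmetric] X Y by (simp add: complex_eq_iff algebra_simps)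
  also have "\<dots> = \<i> * u * P * (1 - cnj u / u * m)" using u0 by (simp add: field_simps)
  finally have "cmod (Re v *\<^sub>R X + Im v *\<^sub>R Y) = cmod P * cmod (1 - cnj u / u * m)"
    by (simp add: norm_mult u)
  then have 1: "(cmod (Re v *\<^sub>R X + Im v *\<^sub>R Y))\<^sup>2 = (cmod P)\<^sup>2 * (cmod (1 - cnj u / u * m))\<^sup>2"
    by (simp add: power_mult_distrib)
  have "Re X * Im Y - Im X * Re Y = (cmod P)\<^sup>2 - (cmod (m * P))\<^sup>2"
    unfolding X Y by (simp only: cmod_power2) (simp add: power2_eq_square algebra_simps)
  also have "\<dots> = (cmod P)\<^sup>2 * (1 - (cmod m)\<^sup>2)" by (simp add: norm_mult power_mult_distrib algebra_simps)
  finally have 2: "\<bar>Re X * Im Y - Im X * Re Y\<bar> = (cmod P)\<^sup>2 * (1 - (cmod m)\<^sup>2)" using m1 by simp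
  show "(cmod (Re v *\<^sub>R X + Im v *\<^sub>R Y))\<^sup>2 = \<bar>Re X * Im Y - Im X * Re Y\<bar> * ((cmod (1 - cnj (z - z0) / (z - z0) * m))\<^sup>2 / (1 - (cmod m)\<^sup>2))"
    unfolding 1 2 quot using m1 by simp
  have "cmod (cnj u / u * m) < 1" using u m by (simp add: norm_mult norm_divide)
  then have "1 - cnj u / u * m \<noteq> 0" by auto
  then show "0 < (cmod (1 - cnj (z - z0) / (z - z0) * m))\<^sup>2 / (1 - (cmod m)\<^sup>2)"
    unfolding quot using m1 by simp
qed

text \<open>The distance to \<open>z0\<close> takes values below \<open>r\<close> and above \<open>r\<close> on the connected set \<open>D\<close>.\<close>
lemma circle_meets_domain:
  assumes "connected D" "z0 \<in> closure D" "ereal \<epsilon>0 < (SUP z\<in>D. ereal (cmod (z - z0)))" "0 < r" "r < \<epsilon>0"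
  shows "sphere z0 r \<inter> D \<noteq> {}"
proof -
  obtain z where z: "z \<in> D" "\<epsilon>0 < cmod (z - z0)" using assms(3) by (auto simp: less_SUP_iff)
  obtain y where y: "y \<in> D" "dist y z0 < r" using assms(2,4) unfolding closure_approachable by blast
  have "connected ((\<lambda>z. cmod (z - z0)) ` D)"
    by (intro connected_continuous_image assms(1) continuous_intros)
  then have "r \<in> (\<lambda>z. cmod (z - z0)) ` D"
    by (rule connectedD_interval[of _ "cmod (y - z0)" "cmod (z - z0)"])
       (use y z assms(5) in \<open>auto simp: dist_norm\<close>)
  then obtain w where "w \<in> D" "r = cmod (w - z0)" by auto
  then have "w \<in> sphere z0 r \<inter> D" by (simp add: dist_norm norm_minus_commute)
  then show ?thesis by blast
qed

theorem theorem4p1: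
  fixes D :: "complex set" and \<mu> f :: "complex \<Rightarrow> complex" and z0 :: complex and \<epsilon> \<epsilon>0 :: real
  assumes "open D" and "connected D"
    and "\<mu> \<in> borel_measurable (lebesgue_on D)"
    and "AE z in lebesgue_on D. cmod (\<mu> z) < 1"
    and "homeomorphic_W11_loc_solution \<mu> D f"
    and "z0 \<in> closure D"
    and "0 < \<epsilon>0" and "ereal \<epsilon>0 < (SUP z\<in>D. ereal (cmod (z - z0)))"
    and "0 < \<epsilon>" and "\<epsilon> < \<epsilon>0"
  shows "modulus (image_family f (circle_family D z0 \<epsilon> \<epsilon>0)) \<ge>
    (INF \<rho>\<in>ext_adm (circle_family D z0 \<epsilon> \<epsilon>0).
       \<integral>\<^sup>+z. (\<rho> z)\<^sup>2 / ennreal (tangent_dilatation \<mu> z z0) \<partial>lebesgue_on D)"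
proof -
  note D = \<open>open D\<close>
  have Dl: "D \<inter> space lebesgue \<in> sets lebesgue" using D by simp
  obtain g fx fy where hom: "homeomorphism D (f ` D) f g" and W: "W11_loc_partials D f fx fy"
    and eq: "AE z in lebesgue_on D. (fx z + \<i> * fy z) / 2 = \<mu> z * ((fx z - \<i> * fy z) / 2)"
    using assms(5) unfolding homeomorphic_W11_loc_solution_def by blast
  have fc: "continuous_on D f" and finj: "inj_on f D"
    using hom unfolding homeomorphism_def by (auto intro: inj_on_inverseI)
  obtain gx where gx: "gx \<in> borel_measurable borel" "AE z in lborel. z \<in> D \<longrightarrow> fx z = gx z"
    "\<And>K. compact K \<Longrightarrow> K \<subseteq> D \<Longrightarrow> set_integrable lborel K gx"
    using Borel_representative[OF D, of fx] W unfolding W11_loc_partials_def by blast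
  obtain gy where gy: "gy \<in> borel_measurable borel" "AE z in lborel. z \<in> D \<longrightarrow> fy z = gy z"
    "\<And>K. compact K \<Longrightarrow> K \<subseteq> D \<Longrightarrow> set_integrable lborel K gy"
    using Borel_representative[OF D, of fy] W unfolding W11_loc_partials_def by blast
  define F where "F = (\<lambda>z. if z \<in> D then f z else 0)"
  interpret weakly_differentiable D F gx gy
  proof
    show "continuous_on D F" using fc by (simp add: F_def cong: continuous_on_cong)
    show "F z = 0" if "z \<notin> D" for z using that by (simp add: F_def)
    fix \<phi> assume \<phi>: "test_function D \<phi>"
    show "(\<integral>z. frechet_derivative \<phi> (at z) 1 *\<^sub>R F z \<partial>lborel) = - (\<integral>z. \<phi> z *\<^sub>R gx z \<partial>lborel)"
      unfolding F_def
      by (rule weak_derivative_lborel[OF D _ fc gx(1,2) \<phi>]) (use W in \<open>auto simp: W11_loc_partials_def\<close>)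
    show "(\<integral>z. frechet_derivative \<phi> (at z) \<i> *\<^sub>R F z \<partial>lborel) = - (\<integral>z. \<phi> z *\<^sub>R gy z \<partial>lborel)"
      unfolding F_def
      by (rule weak_derivative_lborel[OF D _ fc gy(1,2) \<phi>]) (use W in \<open>auto simp: W11_loc_partials_def\<close>)
  qed (fact D gx gy)+
  have injF: "inj_on F D" using finj by (simp add: F_def inj_on_def)
  have fF: "f z = F z" if "z \<in> D" for z using that by (simp add: F_def)
  have meets: "sphere z0 r \<inter> D \<noteq> {}" if "\<epsilon> < r" "r < \<epsilon>0" for r
    by (rule circle_meets_domain[OF assms(2,6,8)]) (use that assms(9) in auto)
  have lt1: "AE z in lborel. z \<in> D \<longrightarrow> cmod (\<mu> z) < 1"
    using assms(4) unfolding AE_restrict_space_iff[OF Dl] AE_completion_iff .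
  have beltrami: "AE z in lborel. z \<in> D \<longrightarrow> (fx z + \<i> * fy z) / 2 = \<mu> z * ((fx z - \<i> * fy z) / 2)"
    using eq unfolding AE_restrict_space_iff[OF Dl] AE_completion_iff .
  have jac: "AE z in lborel. z \<in> D \<longrightarrow>
     (pullback_density z0 \<rho> z)\<^sup>2 / ennreal (tangent_dilatation \<mu> z z0) = ennreal (jacobian z) * (\<rho> (F z))\<^sup>2"
    for \<rho> :: "complex \<Rightarrow> ennreal"
  proof -
    have "AE z in lborel. z \<noteq> z0" by (rule AE_lborel_singleton)
    from AE_conjI[OF this AE_conjI[OF AE_conjI[OF lt1 beltrami] AE_conjI[OF gx(2) gy(2)]]]
    show ?thesis
    proof (rule AE_mp, intro AE_I2 impI)
      fix z assume h: "z \<noteq> z0 \<and> ((z \<in> D \<longrightarrow> cmod (\<mu> z) < 1) \<and> (z \<in> D \<longrightarrow> (fx z + \<i> * fy z) / 2 = \<mu> z * ((fx z - \<i> * fy z) / 2))) \<and>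
          (z \<in> D \<longrightarrow> fx z = gx z) \<and> (z \<in> D \<longrightarrow> fy z = gy z)" and zD: "z \<in> D"
      define k where "k = tangent_dilatation \<mu> z z0"
      define d where "d = cmod (dir_deriv (\<i> * sgn (z - z0)) z)"
      have "(gx z + \<i> * gy z) / 2 = \<mu> z * ((gx z - \<i> * gy z) / 2)" using h zD by auto
      from tangential_derivative_squared[OF _ _ this, of z z0] h zD
      have d: "d\<^sup>2 = jacobian z * k" and k: "0 < k"
        by (simp_all add: d_def k_def dir_deriv_def jacobian_def tangent_dilatation_def)
      have "(pullback_density z0 \<rho> z)\<^sup>2 / ennreal k = (\<rho> (F z))\<^sup>2 * (ennreal d)\<^sup>2 / ennreal k"
        using zD by (simp add: pullback_density_def d_def power_mult_distrib)
      also have "(ennreal d)\<^sup>2 = ennreal (jacobian z * k)"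
        unfolding d[symmetric] by (rule ennreal_power) (simp add: d_def)
      also have "(\<rho> (F z))\<^sup>2 * ennreal (jacobian z * k) / ennreal k = (\<rho> (F z))\<^sup>2 * (ennreal (jacobian z * k) / ennreal k)"
        by (simp only: ennreal_times_divide)
      also have "ennreal (jacobian z * k) / ennreal k = ennreal (jacobian z)"
        using k by (subst divide_ennreal) (simp_all add: jacobian_def)
      finally show "(pullback_density z0 \<rho> z)\<^sup>2 / ennreal (tangent_dilatation \<mu> z z0) = ennreal (jacobian z) * (\<rho> (F z))\<^sup>2"
        unfolding k_def by (simp only: mult.commute)
    qed
  qed
  show ?thesis
    unfolding modulus_def[of "image_family f (circle_family D z0 \<epsilon> \<epsilon>0)"]
  proof (rule INF_greatest)
    fix \<rho> assume \<rho>: "\<rho> \<in> adm (image_family f (circle_family D z0 \<epsilon> \<epsilon>0))"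
    then have [measurable]: "\<rho> \<in> borel_measurable borel" by (simp add: adm_def)
    have adm: "pullback_density z0 \<rho> \<in> ext_adm (circle_family D z0 \<epsilon> \<epsilon>0)"
      by (rule pullback_density_ext_adm[OF \<rho> fF assms(9) meets])
    have "(\<integral>\<^sup>+z. (pullback_density z0 \<rho> z)\<^sup>2 / ennreal (tangent_dilatation \<mu> z z0) \<partial>lebesgue_on D)
       = (\<integral>\<^sup>+z\<in>D. (pullback_density z0 \<rho> z)\<^sup>2 / ennreal (tangent_dilatation \<mu> z z0) \<partial>lborel)"
      unfolding nn_integral_restrict_space[OF Dl] nn_integral_completion ..
    also have "\<dots> = (\<integral>\<^sup>+z\<in>D. ennreal (jacobian z) * (\<rho> (F z))\<^sup>2 \<partial>lborel)"
      by (rule nn_integral_cong_AE, rule AE_mp[OF jac[of \<rho>]], intro AE_I2) (simp add: indicator_def)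
    also have "\<dots> \<le> (\<integral>\<^sup>+z. (\<rho> z)\<^sup>2 \<partial>lborel)"
      by (rule area_inequality_homeomorphism[OF injF]) measurable
    finally show "(INF \<rho>\<in>ext_adm (circle_family D z0 \<epsilon> \<epsilon>0). \<integral>\<^sup>+z. (\<rho> z)\<^sup>2 / ennreal (tangent_dilatation \<mu> z z0) \<partial>lebesgue_on D)
        \<le> (\<integral>\<^sup>+z. (\<rho> z)\<^sup>2 \<partial>lborel)"
      by (rule INF_lower2[OF adm])
  qed
qed

end
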